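(* Let $\mathcal{C}$ be a cofibrantly generated monoidal model category such that the domains of the generating cofibrations can be taken to be cofibrant. Let $A$ and $A'$ be monoids in $\mathcal{C}$ which are cofibrant as objects of $\mathcal{C}$, and let $f\colon A\to A'$ be a homomorphism of monoids which is a weak equivalence in $\mathcal{C}$. Then the induction functor induced by $f$ and its right adjoint, the restriction functor, define a Quillen equivalence from the model category of left (resp. right) $A$-modules to the model category of left (resp. right) $A'$-modules.
   Context: Model categories are bicomplete and have functorial factorizations; $Q$ denotes the functorial cofibrant replacement, with natural trivial fibration $q\colon QX\to X$. Monoidal model category: a model category $\mathcal{C}$ with a closed monoidal structure, with product $\wedge$ and unit $S$ (closed: both $X\wedge -$ and $-\wedge X$ have right adjoints natural in $X$), such that: (a) for cofibrations $f\colon A\to B$ and $g\colon X\to Y$, the pushout smash product $f\mathbin{\square} g\colon (A\wedge Y)\amalg_{A\wedge X}(B\wedge X)\to B\wedge Y$ is a cofibration, which is a weak equivalence if $f$ or $g$ is; (b) the maps $q\wedge X\colon QS\wedge X\to S\wedge X\cong X$ and $X\wedge q\colon X\wedge QS\to X$ are weak equivalences for all cofibrant $X$. The monoidal structure is not assumed symmetric. Smallness: an object $A$ of a cocomplete category $\mathcal{C}$ is small relative to a class of maps (subcategory) $\mathcal{D}$ if there is a cofinal class $\Sigma$ of ordinals (every ordinal is $\le$ some member of $\Sigma$) such that for all $\alpha\in \Sigma$ and all colimit-preserving functors $X\colon\alpha\to\mathcal{C}$ with each $X_\beta\to X_{\beta+1}$ in $\mathcal{D}$, the map $\operatorname{colim}_{\beta<\alpha}\mathcal{C}(A,X_\beta)\to\mathcal{C}(A,\operatorname{colim}_{\beta<\alpha}X_\beta)$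 is an isomorphism. Cofibrantly generated: there are sets $I$ (generating cofibrations) and $J$ (generating trivial cofibrations) of maps such that the domains of $I$ are small relative to the cofibrations, the domains of $J$ are small relative to the trivial cofibrations, the fibrations are exactly the maps with the right lifting property with respect to $J$, and the trivial fibrations are exactly the maps with the right lifting property with respect to $I$. "The domains of the generating cofibrations can be taken to be cofibrant" means that $I$, $J$ can be chosen so that every domain of a map of $I$ is cofibrant. For a monoid $A$ which is cofibrant in $\mathcal{C}$, the category of left (or right) $A$-modules has the model structure in which a map is a weak equivalence (fibration) if and only if it is one in $\mathcal{C}$, and cofibrations are the maps with the left lifting property with respect to the trivial fibrations; this is a cofibrantly generated model structure. For left modules, induction along $f$ is $M\mapsto A'\wedge_A M$ (for right modules, $M\mapsto M\wedge_A A'$), and restriction regards an $A'$-module as an $A$-module via $f$. A functor $F$ between model categories with right adjoint $U$ is left Quillen if it preserves cofibrations and trivial cofibrations; it is a Quillen equivalence if moreover for all cofibrant $X$ in the source and fibrant $Y$ in the target, a map $FX\to Y$ is a weak equivalence if and only if its adjoint $X\to UY$ is. *)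

theory Defs
  imports Main
begin

unbundle cardinal_syntax

section \<open>Categories, functors, adjunctions\<close>

text \<open>
  Arrows know their domain and codomain. All conditions are relativised to the sets of objects and
  arrows, so a category is not tied to full types.
\<close>

record ('o, 'm) cat =
  Obj :: "'o set"
  Arr :: "'m set"
  Dom :: "'m \<Rightarrow> 'o"
  Cod :: "'m \<Rightarrow> 'o"
  Ident :: "'o \<Rightarrow> 'm"
  Comp :: "'m \<Rightarrow> 'm \<Rightarrow> 'm" (infixr \<open>\<cdot>\<index>\<close> 70)

definition hom :: "('o, 'm, 'z) cat_scheme \<Rightarrow> 'o \<Rightarrow> 'o \<Rightarrow> 'm set" where
  "hom C X Y = {f \<in> Arr C. Dom C f = X \<and> Cod C f = Y}"

locale category =
  fixes C :: "('o, 'm, 'z) cat_scheme" (structure)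
  assumes dom_obj: "f \<in> Arr C \<Longrightarrow> Dom C f \<in> Obj C"
    and cod_obj: "f \<in> Arr C \<Longrightarrow> Cod C f \<in> Obj C"
    and ident_hom: "X \<in> Obj C \<Longrightarrow> Ident C X \<in> hom C X X"
    and comp_hom: "f \<in> hom C X Y \<Longrightarrow> g \<in> hom C Y Z \<Longrightarrow> g \<cdot> f \<in> hom C X Z"
    and ident_left: "f \<in> hom C X Y \<Longrightarrow> Ident C Y \<cdot> f = f"
    and ident_right: "f \<in> hom C X Y \<Longrightarrow> f \<cdot> Ident C X = f"
    and comp_assoc: "f \<in> hom C W X \<Longrightarrow> g \<in> hom C X Y \<Longrightarrow> h \<in> hom C Y Z \<Longrightarrow>
      (h \<cdot> g) \<cdot> f = h \<cdot> (g \<cdot> f)"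

definition is_iso :: "('o, 'm, 'z) cat_scheme \<Rightarrow> 'm \<Rightarrow> bool" where
  "is_iso C f \<longleftrightarrow> f \<in> Arr C \<and>
    (\<exists>g \<in> hom C (Cod C f) (Dom C f).
      g \<cdot>\<^bsub>C\<^esub> f = Ident C (Dom C f) \<and> f \<cdot>\<^bsub>C\<^esub> g = Ident C (Cod C f))"

definition op_cat :: "('o, 'm, 'z) cat_scheme \<Rightarrow> ('o, 'm) cat" where
  "op_cat C = \<lparr>Obj = Obj C, Arr = Arr C, Dom = Cod C, Cod = Dom C, Ident = Ident C,
    Comp = (\<lambda>g f. f \<cdot>\<^bsub>C\<^esub> g)\<rparr>"

definition prod_cat ::
  "('o, 'm, 'z) cat_scheme \<Rightarrow> ('p, 'n, 'y) cat_scheme \<Rightarrow> ('o \<times> 'p, 'm \<times> 'n) cat" where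
  "prod_cat C D = \<lparr>Obj = Obj C \<times> Obj D, Arr = Arr C \<times> Arr D,
    Dom = map_prod (Dom C) (Dom D), Cod = map_prod (Cod C) (Cod D),
    Ident = map_prod (Ident C) (Ident D),
    Comp = (\<lambda>(g, g') (f, f'). (g \<cdot>\<^bsub>C\<^esub> f, g' \<cdot>\<^bsub>D\<^esub> f'))\<rparr>"

text \<open>An arrow from \<open>f\<close> to \<open>g\<close> in the arrow category is a commutative square, recorded as
  \<open>(f, u, v, g)\<close> with \<open>g \<cdot> u = v \<cdot> f\<close>.\<close>

definition arrow_cat :: "('o, 'm, 'z) cat_scheme \<Rightarrow> ('m, 'm \<times> 'm \<times> 'm \<times> 'm) cat" where
  "arrow_cat C = \<lparr>Obj = Arr C,
    Arr = {(f, u, v, g). f \<in> Arr C \<and> g \<in> Arr C \<and> u \<in> hom C (Dom C f) (Dom C g) \<and>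
      v \<in> hom C (Cod C f) (Cod C g) \<and> g \<cdot>\<^bsub>C\<^esub> u = v \<cdot>\<^bsub>C\<^esub> f},
    Dom = (\<lambda>(f, u, v, g). f), Cod = (\<lambda>(f, u, v, g). g),
    Ident = (\<lambda>f. (f, Ident C (Dom C f), Ident C (Cod C f), f)),
    Comp = (\<lambda>(_, u', v', g) (f, u, v, _). (f, u' \<cdot>\<^bsub>C\<^esub> u, v' \<cdot>\<^bsub>C\<^esub> v, g))\<rparr>"

record ('o, 'm, 'p, 'n) fctr =
  on_obj :: "'o \<Rightarrow> 'p"
  on_arr :: "'m \<Rightarrow> 'n"

definition is_functor ::
  "('o, 'm, 'z) cat_scheme \<Rightarrow> ('p, 'n, 'y) cat_scheme \<Rightarrow> ('o, 'm, 'p, 'n) fctr \<Rightarrow> bool" where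
  "is_functor C D F \<longleftrightarrow> category C \<and> category D \<and>
    (\<forall>X \<in> Obj C. on_obj F X \<in> Obj D) \<and>
    (\<forall>f \<in> Arr C. on_arr F f \<in> hom D (on_obj F (Dom C f)) (on_obj F (Cod C f))) \<and>
    (\<forall>X \<in> Obj C. on_arr F (Ident C X) = Ident D (on_obj F X)) \<and>
    (\<forall>f \<in> Arr C. \<forall>g \<in> Arr C. Dom C g = Cod C f \<longrightarrow>
      on_arr F (g \<cdot>\<^bsub>C\<^esub> f) = on_arr F g \<cdot>\<^bsub>D\<^esub> on_arr F f)"

definition id_fctr :: "('o, 'm, 'o, 'm) fctr" where
  "id_fctr = \<lparr>on_obj = (\<lambda>X. X), on_arr = (\<lambda>f. f)\<rparr>"

definition comp_fctr ::
  "('p, 'n, 'q, 'k) fctr \<Rightarrow> ('o, 'm, 'p, 'n) fctr \<Rightarrow> ('o, 'm, 'q, 'k) fctr" where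
  "comp_fctr G F = \<lparr>on_obj = on_obj G \<circ> on_obj F, on_arr = on_arr G \<circ> on_arr F\<rparr>"

definition nat_transf ::
  "('o, 'm, 'z) cat_scheme \<Rightarrow> ('p, 'n, 'y) cat_scheme \<Rightarrow>
    ('o, 'm, 'p, 'n) fctr \<Rightarrow> ('o, 'm, 'p, 'n) fctr \<Rightarrow> ('o \<Rightarrow> 'n) \<Rightarrow> bool" where
  "nat_transf C D F G t \<longleftrightarrow> is_functor C D F \<and> is_functor C D G \<and>
    (\<forall>X \<in> Obj C. t X \<in> hom D (on_obj F X) (on_obj G X)) \<and>
    (\<forall>f \<in> Arr C. t (Cod C f) \<cdot>\<^bsub>D\<^esub> on_arr F f = on_arr G f \<cdot>\<^bsub>D\<^esub> t (Dom C f))"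

text \<open>\<open>F\<close> is left adjoint to \<open>U\<close>; \<open>\<phi> X Y\<close> sends \<open>F X \<rightarrow> Y\<close> to its adjoint \<open>X \<rightarrow> U Y\<close>.\<close>

definition adjunction ::
  "('o, 'm, 'z) cat_scheme \<Rightarrow> ('p, 'n, 'y) cat_scheme \<Rightarrow>
    ('o, 'm, 'p, 'n) fctr \<Rightarrow> ('p, 'n, 'o, 'm) fctr \<Rightarrow> ('o \<Rightarrow> 'p \<Rightarrow> 'n \<Rightarrow> 'm) \<Rightarrow> bool" where
  "adjunction C D F U \<phi> \<longleftrightarrow> is_functor C D F \<and> is_functor D C U \<and>
    (\<forall>X \<in> Obj C. \<forall>Y \<in> Obj D.
      bij_betw (\<phi> X Y) (hom D (on_obj F X) Y) (hom C X (on_obj U Y))) \<and>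
    (\<forall>x \<in> Arr C. \<forall>y \<in> Arr D. \<forall>h \<in> hom D (on_obj F (Cod C x)) (Dom D y).
      \<phi> (Dom C x) (Cod D y) (y \<cdot>\<^bsub>D\<^esub> (h \<cdot>\<^bsub>D\<^esub> on_arr F x)) =
      on_arr U y \<cdot>\<^bsub>C\<^esub> (\<phi> (Cod C x) (Dom D y) h \<cdot>\<^bsub>C\<^esub> x))"

section \<open>Limits and colimits\<close>

definition is_cocone ::
  "('j, 'u, 'y) cat_scheme \<Rightarrow> ('o, 'm, 'z) cat_scheme \<Rightarrow> ('j, 'u, 'o, 'm) fctr \<Rightarrow>
    'o \<Rightarrow> ('j \<Rightarrow> 'm) \<Rightarrow> bool" where
  "is_cocone J C D L c \<longleftrightarrow> L \<in> Obj C \<and> (\<forall>j \<in> Obj J. c j \<in> hom C (on_obj D j) L) \<and>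
    (\<forall>u \<in> Arr J. c (Cod J u) \<cdot>\<^bsub>C\<^esub> on_arr D u = c (Dom J u))"

definition is_colimit ::
  "('j, 'u, 'y) cat_scheme \<Rightarrow> ('o, 'm, 'z) cat_scheme \<Rightarrow> ('j, 'u, 'o, 'm) fctr \<Rightarrow>
    'o \<Rightarrow> ('j \<Rightarrow> 'm) \<Rightarrow> bool" where
  "is_colimit J C D L c \<longleftrightarrow> is_cocone J C D L c \<and>
    (\<forall>L' c'. is_cocone J C D L' c' \<longrightarrow>
      (\<exists>!h. h \<in> hom C L L' \<and> (\<forall>j \<in> Obj J. h \<cdot>\<^bsub>C\<^esub> c j = c' j)))"

definition is_cone ::
  "('j, 'u, 'y) cat_scheme \<Rightarrow> ('o, 'm, 'z) cat_scheme \<Rightarrow> ('j, 'u, 'o, 'm) fctr \<Rightarrow>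
    'o \<Rightarrow> ('j \<Rightarrow> 'm) \<Rightarrow> bool" where
  "is_cone J C D L c \<longleftrightarrow> L \<in> Obj C \<and> (\<forall>j \<in> Obj J. c j \<in> hom C L (on_obj D j)) \<and>
    (\<forall>u \<in> Arr J. on_arr D u \<cdot>\<^bsub>C\<^esub> c (Dom J u) = c (Cod J u))"

definition is_limit ::
  "('j, 'u, 'y) cat_scheme \<Rightarrow> ('o, 'm, 'z) cat_scheme \<Rightarrow> ('j, 'u, 'o, 'm) fctr \<Rightarrow>
    'o \<Rightarrow> ('j \<Rightarrow> 'm) \<Rightarrow> bool" where
  "is_limit J C D L c \<longleftrightarrow> is_cone J C D L c \<and>
    (\<forall>L' c'. is_cone J C D L' c' \<longrightarrow>
      (\<exists>!h. h \<in> hom C L' L \<and> (\<forall>j \<in> Obj J. c j \<cdot>\<^bsub>C\<^esub> h = c' j)))"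

text \<open>
  Size: an auxiliary type \<open>'u\<close> plays the role of the universe. A set is small if its cardinality is
  strictly below that of \<open>'u\<close>, and small diagrams and small ordinals are represented on subsets
  of \<open>'u\<close>. If the cardinality of \<open>'u\<close> is strongly inaccessible, the small sets are, up to
  bijection, those of a Grothendieck universe.
\<close>

definition small_set :: "'u itself \<Rightarrow> 'a set \<Rightarrow> bool" where
  "small_set _ X \<longleftrightarrow> |X| <o |UNIV :: 'u set|"

definition small_cat :: "'u itself \<Rightarrow> ('j, 'k, 'z) cat_scheme \<Rightarrow> bool" where
  "small_cat u J \<longleftrightarrow> category J \<and> small_set u (Obj J) \<and> small_set u (Arr J)"

definition bicomplete :: "'u itself \<Rightarrow> ('o, 'm, 'z) cat_scheme \<Rightarrow> bool" where
  "bicomplete u C \<longleftrightarrow> category C \<and>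
    (\<forall>(J :: ('u, 'u) cat) D. small_cat u J \<and> is_functor J C D \<longrightarrow>
      (\<exists>L c. is_colimit J C D L c) \<and> (\<exists>L c. is_limit J C D L c))"

definition preserves_colimits ::
  "'u itself \<Rightarrow> ('p, 'n, 'y) cat_scheme \<Rightarrow> ('o, 'm, 'z) cat_scheme \<Rightarrow>
    ('p, 'n, 'o, 'm) fctr \<Rightarrow> bool" where
  "preserves_colimits u K C F \<longleftrightarrow> is_functor K C F \<and>
    (\<forall>(J :: ('u, 'u) cat) D L c. small_cat u J \<and> is_functor J K D \<and> is_colimit J K D L c \<longrightarrow>
      is_colimit J C (comp_fctr F D) (on_obj F L) (on_arr F \<circ> c))"

definition is_initial :: "('o, 'm, 'z) cat_scheme \<Rightarrow> 'o \<Rightarrow> bool" where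
  "is_initial C Z \<longleftrightarrow> Z \<in> Obj C \<and> (\<forall>X \<in> Obj C. \<exists>!f. f \<in> hom C Z X)"

definition is_terminal :: "('o, 'm, 'z) cat_scheme \<Rightarrow> 'o \<Rightarrow> bool" where
  "is_terminal C T \<longleftrightarrow> T \<in> Obj C \<and> (\<forall>X \<in> Obj C. \<exists>!f. f \<in> hom C X T)"

definition is_pushout :: "('o, 'm, 'z) cat_scheme \<Rightarrow> 'm \<Rightarrow> 'm \<Rightarrow> 'm \<Rightarrow> 'm \<Rightarrow> bool" where
  "is_pushout C f g i j \<longleftrightarrow>
    f \<in> Arr C \<and> g \<in> Arr C \<and> i \<in> Arr C \<and> j \<in> Arr C \<and>
    Dom C f = Dom C g \<and> Dom C i = Cod C f \<and> Dom C j = Cod C g \<and> Cod C i = Cod C j \<and>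
    i \<cdot>\<^bsub>C\<^esub> f = j \<cdot>\<^bsub>C\<^esub> g \<and>
    (\<forall>Z. \<forall>i' \<in> hom C (Cod C f) Z. \<forall>j' \<in> hom C (Cod C g) Z. i' \<cdot>\<^bsub>C\<^esub> f = j' \<cdot>\<^bsub>C\<^esub> g \<longrightarrow>
      (\<exists>!h. h \<in> hom C (Cod C i) Z \<and> h \<cdot>\<^bsub>C\<^esub> i = i' \<and> h \<cdot>\<^bsub>C\<^esub> j = j'))"

definition is_coequalizer :: "('o, 'm, 'z) cat_scheme \<Rightarrow> 'm \<Rightarrow> 'm \<Rightarrow> 'm \<Rightarrow> bool" where
  "is_coequalizer C s t p \<longleftrightarrow>
    s \<in> Arr C \<and> t \<in> Arr C \<and> p \<in> Arr C \<and>
    Dom C s = Dom C t \<and> Cod C s = Cod C t \<and> Dom C p = Cod C s \<and>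
    p \<cdot>\<^bsub>C\<^esub> s = p \<cdot>\<^bsub>C\<^esub> t \<and>
    (\<forall>Z. \<forall>p' \<in> hom C (Cod C s) Z. p' \<cdot>\<^bsub>C\<^esub> s = p' \<cdot>\<^bsub>C\<^esub> t \<longrightarrow>
      (\<exists>!h. h \<in> hom C (Cod C p) Z \<and> h \<cdot>\<^bsub>C\<^esub> p = p'))"

section \<open>Model categories\<close>

record ('o, 'm) model_cat = "('o, 'm) cat" +
  Weq :: "'m set"
  Cof :: "'m set"
  Fib :: "'m set"

definition wide_subcategory :: "('o, 'm, 'z) cat_scheme \<Rightarrow> 'm set \<Rightarrow> bool" where
  "wide_subcategory C W \<longleftrightarrow> W \<subseteq> Arr C \<and> (\<forall>X \<in> Obj C. Ident C X \<in> W) \<and>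
    (\<forall>f \<in> W. \<forall>g \<in> W. Dom C g = Cod C f \<longrightarrow> g \<cdot>\<^bsub>C\<^esub> f \<in> W)"

definition retract_of :: "('o, 'm, 'z) cat_scheme \<Rightarrow> 'm \<Rightarrow> 'm \<Rightarrow> bool" where
  "retract_of C f g \<longleftrightarrow> f \<in> Arr C \<and> g \<in> Arr C \<and>
    (\<exists>a \<in> hom C (Dom C f) (Dom C g). \<exists>b \<in> hom C (Cod C f) (Cod C g).
     \<exists>r \<in> hom C (Dom C g) (Dom C f). \<exists>s \<in> hom C (Cod C g) (Cod C f).
      g \<cdot>\<^bsub>C\<^esub> a = b \<cdot>\<^bsub>C\<^esub> f \<and> f \<cdot>\<^bsub>C\<^esub> r = s \<cdot>\<^bsub>C\<^esub> g \<and>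
      r \<cdot>\<^bsub>C\<^esub> a = Ident C (Dom C f) \<and> s \<cdot>\<^bsub>C\<^esub> b = Ident C (Cod C f))"

text \<open>\<open>i\<close> has the left lifting property with respect to \<open>p\<close>.\<close>

definition lifts :: "('o, 'm, 'z) cat_scheme \<Rightarrow> 'm \<Rightarrow> 'm \<Rightarrow> bool" where
  "lifts C i p \<longleftrightarrow>
    (\<forall>u \<in> hom C (Dom C i) (Dom C p). \<forall>v \<in> hom C (Cod C i) (Cod C p).
      p \<cdot>\<^bsub>C\<^esub> u = v \<cdot>\<^bsub>C\<^esub> i \<longrightarrow>
      (\<exists>h \<in> hom C (Cod C i) (Dom C p). h \<cdot>\<^bsub>C\<^esub> i = u \<and> p \<cdot>\<^bsub>C\<^esub> h = v))"

text \<open>A functorial factorization \<open>f = r f \<cdot> l f\<close> through \<open>on_obj E f\<close>, with \<open>l\<close> and \<open>r\<close> natural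
  with respect to commutative squares.\<close>

definition functorial_factorization ::
  "('o, 'm, 'z) cat_scheme \<Rightarrow> ('m, 'm \<times> 'm \<times> 'm \<times> 'm, 'o, 'm) fctr \<Rightarrow>
    ('m \<Rightarrow> 'm) \<Rightarrow> ('m \<Rightarrow> 'm) \<Rightarrow> bool" where
  "functorial_factorization C E l r \<longleftrightarrow> is_functor (arrow_cat C) C E \<and>
    (\<forall>f \<in> Arr C. l f \<in> hom C (Dom C f) (on_obj E f) \<and> r f \<in> hom C (on_obj E f) (Cod C f) \<and>
      r f \<cdot>\<^bsub>C\<^esub> l f = f) \<and>
    (\<forall>(f, u, v, g) \<in> Arr (arrow_cat C).
      on_arr E (f, u, v, g) \<cdot>\<^bsub>C\<^esub> l f = l g \<cdot>\<^bsub>C\<^esub> u \<and>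
      r g \<cdot>\<^bsub>C\<^esub> on_arr E (f, u, v, g) = v \<cdot>\<^bsub>C\<^esub> r f)"

definition model_category :: "'u itself \<Rightarrow> ('o, 'm, 'z) model_cat_scheme \<Rightarrow> bool" where
  "model_category u C \<longleftrightarrow> bicomplete u C \<and>
    wide_subcategory C (Weq C) \<and> wide_subcategory C (Cof C) \<and> wide_subcategory C (Fib C) \<and>
    (\<forall>f \<in> Arr C. \<forall>g \<in> Arr C. Dom C g = Cod C f \<longrightarrow>
      (f \<in> Weq C \<and> g \<in> Weq C \<longrightarrow> g \<cdot>\<^bsub>C\<^esub> f \<in> Weq C) \<and>
      (f \<in> Weq C \<and> g \<cdot>\<^bsub>C\<^esub> f \<in> Weq C \<longrightarrow> g \<in> Weq C) \<and>
      (g \<in> Weq C \<and> g \<cdot>\<^bsub>C\<^esub> f \<in> Weq C \<longrightarrow> f \<in> Weq C)) \<and>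
    (\<forall>f g. retract_of C f g \<longrightarrow>
      (g \<in> Weq C \<longrightarrow> f \<in> Weq C) \<and> (g \<in> Cof C \<longrightarrow> f \<in> Cof C) \<and> (g \<in> Fib C \<longrightarrow> f \<in> Fib C)) \<and>
    (\<forall>i \<in> Cof C. \<forall>p \<in> Fib C. i \<in> Weq C \<or> p \<in> Weq C \<longrightarrow> lifts C i p) \<and>
    (\<exists>E l r. functorial_factorization C E l r \<and>
      (\<forall>f \<in> Arr C. l f \<in> Cof C \<and> r f \<in> Fib C \<inter> Weq C)) \<and>
    (\<exists>E l r. functorial_factorization C E l r \<and>
      (\<forall>f \<in> Arr C. l f \<in> Cof C \<inter> Weq C \<and> r f \<in> Fib C))"

definition cofibrant :: "('o, 'm, 'z) model_cat_scheme \<Rightarrow> 'o \<Rightarrow> bool" where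
  "cofibrant C X \<longleftrightarrow> (\<exists>Z f. is_initial C Z \<and> f \<in> hom C Z X \<and> f \<in> Cof C)"

definition fibrant :: "('o, 'm, 'z) model_cat_scheme \<Rightarrow> 'o \<Rightarrow> bool" where
  "fibrant C X \<longleftrightarrow> (\<exists>T f. is_terminal C T \<and> f \<in> hom C X T \<and> f \<in> Fib C)"

definition functorial_cofibrant_replacement ::
  "('o, 'm, 'z) model_cat_scheme \<Rightarrow> ('o, 'm, 'o, 'm) fctr \<Rightarrow> ('o \<Rightarrow> 'm) \<Rightarrow> bool" where
  "functorial_cofibrant_replacement C Q q \<longleftrightarrow> nat_transf C C Q id_fctr q \<and>
    (\<forall>X \<in> Obj C. cofibrant C (on_obj Q X) \<and> q X \<in> Fib C \<inter> Weq C)"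

definition left_quillen ::
  "'u itself \<Rightarrow> ('o, 'm, 'z) model_cat_scheme \<Rightarrow> ('p, 'n, 'y) model_cat_scheme \<Rightarrow>
    ('o, 'm, 'p, 'n) fctr \<Rightarrow> ('p, 'n, 'o, 'm) fctr \<Rightarrow> ('o \<Rightarrow> 'p \<Rightarrow> 'n \<Rightarrow> 'm) \<Rightarrow> bool" where
  "left_quillen u C D F U \<phi> \<longleftrightarrow> model_category u C \<and> model_category u D \<and>
    adjunction C D F U \<phi> \<and>
    (\<forall>f \<in> Cof C. on_arr F f \<in> Cof D) \<and>
    (\<forall>f \<in> Cof C \<inter> Weq C. on_arr F f \<in> Cof D \<inter> Weq D)"

definition quillen_equivalence ::
  "'u itself \<Rightarrow> ('o, 'm, 'z) model_cat_scheme \<Rightarrow> ('p, 'n, 'y) model_cat_scheme \<Rightarrow>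
    ('o, 'm, 'p, 'n) fctr \<Rightarrow> ('p, 'n, 'o, 'm) fctr \<Rightarrow> bool" where
  "quillen_equivalence u C D F U \<longleftrightarrow> (\<exists>\<phi>. left_quillen u C D F U \<phi> \<and>
    (\<forall>X \<in> Obj C. \<forall>Y \<in> Obj D. cofibrant C X \<and> fibrant D Y \<longrightarrow>
      (\<forall>h \<in> hom D (on_obj F X) Y. h \<in> Weq D \<longleftrightarrow> \<phi> X Y h \<in> Weq C)))"

section \<open>Smallness and cofibrant generation\<close>

text \<open>An ordinal is given by a well-order \<open>r\<close> on a subset of \<open>'u\<close>, viewed as a poset category.\<close>

definition ord_cat :: "'u rel \<Rightarrow> ('u, 'u \<times> 'u) cat" where
  "ord_cat r = \<lparr>Obj = Field r, Arr = r, Dom = fst, Cod = snd, Ident = (\<lambda>x. (x, x)),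
    Comp = (\<lambda>(_, c) (a, _). (a, c))\<rparr>"

definition small_ordinal :: "'u rel \<Rightarrow> bool" where
  "small_ordinal r \<longleftrightarrow> Well_order r \<and> small_set TYPE('u) (Field r)"

definition immediate_succ :: "'u rel \<Rightarrow> 'u \<Rightarrow> 'u \<Rightarrow> bool" where
  "immediate_succ r b b' \<longleftrightarrow> (b, b') \<in> r \<and> b \<noteq> b' \<and>
    (\<forall>d. (b, d) \<in> r \<and> (d, b') \<in> r \<longrightarrow> d = b \<or> d = b')"

text \<open>
  The colimit in sets of the directed system \<open>hom A (X b)\<close>, as the quotient of the disjoint union
  identifying elements that become equal at a later stage, and its canonical map to \<open>hom A L\<close> for a
  cocone \<open>c\<close> with vertex \<open>L\<close>.
\<close>

definition hom_colim_rel ::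
  "('o, 'm, 'z) cat_scheme \<Rightarrow> 'o \<Rightarrow> 'u rel \<Rightarrow> ('u, 'u \<times> 'u, 'o, 'm) fctr \<Rightarrow> ('u \<times> 'm) rel" where
  "hom_colim_rel C A r X = {((b, g), (b', g')). b \<in> Field r \<and> b' \<in> Field r \<and>
    g \<in> hom C A (on_obj X b) \<and> g' \<in> hom C A (on_obj X b') \<and>
    (\<exists>d. (b, d) \<in> r \<and> (b', d) \<in> r \<and>
      on_arr X (b, d) \<cdot>\<^bsub>C\<^esub> g = on_arr X (b', d) \<cdot>\<^bsub>C\<^esub> g')}"

definition hom_colim ::
  "('o, 'm, 'z) cat_scheme \<Rightarrow> 'o \<Rightarrow> 'u rel \<Rightarrow> ('u, 'u \<times> 'u, 'o, 'm) fctr \<Rightarrow> ('u \<times> 'm) set set" where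
  "hom_colim C A r X = (SIGMA b : Field r. hom C A (on_obj X b)) // hom_colim_rel C A r X"

definition hom_colim_map ::
  "('o, 'm, 'z) cat_scheme \<Rightarrow> ('u \<Rightarrow> 'm) \<Rightarrow> ('u \<times> 'm) set \<Rightarrow> 'm" where
  "hom_colim_map C c K = the_elem ((\<lambda>(b, g). c b \<cdot>\<^bsub>C\<^esub> g) ` K)"

text \<open>The class \<open>\<Sigma>\<close> is only required to be cofinal; it may contain successor ordinals. The sequences
  preserve all small colimits existing in the ordinal, including the empty one.\<close>

definition small_object ::
  "'u itself \<Rightarrow> ('o, 'm, 'z) cat_scheme \<Rightarrow> 'm set \<Rightarrow> 'o \<Rightarrow> bool" where
  "small_object u C D A \<longleftrightarrow> A \<in> Obj C \<and>
    (\<exists>\<Sigma> :: 'u rel set. (\<forall>r \<in> \<Sigma>. small_ordinal r) \<and>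
      (\<forall>s :: 'u rel. small_ordinal s \<longrightarrow> (\<exists>r \<in> \<Sigma>. s \<le>o r)) \<and>
      (\<forall>r \<in> \<Sigma>. \<forall>X. preserves_colimits u (ord_cat r) C X \<and>
        (\<forall>b b'. immediate_succ r b b' \<longrightarrow> on_arr X (b, b') \<in> D) \<longrightarrow>
        (\<forall>L c. is_colimit (ord_cat r) C X L c \<longrightarrow>
          bij_betw (hom_colim_map C c) (hom_colim C A r X) (hom C A L))))"

definition cofibrantly_generated_by ::
  "'u itself \<Rightarrow> ('o, 'm, 'z) model_cat_scheme \<Rightarrow> 'm set \<Rightarrow> 'm set \<Rightarrow> bool" where
  "cofibrantly_generated_by u C I J \<longleftrightarrow> I \<subseteq> Arr C \<and> J \<subseteq> Arr C \<and>
    small_set u I \<and> small_set u J \<and>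
    (\<forall>i \<in> I. small_object u C (Cof C) (Dom C i)) \<and>
    (\<forall>j \<in> J. small_object u C (Cof C \<inter> Weq C) (Dom C j)) \<and>
    Fib C = {p \<in> Arr C. \<forall>j \<in> J. lifts C j p} \<and>
    Fib C \<inter> Weq C = {p \<in> Arr C. \<forall>i \<in> I. lifts C i p}"

section \<open>Monoidal model categories\<close>

record ('o, 'm) monoidal_model_cat = "('o, 'm) model_cat" +
  TensO :: "'o \<Rightarrow> 'o \<Rightarrow> 'o" (infixr \<open>\<odot>\<index>\<close> 75)
  TensA :: "'m \<Rightarrow> 'm \<Rightarrow> 'm" (infixr \<open>\<otimes>\<index>\<close> 75)
  Unit :: "'o"
  Assoc :: "'o \<Rightarrow> 'o \<Rightarrow> 'o \<Rightarrow> 'm"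
  LUnit :: "'o \<Rightarrow> 'm"
  RUnit :: "'o \<Rightarrow> 'm"
  QFun :: "('o, 'm, 'o, 'm) fctr"
  QMap :: "'o \<Rightarrow> 'm"

definition tensor_fctr ::
  "('o, 'm, 'z) monoidal_model_cat_scheme \<Rightarrow> ('o \<times> 'o, 'm \<times> 'm, 'o, 'm) fctr" where
  "tensor_fctr C = \<lparr>on_obj = (\<lambda>(X, Y). X \<odot>\<^bsub>C\<^esub> Y), on_arr = (\<lambda>(f, g). f \<otimes>\<^bsub>C\<^esub> g)\<rparr>"

locale monoidal_category = category C
  for C :: "('o, 'm, 'z) monoidal_model_cat_scheme" (structure) +
  assumes tensor_functor: "is_functor (prod_cat C C) C (tensor_fctr C)"
    and unit_obj: "Unit C \<in> Obj C"
    and assoc_hom: "X \<in> Obj C \<Longrightarrow> Y \<in> Obj C \<Longrightarrow> Z \<in> Obj C \<Longrightarrow>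
      Assoc C X Y Z \<in> hom C ((X \<odot> Y) \<odot> Z) (X \<odot> (Y \<odot> Z)) \<and> is_iso C (Assoc C X Y Z)"
    and assoc_natural: "f \<in> hom C X X' \<Longrightarrow> g \<in> hom C Y Y' \<Longrightarrow> h \<in> hom C Z Z' \<Longrightarrow>
      Assoc C X' Y' Z' \<cdot> ((f \<otimes> g) \<otimes> h) = (f \<otimes> (g \<otimes> h)) \<cdot> Assoc C X Y Z"
    and lunit_hom: "X \<in> Obj C \<Longrightarrow> LUnit C X \<in> hom C (Unit C \<odot> X) X \<and> is_iso C (LUnit C X)"
    and lunit_natural: "f \<in> hom C X X' \<Longrightarrow>
      LUnit C X' \<cdot> (Ident C (Unit C) \<otimes> f) = f \<cdot> LUnit C X"
    and runit_hom: "X \<in> Obj C \<Longrightarrow> RUnit C X \<in> hom C (X \<odot> Unit C) X \<and> is_iso C (RUnit C X)"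
    and runit_natural: "f \<in> hom C X X' \<Longrightarrow>
      RUnit C X' \<cdot> (f \<otimes> Ident C (Unit C)) = f \<cdot> RUnit C X"
    and pentagon: "W \<in> Obj C \<Longrightarrow> X \<in> Obj C \<Longrightarrow> Y \<in> Obj C \<Longrightarrow> Z \<in> Obj C \<Longrightarrow>
      Assoc C W X (Y \<odot> Z) \<cdot> Assoc C (W \<odot> X) Y Z =
      (Ident C W \<otimes> Assoc C X Y Z) \<cdot> (Assoc C W (X \<odot> Y) Z \<cdot> (Assoc C W X Y \<otimes> Ident C Z))"
    and triangle: "X \<in> Obj C \<Longrightarrow> Y \<in> Obj C \<Longrightarrow>
      (Ident C X \<otimes> LUnit C Y) \<cdot> Assoc C X (Unit C) Y = RUnit C X \<otimes> Ident C Y"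

text \<open>\<open>H\<close> is a functor on the product of the opposite of \<open>C\<close> with \<open>C\<close>; for fixed first argument \<open>X\<close>
  it is right adjoint to tensoring with \<open>X\<close> (from the left, resp. from the right), naturally in \<open>X\<close>.\<close>

definition fix_fst ::
  "('o, 'm, 'z) cat_scheme \<Rightarrow> ('o \<times> 'o, 'm \<times> 'm, 'o, 'm) fctr \<Rightarrow> 'o \<Rightarrow> ('o, 'm, 'o, 'm) fctr" where
  "fix_fst C H X = \<lparr>on_obj = (\<lambda>Z. on_obj H (X, Z)), on_arr = (\<lambda>z. on_arr H (Ident C X, z))\<rparr>"

definition fix_snd ::
  "('o, 'm, 'z) cat_scheme \<Rightarrow> ('o \<times> 'o, 'm \<times> 'm, 'o, 'm) fctr \<Rightarrow> 'o \<Rightarrow> ('o, 'm, 'o, 'm) fctr" where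
  "fix_snd C H X = \<lparr>on_obj = (\<lambda>Z. on_obj H (Z, X)), on_arr = (\<lambda>z. on_arr H (z, Ident C X))\<rparr>"

definition closed_monoidal :: "('o, 'm, 'z) monoidal_model_cat_scheme \<Rightarrow> bool" where
  "closed_monoidal C \<longleftrightarrow> monoidal_category C \<and>
    (\<exists>H \<phi>. is_functor (prod_cat (op_cat C) C) C H \<and>
      (\<forall>X \<in> Obj C. adjunction C C (fix_fst C (tensor_fctr C) X) (fix_fst C H X) (\<phi> X)) \<and>
      (\<forall>x \<in> Arr C. \<forall>Y \<in> Obj C. \<forall>Z \<in> Obj C. \<forall>h \<in> hom C (Cod C x \<odot>\<^bsub>C\<^esub> Y) Z.
        \<phi> (Dom C x) Y Z (h \<cdot>\<^bsub>C\<^esub> (x \<otimes>\<^bsub>C\<^esub> Ident C Y)) =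
        on_arr H (x, Ident C Z) \<cdot>\<^bsub>C\<^esub> \<phi> (Cod C x) Y Z h)) \<and>
    (\<exists>H \<phi>. is_functor (prod_cat (op_cat C) C) C H \<and>
      (\<forall>X \<in> Obj C. adjunction C C (fix_snd C (tensor_fctr C) X) (fix_fst C H X) (\<phi> X)) \<and>
      (\<forall>x \<in> Arr C. \<forall>Y \<in> Obj C. \<forall>Z \<in> Obj C. \<forall>h \<in> hom C (Y \<odot>\<^bsub>C\<^esub> Cod C x) Z.
        \<phi> (Dom C x) Y Z (h \<cdot>\<^bsub>C\<^esub> (Ident C Y \<otimes>\<^bsub>C\<^esub> x)) =
        on_arr H (x, Ident C Z) \<cdot>\<^bsub>C\<^esub> \<phi> (Cod C x) Y Z h))"

text \<open>\<open>k\<close> is a pushout smash product of \<open>f : A \<rightarrow> B\<close> and \<open>g : X \<rightarrow> Y\<close>, formed with respect to some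
  choice of the pushout of \<open>A \<odot> Y \<leftarrow> A \<odot> X \<rightarrow> B \<odot> X\<close>.\<close>

definition is_pushout_product ::
  "('o, 'm, 'z) monoidal_model_cat_scheme \<Rightarrow> 'm \<Rightarrow> 'm \<Rightarrow> 'm \<Rightarrow> bool" where
  "is_pushout_product C f g k \<longleftrightarrow>
    (\<exists>i j. is_pushout C (Ident C (Dom C f) \<otimes>\<^bsub>C\<^esub> g) (f \<otimes>\<^bsub>C\<^esub> Ident C (Dom C g)) i j \<and>
      k \<in> hom C (Cod C i) (Cod C f \<odot>\<^bsub>C\<^esub> Cod C g) \<and>
      k \<cdot>\<^bsub>C\<^esub> i = f \<otimes>\<^bsub>C\<^esub> Ident C (Cod C g) \<and>
      k \<cdot>\<^bsub>C\<^esub> j = Ident C (Cod C f) \<otimes>\<^bsub>C\<^esub> g)"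

definition monoidal_model_category ::
  "'u itself \<Rightarrow> ('o, 'm, 'z) monoidal_model_cat_scheme \<Rightarrow> bool" where
  "monoidal_model_category u C \<longleftrightarrow> model_category u C \<and> closed_monoidal C \<and>
    functorial_cofibrant_replacement C (QFun C) (QMap C) \<and>
    (\<forall>f \<in> Cof C. \<forall>g \<in> Cof C. \<forall>k. is_pushout_product C f g k \<longrightarrow>
      k \<in> Cof C \<and> (f \<in> Weq C \<or> g \<in> Weq C \<longrightarrow> k \<in> Weq C)) \<and>
    (\<forall>X \<in> Obj C. cofibrant C X \<longrightarrow>
      LUnit C X \<cdot>\<^bsub>C\<^esub> (QMap C (Unit C) \<otimes>\<^bsub>C\<^esub> Ident C X) \<in> Weq C \<and>
      RUnit C X \<cdot>\<^bsub>C\<^esub> (Ident C X \<otimes>\<^bsub>C\<^esub> QMap C (Unit C)) \<in> Weq C)"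

section \<open>Monoids and modules\<close>

record ('o, 'm) mon =
  MObj :: "'o"
  MMul :: "'m"
  MOne :: "'m"

definition monoid_in :: "('o, 'm, 'z) monoidal_model_cat_scheme \<Rightarrow> ('o, 'm) mon \<Rightarrow> bool" where
  "monoid_in C A \<longleftrightarrow> MObj A \<in> Obj C \<and>
    MMul A \<in> hom C (MObj A \<odot>\<^bsub>C\<^esub> MObj A) (MObj A) \<and> MOne A \<in> hom C (Unit C) (MObj A) \<and>
    MMul A \<cdot>\<^bsub>C\<^esub> (MMul A \<otimes>\<^bsub>C\<^esub> Ident C (MObj A)) =
      MMul A \<cdot>\<^bsub>C\<^esub> (Ident C (MObj A) \<otimes>\<^bsub>C\<^esub> MMul A) \<cdot>\<^bsub>C\<^esub> Assoc C (MObj A) (MObj A) (MObj A) \<and>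
    MMul A \<cdot>\<^bsub>C\<^esub> (MOne A \<otimes>\<^bsub>C\<^esub> Ident C (MObj A)) = LUnit C (MObj A) \<and>
    MMul A \<cdot>\<^bsub>C\<^esub> (Ident C (MObj A) \<otimes>\<^bsub>C\<^esub> MOne A) = RUnit C (MObj A)"

definition monoid_hom_in ::
  "('o, 'm, 'z) monoidal_model_cat_scheme \<Rightarrow> ('o, 'm) mon \<Rightarrow> ('o, 'm) mon \<Rightarrow> 'm \<Rightarrow> bool" where
  "monoid_hom_in C A A' f \<longleftrightarrow> f \<in> hom C (MObj A) (MObj A') \<and>
    f \<cdot>\<^bsub>C\<^esub> MMul A = MMul A' \<cdot>\<^bsub>C\<^esub> (f \<otimes>\<^bsub>C\<^esub> f) \<and> f \<cdot>\<^bsub>C\<^esub> MOne A = MOne A'"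

text \<open>Left modules are pairs \<open>(X, a)\<close> with action \<open>a : A \<odot> X \<rightarrow> X\<close>, right modules pairs with action
  \<open>a : X \<odot> A \<rightarrow> X\<close>. Module maps are triples (domain, underlying arrow, codomain).\<close>

type_synonym ('o, 'm) mdl = "'o \<times> 'm"
type_synonym ('o, 'm) mdl_map = "('o, 'm) mdl \<times> 'm \<times> ('o, 'm) mdl"

definition left_module ::
  "('o, 'm, 'z) monoidal_model_cat_scheme \<Rightarrow> ('o, 'm) mon \<Rightarrow> ('o, 'm) mdl \<Rightarrow> bool" where
  "left_module C A = (\<lambda>(X, a). X \<in> Obj C \<and> a \<in> hom C (MObj A \<odot>\<^bsub>C\<^esub> X) X \<and>
    a \<cdot>\<^bsub>C\<^esub> (MMul A \<otimes>\<^bsub>C\<^esub> Ident C X) =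
      a \<cdot>\<^bsub>C\<^esub> (Ident C (MObj A) \<otimes>\<^bsub>C\<^esub> a) \<cdot>\<^bsub>C\<^esub> Assoc C (MObj A) (MObj A) X \<and>
    a \<cdot>\<^bsub>C\<^esub> (MOne A \<otimes>\<^bsub>C\<^esub> Ident C X) = LUnit C X)"

definition right_module ::
  "('o, 'm, 'z) monoidal_model_cat_scheme \<Rightarrow> ('o, 'm) mon \<Rightarrow> ('o, 'm) mdl \<Rightarrow> bool" where
  "right_module C A = (\<lambda>(X, a). X \<in> Obj C \<and> a \<in> hom C (X \<odot>\<^bsub>C\<^esub> MObj A) X \<and>
    a \<cdot>\<^bsub>C\<^esub> (a \<otimes>\<^bsub>C\<^esub> Ident C (MObj A)) =
      a \<cdot>\<^bsub>C\<^esub> (Ident C X \<otimes>\<^bsub>C\<^esub> MMul A) \<cdot>\<^bsub>C\<^esub> Assoc C X (MObj A) (MObj A) \<and>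
    a \<cdot>\<^bsub>C\<^esub> (Ident C X \<otimes>\<^bsub>C\<^esub> MOne A) = RUnit C X)"

definition left_mod_cat ::
  "('o, 'm, 'z) monoidal_model_cat_scheme \<Rightarrow> ('o, 'm) mon \<Rightarrow>
    (('o, 'm) mdl, ('o, 'm) mdl_map) cat" where
  "left_mod_cat C A = \<lparr>Obj = {M. left_module C A M},
    Arr = {(M, h, N). left_module C A M \<and> left_module C A N \<and> h \<in> hom C (fst M) (fst N) \<and>
      h \<cdot>\<^bsub>C\<^esub> snd M = snd N \<cdot>\<^bsub>C\<^esub> (Ident C (MObj A) \<otimes>\<^bsub>C\<^esub> h)},
    Dom = (\<lambda>(M, h, N). M), Cod = (\<lambda>(M, h, N). N),
    Ident = (\<lambda>M. (M, Ident C (fst M), M)),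
    Comp = (\<lambda>(_, k, P) (M, h, _). (M, k \<cdot>\<^bsub>C\<^esub> h, P))\<rparr>"

definition right_mod_cat ::
  "('o, 'm, 'z) monoidal_model_cat_scheme \<Rightarrow> ('o, 'm) mon \<Rightarrow>
    (('o, 'm) mdl, ('o, 'm) mdl_map) cat" where
  "right_mod_cat C A = \<lparr>Obj = {M. right_module C A M},
    Arr = {(M, h, N). right_module C A M \<and> right_module C A N \<and> h \<in> hom C (fst M) (fst N) \<and>
      h \<cdot>\<^bsub>C\<^esub> snd M = snd N \<cdot>\<^bsub>C\<^esub> (h \<otimes>\<^bsub>C\<^esub> Ident C (MObj A))},
    Dom = (\<lambda>(M, h, N). M), Cod = (\<lambda>(M, h, N). N),
    Ident = (\<lambda>M. (M, Ident C (fst M), M)),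
    Comp = (\<lambda>(_, k, P) (M, h, _). (M, k \<cdot>\<^bsub>C\<^esub> h, P))\<rparr>"

text \<open>The classes of maps on a category \<open>K\<close> of modules determined by the underlying-arrow map: weak
  equivalences and fibrations as in \<open>C\<close>, cofibrations by the left lifting property in \<open>K\<close> with
  respect to the trivial fibrations. Nothing is asserted here about these classes satisfying the
  model category axioms.\<close>

definition module_model ::
  "('o, 'm, 'z) model_cat_scheme \<Rightarrow> (('o, 'm) mdl, ('o, 'm) mdl_map) cat \<Rightarrow>
    (('o, 'm) mdl, ('o, 'm) mdl_map) model_cat" where
  "module_model C K = \<lparr>Obj = Obj K, Arr = Arr K, Dom = Dom K, Cod = Cod K, Ident = Ident K,
    Comp = Comp K,
    Weq = {(M, h, N) \<in> Arr K. h \<in> Weq C},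
    Cof = {i \<in> Arr K. \<forall>(M, h, N) \<in> Arr K. h \<in> Fib C \<inter> Weq C \<longrightarrow> lifts K i (M, h, N)},
    Fib = {(M, h, N) \<in> Arr K. h \<in> Fib C}\<rparr>"

definition left_modules ::
  "('o, 'm, 'z) monoidal_model_cat_scheme \<Rightarrow> ('o, 'm) mon \<Rightarrow>
    (('o, 'm) mdl, ('o, 'm) mdl_map) model_cat" where
  "left_modules C A = module_model C (left_mod_cat C A)"

definition right_modules ::
  "('o, 'm, 'z) monoidal_model_cat_scheme \<Rightarrow> ('o, 'm) mon \<Rightarrow>
    (('o, 'm) mdl, ('o, 'm) mdl_map) model_cat" where
  "right_modules C A = module_model C (right_mod_cat C A)"

section \<open>Restriction and induction\<close>

definition left_res_obj ::
  "('o, 'm, 'z) monoidal_model_cat_scheme \<Rightarrow> 'm \<Rightarrow> ('o, 'm) mdl \<Rightarrow> ('o, 'm) mdl" where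
  "left_res_obj C f = (\<lambda>(X, a). (X, a \<cdot>\<^bsub>C\<^esub> (f \<otimes>\<^bsub>C\<^esub> Ident C X)))"

definition left_restriction ::
  "('o, 'm, 'z) monoidal_model_cat_scheme \<Rightarrow> 'm \<Rightarrow>
    (('o, 'm) mdl, ('o, 'm) mdl_map, ('o, 'm) mdl, ('o, 'm) mdl_map) fctr" where
  "left_restriction C f = \<lparr>on_obj = left_res_obj C f,
    on_arr = (\<lambda>(M, h, N). (left_res_obj C f M, h, left_res_obj C f N))\<rparr>"

definition right_res_obj ::
  "('o, 'm, 'z) monoidal_model_cat_scheme \<Rightarrow> 'm \<Rightarrow> ('o, 'm) mdl \<Rightarrow> ('o, 'm) mdl" where
  "right_res_obj C f = (\<lambda>(X, a). (X, a \<cdot>\<^bsub>C\<^esub> (Ident C X \<otimes>\<^bsub>C\<^esub> f)))"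

definition right_restriction ::
  "('o, 'm, 'z) monoidal_model_cat_scheme \<Rightarrow> 'm \<Rightarrow>
    (('o, 'm) mdl, ('o, 'm) mdl_map, ('o, 'm) mdl, ('o, 'm) mdl_map) fctr" where
  "right_restriction C f = \<lparr>on_obj = right_res_obj C f,
    on_arr = (\<lambda>(M, h, N). (right_res_obj C f M, h, right_res_obj C f N))\<rparr>"

text \<open>
  For a right \<open>A\<close>-module \<open>M = (X, a)\<close> and a left \<open>A\<close>-module \<open>N = (Y, b)\<close>, a chosen projection
  \<open>X \<odot> Y \<rightarrow> M \<and>\<^sub>A N\<close>: a coequalizer of the two actions \<open>(X \<odot> A) \<odot> Y \<rightrightarrows> X \<odot> Y\<close>.
\<close>

definition rel_tensor_proj ::
  "('o, 'm, 'z) monoidal_model_cat_scheme \<Rightarrow> ('o, 'm) mon \<Rightarrow> ('o, 'm) mdl \<Rightarrow> ('o, 'm) mdl \<Rightarrow> 'm" where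
  "rel_tensor_proj C A = (\<lambda>(X, a) (Y, b). SOME p. is_coequalizer C
    (a \<otimes>\<^bsub>C\<^esub> Ident C Y) ((Ident C X \<otimes>\<^bsub>C\<^esub> b) \<cdot>\<^bsub>C\<^esub> Assoc C X (MObj A) Y) p)"

text \<open>
  \<open>A'\<close> as a right \<open>A\<close>-module along \<open>f\<close>, and the projection \<open>A' \<odot> X \<rightarrow> A' \<and>\<^sub>A M\<close> for a left module
  \<open>M = (X, a)\<close>. The action of \<open>A'\<close> on \<open>A' \<and>\<^sub>A M\<close> is the one descending from the multiplication of
  \<open>A'\<close>; it is unique because \<open>A' \<odot> -\<close> preserves coequalizers in a closed monoidal category. The right
  module version is symmetric.
\<close>

definition left_ind_proj ::
  "('o, 'm, 'z) monoidal_model_cat_scheme \<Rightarrow> ('o, 'm) mon \<Rightarrow> ('o, 'm) mon \<Rightarrow> 'm \<Rightarrow>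
    ('o, 'm) mdl \<Rightarrow> 'm" where
  "left_ind_proj C A A' f M = rel_tensor_proj C A (right_res_obj C f (MObj A', MMul A')) M"

definition left_ind_obj ::
  "('o, 'm, 'z) monoidal_model_cat_scheme \<Rightarrow> ('o, 'm) mon \<Rightarrow> ('o, 'm) mon \<Rightarrow> 'm \<Rightarrow>
    ('o, 'm) mdl \<Rightarrow> ('o, 'm) mdl" where
  "left_ind_obj C A A' f M = (let p = left_ind_proj C A A' f M; X = fst M in
    (Cod C p, THE b. b \<in> hom C (MObj A' \<odot>\<^bsub>C\<^esub> Cod C p) (Cod C p) \<and>
      b \<cdot>\<^bsub>C\<^esub> (Ident C (MObj A') \<otimes>\<^bsub>C\<^esub> p) \<cdot>\<^bsub>C\<^esub> Assoc C (MObj A') (MObj A') X =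
      p \<cdot>\<^bsub>C\<^esub> (MMul A' \<otimes>\<^bsub>C\<^esub> Ident C X)))"

definition left_induction ::
  "('o, 'm, 'z) monoidal_model_cat_scheme \<Rightarrow> ('o, 'm) mon \<Rightarrow> ('o, 'm) mon \<Rightarrow> 'm \<Rightarrow>
    (('o, 'm) mdl, ('o, 'm) mdl_map, ('o, 'm) mdl, ('o, 'm) mdl_map) fctr" where
  "left_induction C A A' f = \<lparr>on_obj = left_ind_obj C A A' f,
    on_arr = (\<lambda>(M, h, N). (left_ind_obj C A A' f M,
      THE k. k \<in> hom C (Cod C (left_ind_proj C A A' f M)) (Cod C (left_ind_proj C A A' f N)) \<and>
        k \<cdot>\<^bsub>C\<^esub> left_ind_proj C A A' f M =
        left_ind_proj C A A' f N \<cdot>\<^bsub>C\<^esub> (Ident C (MObj A') \<otimes>\<^bsub>C\<^esub> h),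
      left_ind_obj C A A' f N))\<rparr>"

definition right_ind_proj ::
  "('o, 'm, 'z) monoidal_model_cat_scheme \<Rightarrow> ('o, 'm) mon \<Rightarrow> ('o, 'm) mon \<Rightarrow> 'm \<Rightarrow>
    ('o, 'm) mdl \<Rightarrow> 'm" where
  "right_ind_proj C A A' f M = rel_tensor_proj C A M (left_res_obj C f (MObj A', MMul A'))"

definition right_ind_obj ::
  "('o, 'm, 'z) monoidal_model_cat_scheme \<Rightarrow> ('o, 'm) mon \<Rightarrow> ('o, 'm) mon \<Rightarrow> 'm \<Rightarrow>
    ('o, 'm) mdl \<Rightarrow> ('o, 'm) mdl" where
  "right_ind_obj C A A' f M = (let p = right_ind_proj C A A' f M; X = fst M in
    (Cod C p, THE b. b \<in> hom C (Cod C p \<odot>\<^bsub>C\<^esub> MObj A') (Cod C p) \<and>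
      b \<cdot>\<^bsub>C\<^esub> (p \<otimes>\<^bsub>C\<^esub> Ident C (MObj A')) =
      p \<cdot>\<^bsub>C\<^esub> (Ident C X \<otimes>\<^bsub>C\<^esub> MMul A') \<cdot>\<^bsub>C\<^esub> Assoc C X (MObj A') (MObj A')))"

definition right_induction ::
  "('o, 'm, 'z) monoidal_model_cat_scheme \<Rightarrow> ('o, 'm) mon \<Rightarrow> ('o, 'm) mon \<Rightarrow> 'm \<Rightarrow>
    (('o, 'm) mdl, ('o, 'm) mdl_map, ('o, 'm) mdl, ('o, 'm) mdl_map) fctr" where
  "right_induction C A A' f = \<lparr>on_obj = right_ind_obj C A A' f,
    on_arr = (\<lambda>(M, h, N). (right_ind_obj C A A' f M,
      THE k. k \<in> hom C (Cod C (right_ind_proj C A A' f M)) (Cod C (right_ind_proj C A A' f N)) \<and>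
        k \<cdot>\<^bsub>C\<^esub> right_ind_proj C A A' f M =
        right_ind_proj C A A' f N \<cdot>\<^bsub>C\<^esub> (h \<otimes>\<^bsub>C\<^esub> Ident C (MObj A')),
      right_ind_obj C A A' f N))\<rparr>"

end

(*
  Both functors M |-> M and M |-> A' /\_A M from A-modules to C are left Quillen, with right adjoints
  Z |-> [A, Z] and Z |-> [A', Z], the latter restricted along f. The unit M -> A' /\_A M corresponds under
  these adjunctions to [f, Z] : [A', Z] -> [A, Z], which is a weak equivalence for fibrant Z because f is a
  weak equivalence between cofibrant objects (Ken Brown). Hence for cofibrant M the unit induces bijections on
  homotopy classes of maps into fibrant objects of C, so it is a weak equivalence. Since restriction creates
  weak equivalences, this gives the Quillen equivalence. No transfinite induction on cells is needed.
  Right modules over C are left modules over C with the reversed product.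
*)

theory Submission
  imports Defs
begin

text \<open>The step from bijections on homotopy classes to a weak equivalence is made without
  quotients. Write N for the induced module and let r : M -> Z and r' : N -> Z' be fibrant
  replacements in \<open>C\<close>. Surjectivity gives v : N -> Z with v . unit homotopic to r; a
  map w extends r' . unit along r; injectivity makes w . v homotopic to r'. Hence v . unit and w . v
  are weak equivalences, and a two-of-six argument yields the unit. The homotopies are formed in
  \<open>A\<close>-modules, where M is cofibrant, and only then transposed to \<open>C\<close>: a
  left Quillen functor sends the ends of a cylinder to weak equivalences, and nothing more is asked
  of its image. The right adjoints rest on right multiplication of \<open>A\<close> on itself: (a .
  phi)(b) = phi(b a) on [A, Z], with evaluation at the unit as counit. The model structures on
  modules are hypotheses; their cofibrations are reached only through lifting. Since
  \<open>bicomplete\<close> speaks of diagrams indexed by subsets of the universe type, that type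
  has to be infinite for finite limits and colimits to be available.\<close>

lemma in_hom [simp]: "f \<in> hom C X Y \<longleftrightarrow> f \<in> Arr C \<and> Dom C f = X \<and> Cod C f = Y"
  by (simp add: hom_def)

section \<open>Categories and adjunctions\<close>

context category
begin

lemma obj_simps [simp]: "f \<in> Arr C \<Longrightarrow> Dom C f \<in> Obj C" "f \<in> Arr C \<Longrightarrow> Cod C f \<in> Obj C"
  using dom_obj cod_obj by auto

lemma ident_simps [simp]:
  assumes "X \<in> Obj C"
  shows "Ident C X \<in> Arr C" "Dom C (Ident C X) = X" "Cod C (Ident C X) = X"
  using ident_hom[OF assms] by auto

lemma comp_simps [simp]:
  assumes "f \<in> Arr C" "g \<in> Arr C" "Dom C g = Cod C f"
  shows "g \<cdot> f \<in> Arr C" "Dom C (g \<cdot> f) = Dom C f" "Cod C (g \<cdot> f) = Cod C g"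
  using comp_hom[of f "Dom C f" "Cod C f" g "Cod C g"] assms by auto

lemma comp_ident_left [simp]: "f \<in> Arr C \<Longrightarrow> Cod C f = X \<Longrightarrow> Ident C X \<cdot> f = f"
  using ident_left[of f "Dom C f" X] by simp

lemma comp_ident_right [simp]: "f \<in> Arr C \<Longrightarrow> Dom C f = X \<Longrightarrow> f \<cdot> Ident C X = f"
  using ident_right[of f X "Cod C f"] by simp

text \<open>Normal form of all calculations below: composites nest to the right. Where another
  bracketing exposes the redex, it is written out as a separate step and \<open>simp\<close> checks
  it.\<close>

lemma assoc_simp [simp]:
  assumes "f \<in> Arr C" "g \<in> Arr C" "h \<in> Arr C" "Dom C g = Cod C f" "Dom C h = Cod C g"
  shows "(h \<cdot> g) \<cdot> f = h \<cdot> (g \<cdot> f)"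
  using comp_assoc[of f "Dom C f" "Cod C f" g "Cod C g" h "Cod C h"] assms by auto

text \<open>After nesting to the right, the left side of \<open>g \<cdot> f = g' \<cdot> f'\<close>
  no longer occurs in \<open>g \<cdot> (f \<cdot> h)\<close>; this form rewrites there.\<close>

lemma comp_eq_extend:
  assumes "g \<cdot> f = g' \<cdot> f'" "f \<in> Arr C" "g \<in> Arr C" "Dom C g = Cod C f"
    "f' \<in> Arr C" "g' \<in> Arr C" "Dom C g' = Cod C f'" "h \<in> Arr C" "Cod C h = Dom C f"
  shows "g \<cdot> (f \<cdot> h) = g' \<cdot> (f' \<cdot> h)"
proof -
  have "Dom C f' = Dom C f" using assms(1-7) comp_simps(2) by metis
  then show ?thesis using assms assoc_simp by metis
qed

lemma comp_eq_extend1: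
  assumes "g \<cdot> f = k" "f \<in> Arr C" "g \<in> Arr C" "Dom C g = Cod C f" "h \<in> Arr C" "Cod C h = Dom C f"
  shows "g \<cdot> (f \<cdot> h) = k \<cdot> h"
  using assms assoc_simp by metis

text \<open>Inverses are unique, so the choice is harmless. A total function is wanted because the
  reversed product takes as its associator the inverse of the given one, uniformly in three
  objects.\<close>

definition "inverse_arr f = (SOME g. g \<in> hom C (Cod C f) (Dom C f) \<and>
  g \<cdot> f = Ident C (Dom C f) \<and> f \<cdot> g = Ident C (Cod C f))"

lemma inverse_arr [simp]:
  assumes "is_iso C f"
  shows "inverse_arr f \<in> Arr C" "Dom C (inverse_arr f) = Cod C f" "Cod C (inverse_arr f) = Dom C f"
    "inverse_arr f \<cdot> f = Ident C (Dom C f)" "f \<cdot> inverse_arr f = Ident C (Cod C f)"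
proof -
  from assms have "\<exists>g. g \<in> hom C (Cod C f) (Dom C f) \<and>
    g \<cdot> f = Ident C (Dom C f) \<and> f \<cdot> g = Ident C (Cod C f)"
    unfolding is_iso_def by blast
  from someI_ex[OF this, folded inverse_arr_def]
  show "inverse_arr f \<in> Arr C" "Dom C (inverse_arr f) = Cod C f" "Cod C (inverse_arr f) = Dom C f"
    "inverse_arr f \<cdot> f = Ident C (Dom C f)" "f \<cdot> inverse_arr f = Ident C (Cod C f)"
    by simp_all
qed

lemma inverse_arr_cancel [simp]:
  assumes "is_iso C f" "h \<in> Arr C"
  shows "Cod C h = Dom C f \<Longrightarrow> inverse_arr f \<cdot> (f \<cdot> h) = h"
    "Cod C h = Cod C f \<Longrightarrow> f \<cdot> (inverse_arr f \<cdot> h) = h"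
proof -
  have f: "f \<in> Arr C" using assms(1) by (simp add: is_iso_def)
  show "Cod C h = Dom C f \<Longrightarrow> inverse_arr f \<cdot> (f \<cdot> h) = h"
    "Cod C h = Cod C f \<Longrightarrow> f \<cdot> (inverse_arr f \<cdot> h) = h"
    using assms f comp_eq_extend1[of "inverse_arr f" f _ h] comp_eq_extend1[of f "inverse_arr f" _ h] by auto
qed

lemma liftsE:
  assumes "lifts C i p" "i \<in> Arr C" "p \<in> Arr C" "u \<in> hom C (Dom C i) (Dom C p)"
    "v \<in> hom C (Cod C i) (Cod C p)" "p \<cdot> u = v \<cdot> i"
  obtains h where "h \<in> hom C (Cod C i) (Dom C p)" "h \<cdot> i = u" "p \<cdot> h = v"
  using assms unfolding lifts_def by blast

end

section \<open>Functors, adjunctions and transposition of lifting problems\<close>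

lemma functorD:
  assumes "is_functor C D F"
  shows "category C" "category D" "X \<in> Obj C \<Longrightarrow> on_obj F X \<in> Obj D"
    "f \<in> Arr C \<Longrightarrow> on_arr F f \<in> Arr D"
    "f \<in> Arr C \<Longrightarrow> Dom D (on_arr F f) = on_obj F (Dom C f)"
    "f \<in> Arr C \<Longrightarrow> Cod D (on_arr F f) = on_obj F (Cod C f)"
    "X \<in> Obj C \<Longrightarrow> on_arr F (Ident C X) = Ident D (on_obj F X)"
    "f \<in> Arr C \<Longrightarrow> g \<in> Arr C \<Longrightarrow> Dom C g = Cod C f \<Longrightarrow>
      on_arr F (g \<cdot>\<^bsub>C\<^esub> f) = on_arr F g \<cdot>\<^bsub>D\<^esub> on_arr F f"
  using assms unfolding is_functor_def by auto

lemma adjunctionD: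
  assumes "adjunction C D F U \<phi>"
  shows "is_functor C D F" "is_functor D C U"
  using assms unfolding adjunction_def by auto

lemma adj_bij:
  assumes "adjunction C D F U \<phi>" "X \<in> Obj C" "Y \<in> Obj D"
  shows "bij_betw (\<phi> X Y) (hom D (on_obj F X) Y) (hom C X (on_obj U Y))"
  using assms unfolding adjunction_def by auto

lemma adj_hom:
  assumes "adjunction C D F U \<phi>" "X \<in> Obj C" "Y \<in> Obj D" "h \<in> hom D (on_obj F X) Y"
  shows "\<phi> X Y h \<in> hom C X (on_obj U Y)"
  using adj_bij[OF assms(1-3)] assms(4) unfolding bij_betw_def by blast

lemma adj_simps:
  assumes "adjunction C D F U \<phi>" "h \<in> Arr D" "Dom D h = on_obj F X" "Cod D h = Y" "X \<in> Obj C" "Y \<in> Obj D"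
  shows "\<phi> X Y h \<in> Arr C" "Dom C (\<phi> X Y h) = X" "Cod C (\<phi> X Y h) = on_obj U Y"
  using adj_hom[OF assms(1,5,6), of h] assms(2-4) by auto

lemma adj_nat:
  assumes "adjunction C D F U \<phi>" "x \<in> Arr C" "y \<in> Arr D" "h \<in> hom D (on_obj F (Cod C x)) (Dom D y)"
  shows "\<phi> (Dom C x) (Cod D y) (y \<cdot>\<^bsub>D\<^esub> (h \<cdot>\<^bsub>D\<^esub> on_arr F x)) =
      on_arr U y \<cdot>\<^bsub>C\<^esub> (\<phi> (Cod C x) (Dom D y) h \<cdot>\<^bsub>C\<^esub> x)"
  using assms unfolding adjunction_def by blast

lemma adj_inj:
  assumes "adjunction C D F U \<phi>" "X \<in> Obj C" "Y \<in> Obj D"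
    "h \<in> hom D (on_obj F X) Y" "k \<in> hom D (on_obj F X) Y" "\<phi> X Y h = \<phi> X Y k"
  shows "h = k"
  using inj_onD[OF bij_betw_imp_inj_on[OF adj_bij[OF assms(1-3)]] assms(6,4,5)] .

lemma adj_surj:
  assumes "adjunction C D F U \<phi>" "X \<in> Obj C" "Y \<in> Obj D" "g \<in> hom C X (on_obj U Y)"
  obtains h where "h \<in> hom D (on_obj F X) Y" "\<phi> X Y h = g"
  using adj_bij[OF assms(1-3)] assms(4) that unfolding bij_betw_def by (metis imageE)

text \<open>The naturality clause of \<open>adjunction\<close> varies both variables at once; an
  identity in one of them separates the two.\<close>

lemma adj_nat_left:
  assumes "adjunction C D F U \<phi>" "x \<in> Arr C" "Y \<in> Obj D" "h \<in> hom D (on_obj F (Cod C x)) Y"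
  shows "\<phi> (Dom C x) Y (h \<cdot>\<^bsub>D\<^esub> on_arr F x) = \<phi> (Cod C x) Y h \<cdot>\<^bsub>C\<^esub> x"
proof -
  note F = adjunctionD(1)[OF assms(1)] and U = adjunctionD(2)[OF assms(1)]
  interpret C: category C by (rule functorD[OF F])
  interpret D: category D by (rule functorD[OF F])
  note [simp] = functorD(3-)[OF F] functorD(3-)[OF U]
  have "\<phi> (Dom C x) (Cod D (Ident D Y)) (Ident D Y \<cdot>\<^bsub>D\<^esub> (h \<cdot>\<^bsub>D\<^esub> on_arr F x)) =
      on_arr U (Ident D Y) \<cdot>\<^bsub>C\<^esub> (\<phi> (Cod C x) (Dom D (Ident D Y)) h \<cdot>\<^bsub>C\<^esub> x)"
    by (rule adj_nat[OF assms(1)]) (use assms in auto)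
  moreover have "\<phi> (Cod C x) Y h \<in> hom C (Cod C x) (on_obj U Y)"
    using adj_simps[OF assms(1)] assms by simp
  ultimately show ?thesis using assms by simp
qed

lemma adj_nat_right:
  assumes "adjunction C D F U \<phi>" "X \<in> Obj C" "y \<in> Arr D" "h \<in> hom D (on_obj F X) (Dom D y)"
  shows "\<phi> X (Cod D y) (y \<cdot>\<^bsub>D\<^esub> h) = on_arr U y \<cdot>\<^bsub>C\<^esub> \<phi> X (Dom D y) h"
proof -
  note F = adjunctionD(1)[OF assms(1)] and U = adjunctionD(2)[OF assms(1)]
  interpret C: category C by (rule functorD[OF F])
  interpret D: category D by (rule functorD[OF F])
  note [simp] = functorD(3-)[OF F] functorD(3-)[OF U]
  have "\<phi> (Dom C (Ident C X)) (Cod D y) (y \<cdot>\<^bsub>D\<^esub> (h \<cdot>\<^bsub>D\<^esub> on_arr F (Ident C X))) =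
      on_arr U y \<cdot>\<^bsub>C\<^esub> (\<phi> (Cod C (Ident C X)) (Dom D y) h \<cdot>\<^bsub>C\<^esub> Ident C X)"
    by (rule adj_nat[OF assms(1)]) (use assms in auto)
  moreover have "\<phi> X (Dom D y) h \<in> hom C X (on_obj U (Dom D y))"
    using adj_simps[OF assms(1)] assms by simp
  ultimately show ?thesis using assms by simp
qed

text \<open>The square transposes to one between \<open>i\<close> and \<open>U p\<close>. Its lift
  transposes back, and injectivity of \<phi> turns the transposed triangles into the required
  ones.\<close>

lemma adj_lifts:
  assumes adj: "adjunction C D F U \<phi>" and i: "i \<in> Arr C" and p: "p \<in> Arr D" and L: "lifts C i (on_arr U p)"
  shows "lifts D (on_arr F i) p"
proof -
  note F = adjunctionD(1)[OF adj] and U = adjunctionD(2)[OF adj]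
  interpret C: category C by (rule functorD[OF F])
  interpret D: category D by (rule functorD[OF F])
  note [simp] = functorD(3-)[OF F] functorD(3-)[OF U] i p
  let ?\<phi>d = "\<phi> (Dom C i)" and ?\<phi>c = "\<phi> (Cod C i)"
  note nl = adj_nat_left[OF adj i] and nr = adj_nat_right[OF adj _ p]
  show ?thesis
    unfolding lifts_def
  proof (intro ballI impI)
    fix u v assume u: "u \<in> hom D (Dom D (on_arr F i)) (Dom D p)"
      and v: "v \<in> hom D (Cod D (on_arr F i)) (Cod D p)" and e: "p \<cdot>\<^bsub>D\<^esub> u = v \<cdot>\<^bsub>D\<^esub> on_arr F i"
    have "on_arr U p \<cdot>\<^bsub>C\<^esub> ?\<phi>d (Dom D p) u = ?\<phi>c (Cod D p) v \<cdot>\<^bsub>C\<^esub> i"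
      using nr[of "Dom C i" u] nl[of "Cod D p" v] u v e by simp
    then obtain h where h: "h \<in> hom C (Cod C i) (on_obj U (Dom D p))"
      "h \<cdot>\<^bsub>C\<^esub> i = ?\<phi>d (Dom D p) u" "on_arr U p \<cdot>\<^bsub>C\<^esub> h = ?\<phi>c (Cod D p) v"
      using C.liftsE[OF L i, of "?\<phi>d (Dom D p) u" "?\<phi>c (Cod D p) v"]
        adj_hom[OF adj, of "Dom C i" "Dom D p" u] adj_hom[OF adj, of "Cod C i" "Cod D p" v] u v by auto
    obtain h' where h': "h' \<in> hom D (on_obj F (Cod C i)) (Dom D p)" "?\<phi>c (Dom D p) h' = h"
      using adj_surj[OF adj, of "Cod C i" "Dom D p" h] h by auto
    have "h' \<cdot>\<^bsub>D\<^esub> on_arr F i = u"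
      by (rule adj_inj[OF adj, of "Dom C i" "Dom D p"]) (use u h h' nl[of "Dom D p" h'] in auto)
    moreover have "p \<cdot>\<^bsub>D\<^esub> h' = v"
      by (rule adj_inj[OF adj, of "Cod C i" "Cod D p"]) (use v h h' nr[of "Cod C i" h'] in auto)
    ultimately show "\<exists>h\<in>hom D (Cod D (on_arr F i)) (Dom D p). h \<cdot>\<^bsub>D\<^esub> on_arr F i = u \<and> p \<cdot>\<^bsub>D\<^esub> h = v"
      using h' by auto
  qed
qed

lemma functor_comp:
  assumes "is_functor C D F" "is_functor D E G"
  shows "is_functor C E (comp_fctr G F)"
  using assms unfolding is_functor_def comp_fctr_def by auto

lemma adjunction_comp:
  assumes F: "adjunction C D F U \<phi>" and G: "adjunction D E G T \<psi>"
  shows "adjunction C E (comp_fctr G F) (comp_fctr U T) (\<lambda>X Z h. \<phi> X (on_obj T Z) (\<psi> (on_obj F X) Z h))"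
proof -
  note f = adjunctionD[OF F] adjunctionD[OF G]
  interpret C: category C by (rule functorD[OF f(1)])
  interpret D: category D by (rule functorD[OF f(1)])
  interpret E: category E by (rule functorD[OF f(3)])
  note [simp] = functorD(3-)[OF f(1)] functorD(3-)[OF f(2)] functorD(3-)[OF f(3)] functorD(3-)[OF f(4)]
  have o: "on_obj (comp_fctr G F) X = on_obj G (on_obj F X)" "on_arr (comp_fctr G F) x = on_arr G (on_arr F x)"
    "on_obj (comp_fctr U T) Z = on_obj U (on_obj T Z)" "on_arr (comp_fctr U T) z = on_arr U (on_arr T z)"
    for X x Z z by (simp_all add: comp_fctr_def)
  show ?thesis
    unfolding adjunction_def o
  proof (intro conjI ballI)
    fix X Z assume "X \<in> Obj C" "Z \<in> Obj E"
    then show "bij_betw (\<lambda>h. \<phi> X (on_obj T Z) (\<psi> (on_obj F X) Z h))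
      (hom E (on_obj G (on_obj F X)) Z) (hom C X (on_obj U (on_obj T Z)))"
      using bij_betw_trans[OF adj_bij[OF G] adj_bij[OF F]] by (simp add: comp_def)
  next
    fix x z h assume x: "x \<in> Arr C" and z: "z \<in> Arr E" and h: "h \<in> hom E (on_obj G (on_obj F (Cod C x))) (Dom E z)"
    let ?h = "\<psi> (on_obj F (Cod C x)) (Dom E z) h"
    have h': "?h \<in> hom D (on_obj F (Cod C x)) (on_obj T (Dom E z))"
      using adj_simps[OF G] x z h by simp
    have 1: "\<psi> (Dom D (on_arr F x)) (Cod E z) (z \<cdot>\<^bsub>E\<^esub> (h \<cdot>\<^bsub>E\<^esub> on_arr G (on_arr F x))) =
      on_arr T z \<cdot>\<^bsub>D\<^esub> (\<psi> (Cod D (on_arr F x)) (Dom E z) h \<cdot>\<^bsub>D\<^esub> on_arr F x)"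
      by (rule adj_nat[OF G]) (use x z h in auto)
    have 2: "\<phi> (Dom C x) (Cod D (on_arr T z)) (on_arr T z \<cdot>\<^bsub>D\<^esub> (?h \<cdot>\<^bsub>D\<^esub> on_arr F x)) =
      on_arr U (on_arr T z) \<cdot>\<^bsub>C\<^esub> (\<phi> (Cod C x) (Dom D (on_arr T z)) ?h \<cdot>\<^bsub>C\<^esub> x)"
      by (rule adj_nat[OF F]) (use x z h' in auto)
    show "\<phi> (Dom C x) (on_obj T (Cod E z)) (\<psi> (on_obj F (Dom C x)) (Cod E z) (z \<cdot>\<^bsub>E\<^esub> h \<cdot>\<^bsub>E\<^esub> on_arr G (on_arr F x))) =
      on_arr U (on_arr T z) \<cdot>\<^bsub>C\<^esub> \<phi> (Cod C x) (on_obj T (Dom E z)) ?h \<cdot>\<^bsub>C\<^esub> x"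
      using 1 2 x z by simp
  qed (use functor_comp f in blast)+
qed

text \<open>Suited to a left adjoint whose values are picked by a universal property, as for
  induction: the functor laws of \<open>F\<close> are not assumed but follow from
  uniqueness.\<close>

lemma adjunction_from_unit:
  assumes C: "category C" and U: "is_functor D C U"
    and Fo: "\<And>X. X \<in> Obj C \<Longrightarrow> on_obj F X \<in> Obj D"
    and Fa: "\<And>x. x \<in> Arr C \<Longrightarrow> on_arr F x \<in> hom D (on_obj F (Dom C x)) (on_obj F (Cod C x))"
    and \<eta>: "\<And>X. X \<in> Obj C \<Longrightarrow> \<eta> X \<in> hom C X (on_obj U (on_obj F X))"
    and nat: "\<And>x. x \<in> Arr C \<Longrightarrow> on_arr U (on_arr F x) \<cdot>\<^bsub>C\<^esub> \<eta> (Dom C x) = \<eta> (Cod C x) \<cdot>\<^bsub>C\<^esub> x"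
    and univ: "\<And>X Y g. X \<in> Obj C \<Longrightarrow> Y \<in> Obj D \<Longrightarrow> g \<in> hom C X (on_obj U Y) \<Longrightarrow>
      \<exists>!h. h \<in> hom D (on_obj F X) Y \<and> on_arr U h \<cdot>\<^bsub>C\<^esub> \<eta> X = g"
  shows "adjunction C D F U (\<lambda>X Y h. on_arr U h \<cdot>\<^bsub>C\<^esub> \<eta> X)"
proof -
  interpret C: category C by (rule C)
  interpret D: category D by (rule functorD[OF U])
  note [simp] = functorD(3-)[OF U] Fo
  have \<eta>' [simp]: "\<eta> X \<in> Arr C" "Dom C (\<eta> X) = X" "Cod C (\<eta> X) = on_obj U (on_obj F X)" if "X \<in> Obj C" for X
    using \<eta>[OF that] by auto
  have Fa' [simp]: "on_arr F x \<in> Arr D" "Dom D (on_arr F x) = on_obj F (Dom C x)"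
    "Cod D (on_arr F x) = on_obj F (Cod C x)" if "x \<in> Arr C" for x
    using Fa[OF that] by auto
  have uniq: "h = k" if "X \<in> Obj C" "Y \<in> Obj D" "h \<in> hom D (on_obj F X) Y" "k \<in> hom D (on_obj F X) Y"
    "on_arr U h \<cdot>\<^bsub>C\<^esub> \<eta> X = on_arr U k \<cdot>\<^bsub>C\<^esub> \<eta> X" for X Y h k
    using univ[OF that(1,2), of "on_arr U k \<cdot>\<^bsub>C\<^esub> \<eta> X"] that by auto
  have F: "is_functor C D F"
    unfolding is_functor_def
  proof (intro conjI ballI impI)
    fix X assume "X \<in> Obj C"
    then show "on_arr F (Ident C X) = Ident D (on_obj F X)"
      using nat[of "Ident C X"] by (intro uniq[of X "on_obj F X"]) auto
  next
    fix f g assume fg: "f \<in> Arr C" "g \<in> Arr C" "Dom C g = Cod C f"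
    show "on_arr F (g \<cdot>\<^bsub>C\<^esub> f) = on_arr F g \<cdot>\<^bsub>D\<^esub> on_arr F f"
    proof (rule uniq[of "Dom C f" "on_obj F (Cod C g)"])
      have "on_arr U (on_arr F g) \<cdot>\<^bsub>C\<^esub> \<eta> (Cod C f) \<cdot>\<^bsub>C\<^esub> f = \<eta> (Cod C g) \<cdot>\<^bsub>C\<^esub> g \<cdot>\<^bsub>C\<^esub> f"
        using nat[of g] fg C.comp_eq_extend[of "on_arr U (on_arr F g)" "\<eta> (Cod C f)" "\<eta> (Cod C g)" g f] by simp
      then show "on_arr U (on_arr F (g \<cdot>\<^bsub>C\<^esub> f)) \<cdot>\<^bsub>C\<^esub> \<eta> (Dom C f) =
        on_arr U (on_arr F g \<cdot>\<^bsub>D\<^esub> on_arr F f) \<cdot>\<^bsub>C\<^esub> \<eta> (Dom C f)"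
        using fg nat[of f] nat[of "g \<cdot>\<^bsub>C\<^esub> f"] by simp
    qed (use fg in auto)
  qed (use C D.category_axioms in auto)
  show ?thesis
    unfolding adjunction_def
  proof (intro conjI ballI)
    fix X Y assume XY: "X \<in> Obj C" "Y \<in> Obj D"
    show "bij_betw (\<lambda>h. on_arr U h \<cdot>\<^bsub>C\<^esub> \<eta> X) (hom D (on_obj F X) Y) (hom C X (on_obj U Y))"
      unfolding bij_betw_def
    proof
      show "inj_on (\<lambda>h. on_arr U h \<cdot>\<^bsub>C\<^esub> \<eta> X) (hom D (on_obj F X) Y)"
        using uniq[OF XY] by (intro inj_onI)
      have "\<exists>h\<in>hom D (on_obj F X) Y. g = on_arr U h \<cdot>\<^bsub>C\<^esub> \<eta> X" if "g \<in> hom C X (on_obj U Y)" for g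
        using univ[OF XY that] by metis
      moreover have "on_arr U h \<cdot>\<^bsub>C\<^esub> \<eta> X \<in> hom C X (on_obj U Y)" if "h \<in> hom D (on_obj F X) Y" for h
        using that XY by simp
      ultimately show "(\<lambda>h. on_arr U h \<cdot>\<^bsub>C\<^esub> \<eta> X) ` hom D (on_obj F X) Y = hom C X (on_obj U Y)"
        by (intro equalityI subsetI; blast)
    qed
  next
    fix x y h assume "x \<in> Arr C" "y \<in> Arr D" "h \<in> hom D (on_obj F (Cod C x)) (Dom D y)"
    then show "on_arr U (y \<cdot>\<^bsub>D\<^esub> h \<cdot>\<^bsub>D\<^esub> on_arr F x) \<cdot>\<^bsub>C\<^esub> \<eta> (Dom C x) =
      on_arr U y \<cdot>\<^bsub>C\<^esub> (on_arr U h \<cdot>\<^bsub>C\<^esub> \<eta> (Cod C x)) \<cdot>\<^bsub>C\<^esub> x"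
      using nat[of x] by simp
  qed (use F U in auto)
qed

text \<open>The dual criterion, used for coinduction. The transposition \<phi> is supplied by the
  caller because its explicit formula is needed later, when the unit of induction is compared with
  [f, Z].\<close>

lemma adjunction_from_counit:
  assumes D: "category D" and F: "is_functor C D F"
    and Uo: "\<And>Y. Y \<in> Obj D \<Longrightarrow> on_obj U Y \<in> Obj C"
    and Ua: "\<And>y. y \<in> Arr D \<Longrightarrow> on_arr U y \<in> hom C (on_obj U (Dom D y)) (on_obj U (Cod D y))"
    and \<epsilon>: "\<And>Y. Y \<in> Obj D \<Longrightarrow> \<epsilon> Y \<in> hom D (on_obj F (on_obj U Y)) Y"
    and nat: "\<And>y. y \<in> Arr D \<Longrightarrow> \<epsilon> (Cod D y) \<cdot>\<^bsub>D\<^esub> on_arr F (on_arr U y) = y \<cdot>\<^bsub>D\<^esub> \<epsilon> (Dom D y)"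
    and tr: "\<And>X Y h. X \<in> Obj C \<Longrightarrow> Y \<in> Obj D \<Longrightarrow> h \<in> hom D (on_obj F X) Y \<Longrightarrow>
      \<phi> X Y h \<in> hom C X (on_obj U Y) \<and> \<epsilon> Y \<cdot>\<^bsub>D\<^esub> on_arr F (\<phi> X Y h) = h"
    and uniq: "\<And>X Y k k'. X \<in> Obj C \<Longrightarrow> Y \<in> Obj D \<Longrightarrow> k \<in> hom C X (on_obj U Y) \<Longrightarrow>
      k' \<in> hom C X (on_obj U Y) \<Longrightarrow> \<epsilon> Y \<cdot>\<^bsub>D\<^esub> on_arr F k = \<epsilon> Y \<cdot>\<^bsub>D\<^esub> on_arr F k' \<Longrightarrow> k = k'"
  shows "adjunction C D F U \<phi>"
proof -
  interpret C: category C by (rule functorD[OF F])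
  interpret D: category D by (rule D)
  note [simp] = functorD(3-)[OF F] Uo
  have \<epsilon>' [simp]: "\<epsilon> Y \<in> Arr D" "Dom D (\<epsilon> Y) = on_obj F (on_obj U Y)" "Cod D (\<epsilon> Y) = Y" if "Y \<in> Obj D" for Y
    using \<epsilon>[OF that] by auto
  have Ua' [simp]: "on_arr U y \<in> Arr C" "Dom C (on_arr U y) = on_obj U (Dom D y)"
    "Cod C (on_arr U y) = on_obj U (Cod D y)" if "y \<in> Arr D" for y
    using Ua[OF that] by auto
  have nat': "\<epsilon> (Cod D y) \<cdot>\<^bsub>D\<^esub> on_arr F (on_arr U y) \<cdot>\<^bsub>D\<^esub> k = y \<cdot>\<^bsub>D\<^esub> \<epsilon> (Dom D y) \<cdot>\<^bsub>D\<^esub> k"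
    if "y \<in> Arr D" "k \<in> Arr D" "Cod D k = on_obj F (on_obj U (Dom D y))" for y k
    using D.comp_eq_extend[OF nat[OF that(1)]] that by simp
  have U: "is_functor D C U"
    unfolding is_functor_def
  proof (intro conjI ballI impI)
    fix Y assume "Y \<in> Obj D"
    then show "on_arr U (Ident D Y) = Ident C (on_obj U Y)"
      using nat[of "Ident D Y"] by (intro uniq[of "on_obj U Y" Y]) auto
  next
    fix f g assume fg: "f \<in> Arr D" "g \<in> Arr D" "Dom D g = Cod D f"
    show "on_arr U (g \<cdot>\<^bsub>D\<^esub> f) = on_arr U g \<cdot>\<^bsub>C\<^esub> on_arr U f"
      using fg nat[of "g \<cdot>\<^bsub>D\<^esub> f"] nat'[of g "on_arr F (on_arr U f)"] nat[of f]
      by (intro uniq[of "on_obj U (Dom D f)" "Cod D g"]) auto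
  qed (use D C.category_axioms in auto)
  show ?thesis
    unfolding adjunction_def
  proof (intro conjI ballI)
    fix X Y assume XY: "X \<in> Obj C" "Y \<in> Obj D"
    show "bij_betw (\<phi> X Y) (hom D (on_obj F X) Y) (hom C X (on_obj U Y))"
    proof (rule bij_betw_byWitness[where f' = "\<lambda>k. \<epsilon> Y \<cdot>\<^bsub>D\<^esub> on_arr F k"])
      show "\<forall>h\<in>hom D (on_obj F X) Y. \<epsilon> Y \<cdot>\<^bsub>D\<^esub> on_arr F (\<phi> X Y h) = h"
        using tr[OF XY] by blast
      have *: "\<epsilon> Y \<cdot>\<^bsub>D\<^esub> on_arr F k \<in> hom D (on_obj F X) Y" if "k \<in> hom C X (on_obj U Y)" for k
        using that XY by simp
      then show "(\<lambda>k. \<epsilon> Y \<cdot>\<^bsub>D\<^esub> on_arr F k) ` hom C X (on_obj U Y) \<subseteq> hom D (on_obj F X) Y"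
        by blast
      show "\<forall>k\<in>hom C X (on_obj U Y). \<phi> X Y (\<epsilon> Y \<cdot>\<^bsub>D\<^esub> on_arr F k) = k"
      proof
        fix k assume k: "k \<in> hom C X (on_obj U Y)"
        show "\<phi> X Y (\<epsilon> Y \<cdot>\<^bsub>D\<^esub> on_arr F k) = k"
          using uniq[OF XY _ k] tr[OF XY *[OF k]] by blast
      qed
      show "\<phi> X Y ` hom D (on_obj F X) Y \<subseteq> hom C X (on_obj U Y)"
        using tr[OF XY] by blast
    qed
  next
    fix x y h assume a: "x \<in> Arr C" "y \<in> Arr D" "h \<in> hom D (on_obj F (Cod C x)) (Dom D y)"
    have t1: "\<phi> (Cod C x) (Dom D y) h \<in> Arr C" "Dom C (\<phi> (Cod C x) (Dom D y) h) = Cod C x"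
      "Cod C (\<phi> (Cod C x) (Dom D y) h) = on_obj U (Dom D y)"
      "\<epsilon> (Dom D y) \<cdot>\<^bsub>D\<^esub> on_arr F (\<phi> (Cod C x) (Dom D y) h) = h"
      using tr[of "Cod C x" "Dom D y" h] a by simp_all
    have "\<epsilon> (Dom D y) \<cdot>\<^bsub>D\<^esub> on_arr F (\<phi> (Cod C x) (Dom D y) h) \<cdot>\<^bsub>D\<^esub> on_arr F x = h \<cdot>\<^bsub>D\<^esub> on_arr F x"
      using D.comp_eq_extend1[OF t1(4)] t1(1-3) a by simp
    moreover note tr[of "Dom C x" "Cod D y" "y \<cdot>\<^bsub>D\<^esub> h \<cdot>\<^bsub>D\<^esub> on_arr F x"]
    ultimately show "\<phi> (Dom C x) (Cod D y) (y \<cdot>\<^bsub>D\<^esub> h \<cdot>\<^bsub>D\<^esub> on_arr F x) =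
      on_arr U y \<cdot>\<^bsub>C\<^esub> \<phi> (Cod C x) (Dom D y) h \<cdot>\<^bsub>C\<^esub> x"
      using a t1 nat'[of y "on_arr F (\<phi> (Cod C x) (Dom D y) h) \<cdot>\<^bsub>D\<^esub> on_arr F x"]
      by (intro uniq[of "Dom C x" "Cod D y"]) auto
  qed (use F U in auto)
qed

section \<open>Finite limits and colimits\<close>

lemma category_ord_cat:
  assumes "refl_on (Field r) r" "trans r"
  shows "category (ord_cat r)"
  using assms unfolding category_def ord_cat_def
  by (auto simp: refl_on_def FieldI1 FieldI2 elim: transE)

lemma finite_embeds_in_infinite:
  assumes "finite A" "infinite (UNIV :: 'u set)"
  shows "\<exists>e :: 'x \<Rightarrow> 'u. inj_on e A"
proof -
  have "\<exists>f :: 'x \<Rightarrow> nat. inj_on f A" using finite_imp_inj_to_nat_seg[OF assms(1)] by auto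
  then obtain f :: "'x \<Rightarrow> nat" where f: "inj_on f A" ..
  have "\<exists>g :: nat \<Rightarrow> 'u. inj g" using infinite_countable_subset[OF assms(2)] by auto
  then obtain g :: "nat \<Rightarrow> 'u" where "inj g" ..
  then show ?thesis using comp_inj_on[OF f, of g] inj_on_subset by blast
qed

text \<open>\<open>bicomplete\<close> only covers index categories whose objects and arrows lie in
  the universe type. A finite category is therefore relabelled along injections into that type, and
  universal (co)cones are carried back along them.\<close>

lemma small_model_of_finite_diagram:
  fixes J :: "('j, 'k) cat"
  assumes inf: "infinite (UNIV :: 'u set)" and J: "category J" "finite (Obj J)" "finite (Arr J)"
    and D: "is_functor J C D"
  obtains J' :: "('u, 'u) cat" and D' where "small_cat (u :: 'u itself) J'" "is_functor J' C D'"
    "\<And>L c. is_colimit J' C D' L c \<Longrightarrow> \<exists>c'. is_colimit J C D L c'"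
    "\<And>L c. is_limit J' C D' L c \<Longrightarrow> \<exists>c'. is_limit J C D L c'"
proof -
  note emb = finite_embeds_in_infinite[OF _ inf]
  obtain e :: "'j \<Rightarrow> 'u" where e: "inj_on e (Obj J)" using emb[OF J(2)] by auto
  obtain k :: "'k \<Rightarrow> 'u" where k: "inj_on k (Arr J)" using emb[OF J(3)] by auto
  define d where "d = inv_into (Obj J) e"
  define l where "l = inv_into (Arr J) k"
  have [simp]: "d (e X) = X" if "X \<in> Obj J" for X using that e by (simp add: d_def)
  have [simp]: "l (k x) = x" if "x \<in> Arr J" for x using that k by (simp add: l_def)
  interpret J: category J by fact
  interpret C: category C by (rule functorD[OF D])
  note [simp] = functorD(3-)[OF D]
  \<comment> \<open>\<open>J\<close> relabelled: \<open>e\<close> and \<open>k\<close> name objects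
    and arrows by elements of the universe, \<open>d\<close> and \<open>l\<close> recover
    them.\<close>
  define J' :: "('u, 'u) cat" where "J' = \<lparr>Obj = e ` Obj J, Arr = k ` Arr J, Dom = \<lambda>x. e (Dom J (l x)),
    Cod = \<lambda>x. e (Cod J (l x)), Ident = \<lambda>x. k (Ident J (d x)), Comp = \<lambda>x y. k (l x \<cdot>\<^bsub>J\<^esub> l y)\<rparr>"
  define D' where "D' = \<lparr>on_obj = on_obj D \<circ> d, on_arr = on_arr D \<circ> l\<rparr>"
  have eq: "e X = e Y \<longleftrightarrow> X = Y" if "X \<in> Obj J" "Y \<in> Obj J" for X Y
    using e that by (auto dest: inj_onD)
  have cat: "category J'"
    unfolding category_def J'_def by (auto simp: eq)
  have small: "|A| <o |UNIV :: 'u set|" if "finite A" for A :: "'u set"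
    by (rule finite_ordLess_infinite) (use that inf in \<open>auto simp: card_of_well_order_on Field_card_of\<close>)
  have "small_cat u J'"
    using cat J unfolding small_cat_def small_set_def J'_def
    by (simp add: small)
  moreover have F: "is_functor J' C D'"
    using cat C.category_axioms unfolding is_functor_def by (auto simp: J'_def D'_def eq)
  moreover have cc: "is_cocone J' C D' L c \<longleftrightarrow> is_cocone J C D L (c \<circ> e)" for L c
    by (auto simp: is_cocone_def J'_def D'_def)
  have "\<exists>c'. is_colimit J C D L c'" if *: "is_colimit J' C D' L c" for L c
  proof -
    have "\<exists>!h. h \<in> hom C L L' \<and> (\<forall>j\<in>Obj J. h \<cdot>\<^bsub>C\<^esub> (c \<circ> e) j = c' j)" if "is_cocone J C D L' c'" for L' c'
    proof -
      have "is_cocone J C D L' ((c' \<circ> d) \<circ> e)" using that by (auto simp: is_cocone_def)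
      then have "is_cocone J' C D' L' (c' \<circ> d)" by (simp only: cc)
      with * have "\<exists>!h. h \<in> hom C L L' \<and> (\<forall>j\<in>Obj J'. h \<cdot>\<^bsub>C\<^esub> c j = (c' \<circ> d) j)"
        unfolding is_colimit_def by blast
      then show ?thesis by (simp add: J'_def)
    qed
    then show ?thesis using * cc unfolding is_colimit_def by blast
  qed
  moreover have cc: "is_cone J' C D' L c \<longleftrightarrow> is_cone J C D L (c \<circ> e)" for L c
    by (auto simp: is_cone_def J'_def D'_def)
  have "\<exists>c'. is_limit J C D L c'" if *: "is_limit J' C D' L c" for L c
  proof -
    have "\<exists>!h. h \<in> hom C L' L \<and> (\<forall>j\<in>Obj J. (c \<circ> e) j \<cdot>\<^bsub>C\<^esub> h = c' j)" if "is_cone J C D L' c'" for L' c'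
    proof -
      have "is_cone J C D L' ((c' \<circ> d) \<circ> e)" using that by (auto simp: is_cone_def)
      then have "is_cone J' C D' L' (c' \<circ> d)" by (simp only: cc)
      with * have "\<exists>!h. h \<in> hom C L' L \<and> (\<forall>j\<in>Obj J'. c j \<cdot>\<^bsub>C\<^esub> h = (c' \<circ> d) j)"
        unfolding is_limit_def by blast
      then show ?thesis by (simp add: J'_def)
    qed
    then show ?thesis using * cc unfolding is_limit_def by blast
  qed
  ultimately show ?thesis using that by blast
qed

text \<open>The summands are read off as the domains of the two injections, so that a coproduct is
  just a pair of arrows.\<close>

definition coproduct_of :: "('o, 'm, 'z) cat_scheme \<Rightarrow> 'm \<Rightarrow> 'm \<Rightarrow> bool" where
  "coproduct_of C i j \<longleftrightarrow> i \<in> Arr C \<and> j \<in> Arr C \<and> Cod C i = Cod C j \<and>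
    (\<forall>Z. \<forall>u \<in> hom C (Dom C i) Z. \<forall>v \<in> hom C (Dom C j) Z.
      \<exists>!h. h \<in> hom C (Cod C i) Z \<and> h \<cdot>\<^bsub>C\<^esub> i = u \<and> h \<cdot>\<^bsub>C\<^esub> j = v)"

definition product_of :: "('o, 'm, 'z) cat_scheme \<Rightarrow> 'm \<Rightarrow> 'm \<Rightarrow> bool" where
  "product_of C p q \<longleftrightarrow> p \<in> Arr C \<and> q \<in> Arr C \<and> Dom C p = Dom C q \<and>
    (\<forall>Z. \<forall>u \<in> hom C Z (Cod C p). \<forall>v \<in> hom C Z (Cod C q).
      \<exists>!h. h \<in> hom C Z (Dom C p) \<and> p \<cdot>\<^bsub>C\<^esub> h = u \<and> q \<cdot>\<^bsub>C\<^esub> h = v)"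

lemma is_pushoutI:
  assumes "f \<in> Arr C" "g \<in> Arr C" "Dom C f = Dom C g" "i \<in> hom C (Cod C f) L" "j \<in> hom C (Cod C g) L"
    "i \<cdot>\<^bsub>C\<^esub> f = j \<cdot>\<^bsub>C\<^esub> g"
    "\<And>Z v w. v \<in> hom C (Cod C f) Z \<Longrightarrow> w \<in> hom C (Cod C g) Z \<Longrightarrow> v \<cdot>\<^bsub>C\<^esub> f = w \<cdot>\<^bsub>C\<^esub> g \<Longrightarrow>
      \<exists>!h. h \<in> hom C L Z \<and> h \<cdot>\<^bsub>C\<^esub> i = v \<and> h \<cdot>\<^bsub>C\<^esub> j = w"
  shows "is_pushout C f g i j"
proof -
  have [simp]: "Cod C i = L" "Cod C j = L" using assms(4,5) by auto
  show ?thesis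
    unfolding is_pushout_def
  proof (intro conjI allI ballI impI)
    fix Z v w assume "v \<in> hom C (Cod C f) Z" "w \<in> hom C (Cod C g) Z" "v \<cdot>\<^bsub>C\<^esub> f = w \<cdot>\<^bsub>C\<^esub> g"
    then show "\<exists>!h. h \<in> hom C (Cod C i) Z \<and> h \<cdot>\<^bsub>C\<^esub> i = v \<and> h \<cdot>\<^bsub>C\<^esub> j = w"
      unfolding \<open>Cod C i = L\<close> by (rule assms(7))
  qed (use assms(1-6) in auto)
qed

lemma is_coequalizerI:
  assumes "s \<in> Arr C" "t \<in> Arr C" "Dom C s = Dom C t" "Cod C s = Cod C t" "p \<in> hom C (Cod C s) L"
    "p \<cdot>\<^bsub>C\<^esub> s = p \<cdot>\<^bsub>C\<^esub> t"
    "\<And>Z v. v \<in> hom C (Cod C s) Z \<Longrightarrow> v \<cdot>\<^bsub>C\<^esub> s = v \<cdot>\<^bsub>C\<^esub> t \<Longrightarrow> \<exists>!h. h \<in> hom C L Z \<and> h \<cdot>\<^bsub>C\<^esub> p = v"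
  shows "is_coequalizer C s t p"
proof -
  have [simp]: "Cod C p = L" using assms(5) by auto
  show ?thesis
    unfolding is_coequalizer_def
  proof (intro conjI allI ballI impI)
    fix Z v assume "v \<in> hom C (Cod C s) Z" "v \<cdot>\<^bsub>C\<^esub> s = v \<cdot>\<^bsub>C\<^esub> t"
    then show "\<exists>!h. h \<in> hom C (Cod C p) Z \<and> h \<cdot>\<^bsub>C\<^esub> p = v"
      unfolding \<open>Cod C p = L\<close> by (rule assms(7))
  qed (use assms(1-6) in auto)
qed

lemma coequalizer_induced:
  assumes "is_coequalizer C s t p" "v \<in> hom C (Cod C s) Z" "v \<cdot>\<^bsub>C\<^esub> s = v \<cdot>\<^bsub>C\<^esub> t"
  shows "\<exists>!h. h \<in> hom C (Cod C p) Z \<and> h \<cdot>\<^bsub>C\<^esub> p = v"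
proof -
  have "\<forall>Z. \<forall>p' \<in> hom C (Cod C s) Z. p' \<cdot>\<^bsub>C\<^esub> s = p' \<cdot>\<^bsub>C\<^esub> t \<longrightarrow>
      (\<exists>!h. h \<in> hom C (Cod C p) Z \<and> h \<cdot>\<^bsub>C\<^esub> p = p')"
    using assms(1) unfolding is_coequalizer_def by (elim conjE)
  then show ?thesis using assms(2,3) by (elim allE[of _ Z] ballE[of _ _ v]) simp_all
qed

lemma pushout_induced:
  assumes "is_pushout C f g i j" "v \<in> hom C (Cod C f) Z" "w \<in> hom C (Cod C g) Z"
    "v \<cdot>\<^bsub>C\<^esub> f = w \<cdot>\<^bsub>C\<^esub> g"
  shows "\<exists>!h. h \<in> hom C (Cod C i) Z \<and> h \<cdot>\<^bsub>C\<^esub> i = v \<and> h \<cdot>\<^bsub>C\<^esub> j = w"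
proof -
  have "\<forall>Z. \<forall>i' \<in> hom C (Cod C f) Z. \<forall>j' \<in> hom C (Cod C g) Z. i' \<cdot>\<^bsub>C\<^esub> f = j' \<cdot>\<^bsub>C\<^esub> g \<longrightarrow>
      (\<exists>!h. h \<in> hom C (Cod C i) Z \<and> h \<cdot>\<^bsub>C\<^esub> i = i' \<and> h \<cdot>\<^bsub>C\<^esub> j = j')"
    using assms(1) unfolding is_pushout_def by (elim conjE)
  then show ?thesis using assms(2-4) by (elim allE[of _ Z] ballE[of _ _ v] ballE[of _ _ w]) simp_all
qed

lemma initial_map: "is_initial C Z \<Longrightarrow> X \<in> Obj C \<Longrightarrow> \<exists>f. f \<in> hom C Z X"
  and initial_unique: "is_initial C Z \<Longrightarrow> X \<in> Obj C \<Longrightarrow> f \<in> hom C Z X \<Longrightarrow> g \<in> hom C Z X \<Longrightarrow> f = g"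
  unfolding is_initial_def by blast+

lemma terminal_map: "is_terminal C T \<Longrightarrow> X \<in> Obj C \<Longrightarrow> \<exists>f. f \<in> hom C X T"
  and terminal_unique: "is_terminal C T \<Longrightarrow> X \<in> Obj C \<Longrightarrow> f \<in> hom C X T \<Longrightarrow> g \<in> hom C X T \<Longrightarrow> f = g"
  unfolding is_terminal_def by blast+

text \<open>The lifting condition says that \<open>[d, e] : M \<amalg> M \<rightarrow> T\<close> is a cofibration, without naming a coproduct.\<close>

definition cylinder :: "('o, 'm, 'z) model_cat_scheme \<Rightarrow> 'o \<Rightarrow> 'o \<Rightarrow> 'm \<Rightarrow> 'm \<Rightarrow> bool" where
  "cylinder C M T d e \<longleftrightarrow> d \<in> hom C M T \<and> e \<in> hom C M T \<and>
    d \<in> Cof C \<and> d \<in> Weq C \<and> e \<in> Cof C \<and> e \<in> Weq C \<and>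
    (\<forall>p a b v. p \<in> Fib C \<longrightarrow> p \<in> Weq C \<longrightarrow> a \<in> hom C M (Dom C p) \<longrightarrow> b \<in> hom C M (Dom C p) \<longrightarrow>
      v \<in> hom C T (Cod C p) \<longrightarrow> p \<cdot>\<^bsub>C\<^esub> a = v \<cdot>\<^bsub>C\<^esub> d \<longrightarrow> p \<cdot>\<^bsub>C\<^esub> b = v \<cdot>\<^bsub>C\<^esub> e \<longrightarrow>
      (\<exists>h \<in> hom C T (Dom C p). h \<cdot>\<^bsub>C\<^esub> d = a \<and> h \<cdot>\<^bsub>C\<^esub> e = b \<and> p \<cdot>\<^bsub>C\<^esub> h = v)) \<and>
    (\<exists>s \<in> hom C T M. s \<cdot>\<^bsub>C\<^esub> d = Ident C M \<and> s \<cdot>\<^bsub>C\<^esub> e = Ident C M)"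

locale model_structure =
  fixes u :: "'u itself" and C :: "('o, 'm, 'z) model_cat_scheme" (structure)
  assumes infinite_universe: "infinite (UNIV :: 'u set)" and model: "model_category u C"
begin

lemma bicomp: "bicomplete u C"
  using model by (simp add: model_category_def)

sublocale category C
  using bicomp by (simp add: bicomplete_def)

lemma finite_colimit:
  fixes J :: "('j, 'k) cat"
  assumes "category J" "finite (Obj J)" "finite (Arr J)" "is_functor J C D"
  obtains L c where "is_colimit J C D L c"
proof -
  obtain J' :: "('u, 'u) cat" and D' where "small_cat u J'" "is_functor J' C D'"
    "\<And>L c. is_colimit J' C D' L c \<Longrightarrow> \<exists>c'. is_colimit J C D L c'"
    using small_model_of_finite_diagram[OF infinite_universe assms] by metis
  then show ?thesis using that bicomp unfolding bicomplete_def by metis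
qed

lemma finite_limit:
  fixes J :: "('j, 'k) cat"
  assumes "category J" "finite (Obj J)" "finite (Arr J)" "is_functor J C D"
  obtains L c where "is_limit J C D L c"
proof -
  obtain J' :: "('u, 'u) cat" and D' where "small_cat u J'" "is_functor J' C D'"
    "\<And>L c. is_limit J' C D' L c \<Longrightarrow> \<exists>c'. is_limit J C D L c'"
    using small_model_of_finite_diagram[OF infinite_universe assms] by metis
  then show ?thesis using that bicomp unfolding bicomplete_def by metis
qed

text \<open>The empty relation gives the empty category, on which any \<open>D\<close> is a functor
  vacuously; \<open>undefined\<close> serves below.\<close>

lemma empty_diagram: "is_functor (ord_cat ({} :: nat rel)) C D"
  using category_ord_cat[of "{} :: nat rel"] category_axioms
  unfolding is_functor_def by (simp add: ord_cat_def)

lemma initial_exists: obtains Z where "is_initial C Z"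
proof -
  obtain L c where "is_colimit (ord_cat ({} :: nat rel)) C undefined L c"
    using finite_colimit[OF _ _ _ empty_diagram] category_ord_cat[of "{} :: nat rel"]
    by (auto simp: ord_cat_def)
  then have "is_initial C L"
    unfolding is_colimit_def is_cocone_def is_initial_def by (simp add: ord_cat_def)
  then show ?thesis by (rule that)
qed

lemma terminal_exists: obtains T where "is_terminal C T"
proof -
  obtain L c where "is_limit (ord_cat ({} :: nat rel)) C undefined L c"
    using finite_limit[OF _ _ _ empty_diagram] category_ord_cat[of "{} :: nat rel"]
    by (auto simp: ord_cat_def)
  then have "is_terminal C L"
    unfolding is_limit_def is_cone_def is_terminal_def by (simp add: ord_cat_def)
  then show ?thesis by (rule that)
qed

lemma product_exists:
  assumes X: "X \<in> Obj C" and Y: "Y \<in> Obj C"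
  obtains p q where "product_of C p q" "Cod C p = X" "Cod C q = Y"
proof -
  \<comment> \<open>The discrete category on two objects. \<open>ord_cat\<close> yields a category
    for every reflexive transitive relation, not only for well-orders.\<close>
  define r :: "nat rel" where "r = {(0, 0), (1, 1)}"
  define D where "D = \<lparr>on_obj = \<lambda>n :: nat. if n = 0 then X else Y,
    on_arr = \<lambda>(m, n :: nat). if m = (0 :: nat) then Ident C X else Ident C Y\<rparr>"
  have r: "Field r = {0, 1}" by (auto simp: r_def Field_def)
  have cat: "category (ord_cat r)"
    by (rule category_ord_cat) (auto simp: r refl_on_def r_def trans_def)
  have "is_functor (ord_cat r) C D"
    unfolding is_functor_def using cat category_axioms X Y by (auto simp: ord_cat_def r D_def r_def)
  then obtain L c where L: "is_limit (ord_cat r) C D L c"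
    using finite_limit[OF cat] by (auto simp: ord_cat_def r) (auto simp: r_def)
  have cone: "is_cone (ord_cat r) C D Z d \<longleftrightarrow> Z \<in> Obj C \<and> d 0 \<in> hom C Z X \<and> d 1 \<in> hom C Z Y" for Z d
    unfolding is_cone_def by (auto simp: ord_cat_def r D_def r_def)
  have "\<exists>!h. h \<in> hom C Z L \<and> c 0 \<cdot> h = u \<and> c 1 \<cdot> h = v" if "u \<in> hom C Z X" "v \<in> hom C Z Y" for Z u v
  proof -
    have "is_cone (ord_cat r) C D Z (\<lambda>n. if n = 0 then u else v)"
      using that cone by auto
    then have "\<exists>!h. h \<in> hom C Z L \<and> (\<forall>j \<in> Obj (ord_cat r). c j \<cdot> h = (if j = 0 then u else v))"
      using L unfolding is_limit_def by blast
    then show ?thesis by (simp add: ord_cat_def r)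
  qed
  moreover have "c 0 \<in> hom C L X" "c 1 \<in> hom C L Y" using L cone unfolding is_limit_def by auto
  ultimately have "product_of C (c 0) (c 1)"
    unfolding product_of_def by (metis in_hom)
  then show ?thesis using \<open>c 0 \<in> hom C L X\<close> \<open>c 1 \<in> hom C L Y\<close> that by simp
qed

lemma pushout_exists:
  assumes f: "f \<in> Arr C" and g: "g \<in> Arr C" and fg: "Dom C f = Dom C g"
  obtains i j where "is_pushout C f g i j"
proof -
  \<comment> \<open>The walking span 1 <- 0 -> 2 as a preorder.\<close>
  define r :: "nat rel" where "r = {(0, 0), (1, 1), (2, 2), (0, 1), (0, 2)}"
  define D where "D = \<lparr>on_obj = \<lambda>n :: nat. if n = 0 then Dom C f else if n = 1 then Cod C f else Cod C g,
    on_arr = \<lambda>(m, n :: nat). if m = (0 :: nat) then if n = 0 then Ident C (Dom C f) else if n = 1 then f else g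
      else if m = 1 then Ident C (Cod C f) else Ident C (Cod C g)\<rparr>"
  have r: "Field r = {0, 1, 2}" by (auto simp: r_def Field_def)
  have cat: "category (ord_cat r)"
    by (rule category_ord_cat) (auto simp: r refl_on_def r_def trans_def)
  have "is_functor (ord_cat r) C D"
    unfolding is_functor_def using cat category_axioms f g fg
    by (simp add: ord_cat_def r) (auto simp: D_def r_def)
  then obtain L c where L: "is_colimit (ord_cat r) C D L c"
    using finite_colimit[OF cat] by (auto simp: ord_cat_def r) (auto simp: r_def)
  have cocone: "is_cocone (ord_cat r) C D Z d \<longleftrightarrow> d 0 \<in> hom C (Dom C f) Z \<and> d 1 \<in> hom C (Cod C f) Z \<and>
      d 2 \<in> hom C (Cod C g) Z \<and> d 1 \<cdot> f = d 0 \<and> d 2 \<cdot> g = d 0" for Z d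
    unfolding is_cocone_def using f g fg by (auto simp: ord_cat_def r D_def r_def)
  have c: "c 0 \<in> hom C (Dom C f) L" "c 1 \<in> hom C (Cod C f) L"
      "c 2 \<in> hom C (Cod C g) L" "c 1 \<cdot> f = c 0" "c 2 \<cdot> g = c 0"
    using L cocone unfolding is_colimit_def by auto
  have "\<exists>!h. h \<in> hom C L Z \<and> h \<cdot> c 1 = u \<and> h \<cdot> c 2 = v"
    if uv: "u \<in> hom C (Cod C f) Z" "v \<in> hom C (Cod C g) Z" "u \<cdot> f = v \<cdot> g" for Z u v
  proof -
    have "is_cocone (ord_cat r) C D Z (\<lambda>n. if n = 0 then u \<cdot> f else if n = 1 then u else v)"
      using uv cocone f g fg by auto
    then have *: "\<exists>!h. h \<in> hom C L Z \<and> (\<forall>j \<in> Obj (ord_cat r). h \<cdot> c j =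
        (if j = 0 then u \<cdot> f else if j = 1 then u else v))"
      using L unfolding is_colimit_def by blast
    have "\<exists>!h. h \<in> hom C L Z \<and> h \<cdot> c 0 = u \<cdot> f \<and> h \<cdot> c 1 = u \<and> h \<cdot> c 2 = v"
      using * by (simp add: ord_cat_def r)
    moreover have "h \<cdot> c 0 = u \<cdot> f" if "h \<in> hom C L Z" "h \<cdot> c 1 = u" for h
      using comp_eq_extend1[OF that(2), of f] c(1,2,4) that(1) f by simp
    ultimately show ?thesis by blast
  qed
  then have "is_pushout C f g (c 1) (c 2)"
    using c f g fg by (intro is_pushoutI[where L = L]) auto
  then show ?thesis by (rule that)
qed

text \<open>A pushout over the initial object, where the commutativity condition on cocones is
  automatic.\<close>

lemma coproduct_exists:
  assumes X: "X \<in> Obj C" and Y: "Y \<in> Obj C"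
  obtains i j where "coproduct_of C i j" "Dom C i = X" "Dom C j = Y"
proof -
  obtain Z where Z: "is_initial C Z" by (rule initial_exists)
  then obtain f g where fg: "f \<in> hom C Z X" "g \<in> hom C Z Y" using X Y unfolding is_initial_def by metis
  obtain i j where po: "is_pushout C f g i j" using pushout_exists[of f g] fg by auto
  have "u \<cdot> f = v \<cdot> g" if "u \<in> hom C X W" "v \<in> hom C Y W" for u v W
  proof -
    have "u \<cdot> f \<in> hom C Z W" "v \<cdot> g \<in> hom C Z W" "W \<in> Obj C" using fg that by auto
    then show ?thesis using Z unfolding is_initial_def by metis
  qed
  moreover have *: "Dom C i = X" "Dom C j = Y" "Cod C f = X" "Cod C g = Y"
    using po fg unfolding is_pushout_def by auto
  ultimately have "coproduct_of C i j"
    using po unfolding is_pushout_def coproduct_of_def by metis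
  then show ?thesis using * that by blast
qed

lemma coproduct_eq:
  assumes "coproduct_of C i j" "h \<cdot> i = k \<cdot> i" "h \<cdot> j = k \<cdot> j" "h \<in> hom C (Cod C i) Z" "k \<in> hom C (Cod C i) Z"
  shows "h = k"
proof -
  have "k \<cdot> i \<in> hom C (Dom C i) Z" "k \<cdot> j \<in> hom C (Dom C j) Z"
    using assms by (auto simp: coproduct_of_def)
  then show ?thesis using assms unfolding coproduct_of_def by metis
qed

lemma coproduct_copair:
  assumes "coproduct_of C i j" "v \<in> hom C (Dom C i) Z" "w \<in> hom C (Dom C j) Z"
  obtains h where "h \<in> hom C (Cod C i) Z" "h \<cdot> i = v" "h \<cdot> j = w"
  using assms unfolding coproduct_of_def by metis

text \<open>Push out the copair of \<open>s\<close> and \<open>t\<close> (the arrow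
  \<open>a\<close>) along the codiagonal of \<open>Dom C s\<close> (the arrow \<open>b\<close>):
  restricted to the two summands, the pushout condition says that both composites equal the same
  arrow \<open>q\<close>.\<close>

lemma coequalizer_exists:
  assumes s: "s \<in> Arr C" and t: "t \<in> Arr C" and st: "Dom C s = Dom C t" "Cod C s = Cod C t"
  obtains p where "is_coequalizer C s t p"
proof -
  obtain i j where ij: "coproduct_of C i j" "Dom C i = Dom C s" "Dom C j = Dom C s"
    using coproduct_exists[of "Dom C s" "Dom C s"] s by auto
  note ij' [simp] = ij(1)[unfolded coproduct_of_def, THEN conjunct1] ij(2,3) s t
    ij(1)[unfolded coproduct_of_def, THEN conjunct2, THEN conjunct1]
    ij(1)[unfolded coproduct_of_def, THEN conjunct2, THEN conjunct2, THEN conjunct1]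
  obtain a where a: "a \<in> hom C (Cod C i) (Cod C s)" "a \<cdot> i = s" "a \<cdot> j = t"
    using coproduct_copair[OF ij(1), of s "Cod C s" t] st by auto
  obtain b where b: "b \<in> hom C (Cod C i) (Dom C s)" "b \<cdot> i = Ident C (Dom C s)" "b \<cdot> j = Ident C (Dom C s)"
    using coproduct_copair[OF ij(1), of "Ident C (Dom C s)" "Dom C s" "Ident C (Dom C s)"] by auto
  obtain p q where po: "is_pushout C a b p q" using pushout_exists[of a b] a b by auto
  then have pq: "p \<in> Arr C" "q \<in> Arr C" "Dom C p = Cod C s" "Dom C q = Dom C s" "Cod C q = Cod C p" "p \<cdot> a = q \<cdot> b"
    using a b unfolding is_pushout_def by auto
  have ps: "p \<cdot> s = q"
    using comp_eq_extend[OF pq(6), of i] a b pq by simp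
  have pt: "p \<cdot> t = q"
    using comp_eq_extend[OF pq(6), of j] a b pq by simp
  have "\<exists>!h. h \<in> hom C (Cod C p) Z \<and> h \<cdot> p = p'" if p': "p' \<in> hom C (Cod C s) Z" "p' \<cdot> s = p' \<cdot> t" for Z p'
  proof -
    have "p' \<cdot> a = (p' \<cdot> s) \<cdot> b"
      by (rule coproduct_eq[OF ij(1)]) (use a b p' st in auto)
    moreover have "p' \<in> hom C (Cod C a) Z" "p' \<cdot> s \<in> hom C (Cod C b) Z"
      using a b p'(1) st by simp_all
    ultimately have "\<exists>!h. h \<in> hom C (Cod C p) Z \<and> h \<cdot> p = p' \<and> h \<cdot> q = p' \<cdot> s"
      by (intro pushout_induced[OF po])
    moreover have "h \<cdot> q = p' \<cdot> s" if "h \<in> hom C (Cod C p) Z" "h \<cdot> p = p'" for h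
      using comp_eq_extend1[OF that(2), of s] that pq ps p' by simp
    ultimately show ?thesis by blast
  qed
  then have "is_coequalizer C s t p"
    using s t st pq(1,3) ps pt by (intro is_coequalizerI[where L = "Cod C p"]) simp_all
  then show ?thesis by (rule that)
qed

section \<open>Model categories\<close>

lemma weq_arr: "f \<in> Weq C \<Longrightarrow> f \<in> Arr C" and cof_arr: "f \<in> Cof C \<Longrightarrow> f \<in> Arr C"
  and fib_arr: "f \<in> Fib C \<Longrightarrow> f \<in> Arr C"
  using model unfolding model_category_def wide_subcategory_def by auto

lemma weq_ident: "X \<in> Obj C \<Longrightarrow> Ident C X \<in> Weq C"
  using model unfolding model_category_def wide_subcategory_def by auto

lemma cof_comp: "f \<in> Cof C \<Longrightarrow> g \<in> Cof C \<Longrightarrow> Dom C g = Cod C f \<Longrightarrow> g \<cdot> f \<in> Cof C"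
  and fib_comp: "f \<in> Fib C \<Longrightarrow> g \<in> Fib C \<Longrightarrow> Dom C g = Cod C f \<Longrightarrow> g \<cdot> f \<in> Fib C"
  using model unfolding model_category_def wide_subcategory_def by auto

lemma two_of_three: "\<forall>f \<in> Arr C. \<forall>g \<in> Arr C. Dom C g = Cod C f \<longrightarrow>
      (f \<in> Weq C \<and> g \<in> Weq C \<longrightarrow> g \<cdot> f \<in> Weq C) \<and>
      (f \<in> Weq C \<and> g \<cdot> f \<in> Weq C \<longrightarrow> g \<in> Weq C) \<and>
      (g \<in> Weq C \<and> g \<cdot> f \<in> Weq C \<longrightarrow> f \<in> Weq C)"
  using model unfolding model_category_def by blast

lemma weq_comp: "f \<in> Weq C \<Longrightarrow> g \<in> Weq C \<Longrightarrow> Dom C g = Cod C f \<Longrightarrow> g \<cdot> f \<in> Weq C"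
  using two_of_three weq_arr by blast

lemma weq_cancel_right: "f \<in> Weq C \<Longrightarrow> g \<cdot> f \<in> Weq C \<Longrightarrow> g \<in> Arr C \<Longrightarrow> Dom C g = Cod C f \<Longrightarrow> g \<in> Weq C"
  using two_of_three weq_arr by blast

lemma weq_cancel_left: "g \<in> Weq C \<Longrightarrow> g \<cdot> f \<in> Weq C \<Longrightarrow> f \<in> Arr C \<Longrightarrow> Dom C g = Cod C f \<Longrightarrow> f \<in> Weq C"
  using two_of_three weq_arr by blast

lemma retract_closed:
  assumes "retract_of C f g"
  shows "g \<in> Weq C \<Longrightarrow> f \<in> Weq C" "g \<in> Cof C \<Longrightarrow> f \<in> Cof C" "g \<in> Fib C \<Longrightarrow> f \<in> Fib C"
  using model assms unfolding model_category_def by blast+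

lemma model_lifts: "i \<in> Cof C \<Longrightarrow> p \<in> Fib C \<Longrightarrow> i \<in> Weq C \<or> p \<in> Weq C \<Longrightarrow> lifts C i p"
  using model unfolding model_category_def by blast

lemma model_lift:
  assumes "i \<in> Cof C" "p \<in> Fib C" "i \<in> Weq C \<or> p \<in> Weq C" "v \<in> hom C (Dom C i) (Dom C p)"
    "w \<in> hom C (Cod C i) (Cod C p)" "p \<cdot> v = w \<cdot> i"
  shows "\<exists>h. h \<in> hom C (Cod C i) (Dom C p) \<and> h \<cdot> i = v \<and> p \<cdot> h = w"
  using model_lifts[OF assms(1-3)] assms(4-6) unfolding lifts_def by blast

lemma factor_cof_tfib:
  assumes "f \<in> Arr C"
  obtains i p where "i \<in> Cof C" "p \<in> Fib C" "p \<in> Weq C" "Dom C i = Dom C f" "Dom C p = Cod C i"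
    "Cod C p = Cod C f" "p \<cdot> i = f"
proof -
  obtain E l r where "functorial_factorization C E l r" "\<forall>f \<in> Arr C. l f \<in> Cof C \<and> r f \<in> Fib C \<inter> Weq C"
    using model unfolding model_category_def by blast
  then show ?thesis using assms that[of "l f" "r f"] unfolding functorial_factorization_def by auto
qed

lemma factor_tcof_fib:
  assumes "f \<in> Arr C"
  obtains i p where "i \<in> Cof C" "i \<in> Weq C" "p \<in> Fib C" "Dom C i = Dom C f" "Dom C p = Cod C i"
    "Cod C p = Cod C f" "p \<cdot> i = f"
proof -
  obtain E l r where "functorial_factorization C E l r" "\<forall>f \<in> Arr C. l f \<in> Cof C \<inter> Weq C \<and> r f \<in> Fib C"
    using model unfolding model_category_def by blast
  then show ?thesis using assms that[of "l f" "r f"] unfolding functorial_factorization_def by auto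
qed

section \<open>Retract arguments: the classes of maps are determined by lifting\<close>

text \<open>Lift in the square with top \<open>j\<close> and bottom an identity: the lift is a
  section of \<open>p\<close> carrying \<open>p \<cdot> j\<close> to \<open>j\<close>.\<close>

lemma retract_of_left_factor:
  assumes "p \<in> Arr C" "j \<in> Arr C" "Dom C p = Cod C j" "lifts C (p \<cdot> j) p"
  shows "retract_of C (p \<cdot> j) j"
proof -
  have "j \<in> hom C (Dom C (p \<cdot> j)) (Dom C p)" "Ident C (Cod C p) \<in> hom C (Cod C (p \<cdot> j)) (Cod C p)"
    "p \<cdot> j = Ident C (Cod C p) \<cdot> (p \<cdot> j)" using assms by auto
  then obtain h where h: "h \<in> hom C (Cod C (p \<cdot> j)) (Dom C p)" "h \<cdot> (p \<cdot> j) = j" "p \<cdot> h = Ident C (Cod C p)"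
    using liftsE[OF assms(4)] assms by (metis comp_simps(1))
  show ?thesis
    unfolding retract_of_def using assms h
    by (intro conjI bexI[of _ "Ident C (Dom C j)"] bexI[of _ h] bexI[of _ p]) auto
qed

lemma retract_of_right_factor:
  assumes "p \<in> Arr C" "j \<in> Arr C" "Dom C p = Cod C j" "lifts C j (p \<cdot> j)"
  shows "retract_of C (p \<cdot> j) p"
proof -
  have "p \<in> hom C (Cod C j) (Cod C (p \<cdot> j))" "Ident C (Dom C j) \<in> hom C (Dom C j) (Dom C (p \<cdot> j))"
    "(p \<cdot> j) \<cdot> Ident C (Dom C j) = p \<cdot> j" using assms by auto
  then obtain h where h: "h \<in> hom C (Cod C j) (Dom C (p \<cdot> j))" "h \<cdot> j = Ident C (Dom C j)" "(p \<cdot> j) \<cdot> h = p"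
    using liftsE[OF assms(4)] assms by (metis comp_simps(1))
  show ?thesis
    unfolding retract_of_def using assms h
    by (intro conjI bexI[of _ j] bexI[of _ "Ident C (Cod C p)"] bexI[of _ h]) auto
qed

text \<open>Factor \<open>p\<close> as a trivial cofibration followed by a fibration; lifting
  against the first factor exhibits \<open>p\<close> as a retract of the second. The three lemmas
  that follow vary the factorization and the side.\<close>

lemma fib_if_lifts: "p \<in> Arr C \<Longrightarrow> (\<And>i. i \<in> Cof C \<Longrightarrow> i \<in> Weq C \<Longrightarrow> lifts C i p) \<Longrightarrow> p \<in> Fib C"
  using factor_tcof_fib[of p] retract_of_right_factor retract_closed(3) cof_arr fib_arr by metis

lemma tfib_if_lifts: "p \<in> Arr C \<Longrightarrow> (\<And>i. i \<in> Cof C \<Longrightarrow> lifts C i p) \<Longrightarrow> p \<in> Fib C \<and> p \<in> Weq C"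
  using factor_cof_tfib[of p] retract_of_right_factor retract_closed(1,3) cof_arr fib_arr by metis

lemma cof_if_lifts: "i \<in> Arr C \<Longrightarrow> (\<And>p. p \<in> Fib C \<Longrightarrow> p \<in> Weq C \<Longrightarrow> lifts C i p) \<Longrightarrow> i \<in> Cof C"
  using factor_cof_tfib[of i] retract_of_left_factor retract_closed(2) cof_arr fib_arr by metis

lemma tcof_if_lifts: "i \<in> Arr C \<Longrightarrow> (\<And>p. p \<in> Fib C \<Longrightarrow> lifts C i p) \<Longrightarrow> i \<in> Cof C \<and> i \<in> Weq C"
  using factor_tcof_fib[of i] retract_of_left_factor retract_closed(1,2) cof_arr fib_arr by metis

section \<open>Fibrant and cofibrant objects\<close>

text \<open>Squares over a terminal object commute automatically, so lifting against X -> 1 is mere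
  extension. This form no longer refers to a chosen terminal object.\<close>

lemma fibrant_iff:
  "fibrant C Z \<longleftrightarrow> Z \<in> Obj C \<and>
    (\<forall>i w. i \<in> Cof C \<longrightarrow> i \<in> Weq C \<longrightarrow> w \<in> hom C (Dom C i) Z \<longrightarrow> (\<exists>h \<in> hom C (Cod C i) Z. h \<cdot> i = w))"
proof
  assume "fibrant C Z"
  then obtain T f where f: "is_terminal C T" "f \<in> hom C Z T" "f \<in> Fib C" unfolding fibrant_def by blast
  have "\<exists>h \<in> hom C (Cod C i) Z. h \<cdot> i = w" if i: "i \<in> Cof C" "i \<in> Weq C" and w: "w \<in> hom C (Dom C i) Z" for i w
  proof -
    note [simp] = cof_arr[OF i(1)]
    obtain v where v: "v \<in> hom C (Cod C i) T"
      using terminal_map[OF f(1), of "Cod C i"] by auto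
    have "f \<cdot> w = v \<cdot> i"
      by (rule terminal_unique[OF f(1), of "Dom C i"]) (use f w v in auto)
    then show ?thesis using model_lift[OF i(1) f(3), of w v] i f w v by auto
  qed
  then show "Z \<in> Obj C \<and>
    (\<forall>i w. i \<in> Cof C \<longrightarrow> i \<in> Weq C \<longrightarrow> w \<in> hom C (Dom C i) Z \<longrightarrow> (\<exists>h \<in> hom C (Cod C i) Z. h \<cdot> i = w))"
    using f(2) by auto
next
  assume Z: "Z \<in> Obj C \<and>
    (\<forall>i w. i \<in> Cof C \<longrightarrow> i \<in> Weq C \<longrightarrow> w \<in> hom C (Dom C i) Z \<longrightarrow> (\<exists>h \<in> hom C (Cod C i) Z. h \<cdot> i = w))"
  obtain T where T: "is_terminal C T" by (rule terminal_exists)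
  then obtain f where f: "f \<in> hom C Z T" using Z unfolding is_terminal_def by blast
  have "f \<in> Fib C"
  proof (rule fib_if_lifts)
    fix i assume i: "i \<in> Cof C" "i \<in> Weq C"
    note [simp] = cof_arr[OF i(1)]
    show "lifts C i f"
      unfolding lifts_def
    proof (intro ballI impI)
      fix w v assume w: "w \<in> hom C (Dom C i) (Dom C f)" and v: "v \<in> hom C (Cod C i) (Cod C f)"
      then have "w \<in> hom C (Dom C i) Z" using f by simp
      then obtain h where h: "h \<in> hom C (Cod C i) Z" "h \<cdot> i = w" using Z i by blast
      have "f \<cdot> h = v"
        by (rule terminal_unique[OF T, of "Cod C i"]) (use f h v in auto)
      then show "\<exists>h\<in>hom C (Cod C i) (Dom C f). h \<cdot> i = w \<and> f \<cdot> h = v" using h f by auto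
    qed
  qed (use f in auto)
  then show "fibrant C Z" using T f unfolding fibrant_def by blast
qed

lemma cofibrant_lift:
  assumes Z: "cofibrant C Z" and p: "p \<in> Fib C" "p \<in> Weq C" and v: "v \<in> hom C Z (Cod C p)"
  obtains h where "h \<in> hom C Z (Dom C p)" "p \<cdot> h = v"
proof -
  obtain T f where f: "is_initial C T" "f \<in> hom C T Z" "f \<in> Cof C" using Z unfolding cofibrant_def by blast
  note [simp] = fib_arr[OF p(1)]
  obtain w where w: "w \<in> hom C T (Dom C p)"
    using initial_map[OF f(1), of "Dom C p"] by auto
  have "p \<cdot> w = v \<cdot> f"
    by (rule initial_unique[OF f(1), of "Cod C p"]) (use f w v in auto)
  then show ?thesis using model_lift[OF f(3) p(1), of w v] p f w v that by auto
qed

lemma cofibrant_obj: "cofibrant C Z \<Longrightarrow> Z \<in> Obj C"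
  unfolding cofibrant_def by auto

lemma fibrant_obj: "fibrant C Z \<Longrightarrow> Z \<in> Obj C"
  by (simp add: fibrant_iff)

lemma fibrant_extend:
  assumes "fibrant C Z" "i \<in> Cof C" "i \<in> Weq C" "w \<in> hom C (Dom C i) Z"
  obtains h where "h \<in> hom C (Cod C i) Z" "h \<cdot> i = w"
  using assms fibrant_iff by blast

lemma cofibrant_cod:
  assumes "cofibrant C X" "i \<in> Cof C" "Dom C i = X"
  shows "cofibrant C (Cod C i)"
proof -
  obtain T f where f: "is_initial C T" "f \<in> hom C T X" "f \<in> Cof C" using assms(1) unfolding cofibrant_def by blast
  then have "i \<cdot> f \<in> hom C T (Cod C i)" "i \<cdot> f \<in> Cof C" using assms cof_arr cof_comp by auto
  then show ?thesis using f(1) unfolding cofibrant_def by blast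
qed

lemma fibrant_dom:
  assumes X: "fibrant C X" and p: "p \<in> Fib C" "Cod C p = X"
  shows "fibrant C (Dom C p)"
proof -
  obtain T f where f: "is_terminal C T" "f \<in> hom C X T" "f \<in> Fib C" using assms(1) unfolding fibrant_def by blast
  then have "f \<cdot> p \<in> hom C (Dom C p) T" "f \<cdot> p \<in> Fib C" using assms fib_arr fib_comp by auto
  then show ?thesis using f(1) unfolding fibrant_def by blast
qed

lemma fibrant_replacement:
  assumes "X \<in> Obj C"
  obtains r where "r \<in> Cof C" "r \<in> Weq C" "Dom C r = X" "fibrant C (Cod C r)"
proof -
  obtain T where T: "is_terminal C T" by (rule terminal_exists)
  then obtain f where f: "f \<in> hom C X T" using assms unfolding is_terminal_def by blast
  then obtain i p where ip: "i \<in> Cof C" "i \<in> Weq C" "p \<in> Fib C" "Dom C i = X" "Dom C p = Cod C i"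
    "Cod C p = T" using factor_tcof_fib[of f] by (metis in_hom)
  then have "fibrant C (Cod C i)" using T fib_arr unfolding fibrant_def by auto
  then show ?thesis using ip that by blast
qed

section \<open>Cylinders and path objects\<close>

text \<open>Against a trivial fibration the lift is prescribed on the first summand; cofibrancy of
  the second supplies the rest. This direct argument avoids stability of cofibrations under
  pushout.\<close>

lemma coproduct_inclusion_cof:
  assumes ij: "coproduct_of C i j" and Y: "cofibrant C (Dom C j)"
  shows "i \<in> Cof C"
proof (rule cof_if_lifts)
  show i: "i \<in> Arr C" using ij by (simp add: coproduct_of_def)
  fix p assume p: "p \<in> Fib C" "p \<in> Weq C"
  have ij' [simp]: "i \<in> Arr C" "j \<in> Arr C" "Cod C j = Cod C i" "p \<in> Arr C"
    using ij fib_arr[OF p(1)] by (auto simp: coproduct_of_def)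
  show "lifts C i p"
    unfolding lifts_def
  proof (intro ballI impI)
    fix a v assume a: "a \<in> hom C (Dom C i) (Dom C p)" and v: "v \<in> hom C (Cod C i) (Cod C p)"
      and e: "p \<cdot> a = v \<cdot> i"
    obtain b where b: "b \<in> hom C (Dom C j) (Dom C p)" "p \<cdot> b = v \<cdot> j"
      using cofibrant_lift[OF Y p, of "v \<cdot> j"] v by auto
    obtain h where h: "h \<in> hom C (Cod C i) (Dom C p)" "h \<cdot> i = a" "h \<cdot> j = b"
      using coproduct_copair[OF ij a b(1)] by blast
    have "p \<cdot> h = v"
      by (rule coproduct_eq[OF ij]) (use h e b v in auto)
    then show "\<exists>h\<in>hom C (Cod C i) (Dom C p). h \<cdot> i = a \<and> p \<cdot> h = v" using h by auto
  qed
qed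

lemma coproduct_sym: "coproduct_of C i j \<Longrightarrow> coproduct_of C j i"
  unfolding coproduct_of_def by (simp add: conj_ac del: in_hom) (metis (no_types, lifting))

text \<open>Factor the codiagonal \<open>f\<close> of \<open>M\<close> as a cofibration
  \<open>c\<close> and a trivial fibration \<open>s\<close>; the ends are \<open>c\<close>
  restricted to the two summands.\<close>

lemma cylinder_exists:
  assumes M: "cofibrant C M"
  obtains T d e where "cylinder C M T d e"
proof -
  note Mo [simp] = cofibrant_obj[OF M]
  obtain i j where ij: "coproduct_of C i j" and dij [simp]: "Dom C i = M" "Dom C j = M"
    using coproduct_exists[OF Mo Mo] by blast
  have ij' [simp]: "i \<in> Arr C" "j \<in> Arr C" "Cod C j = Cod C i" using ij by (auto simp: coproduct_of_def)
  obtain f where f: "f \<in> hom C (Cod C i) M" "f \<cdot> i = Ident C M" "f \<cdot> j = Ident C M"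
    using coproduct_copair[OF ij, of "Ident C M" M "Ident C M"] by auto
  obtain c s where cs: "c \<in> Cof C" "s \<in> Fib C" "s \<in> Weq C" "Dom C c = Cod C i" "Dom C s = Cod C c" "Cod C s = M"
    "s \<cdot> c = f"
    using factor_cof_tfib[of f] f by auto
  note [simp] = cof_arr[OF cs(1)] fib_arr[OF cs(2)] cs(4-6)
  have sc: "s \<cdot> (c \<cdot> i) = Ident C M" "s \<cdot> (c \<cdot> j) = Ident C M"
    using comp_eq_extend1[OF cs(7), of i] comp_eq_extend1[OF cs(7), of j] f by auto
  have cof: "c \<cdot> i \<in> Cof C" "c \<cdot> j \<in> Cof C"
    using coproduct_inclusion_cof[OF ij] coproduct_inclusion_cof[OF coproduct_sym[OF ij]] M cof_comp cs(1)
    by auto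
  \<comment> \<open>Each end is a section of the weak equivalence \<open>s\<close>.\<close>
  have weq: "c \<cdot> i \<in> Weq C" "c \<cdot> j \<in> Weq C"
    using weq_cancel_left[OF cs(3), of "c \<cdot> i"] weq_cancel_left[OF cs(3), of "c \<cdot> j"] sc weq_ident by auto
  have "\<exists>h \<in> hom C (Cod C c) (Dom C p). h \<cdot> (c \<cdot> i) = a \<and> h \<cdot> (c \<cdot> j) = b \<and> p \<cdot> h = v"
    if p: "p \<in> Fib C" "p \<in> Weq C" and a: "a \<in> hom C M (Dom C p)" and b: "b \<in> hom C M (Dom C p)"
      and v: "v \<in> hom C (Cod C c) (Cod C p)" and e: "p \<cdot> a = v \<cdot> (c \<cdot> i)" "p \<cdot> b = v \<cdot> (c \<cdot> j)" for p a b v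
  proof -
    note [simp] = fib_arr[OF p(1)]
    obtain k where k: "k \<in> hom C (Cod C i) (Dom C p)" "k \<cdot> i = a" "k \<cdot> j = b"
      using coproduct_copair[OF ij, of a _ b] a b by auto
    have "p \<cdot> k = v \<cdot> c"
      by (rule coproduct_eq[OF ij]) (use k e v in auto)
    then obtain h where h: "h \<in> hom C (Cod C c) (Dom C p)" "h \<cdot> c = k" "p \<cdot> h = v"
      using model_lift[OF cs(1) p(1), of k v] p k v by auto
    then show ?thesis
      using comp_eq_extend1[OF h(2), of i] comp_eq_extend1[OF h(2), of j] k by auto
  qed
  moreover have "\<exists>s \<in> hom C (Cod C c) M. s \<cdot> (c \<cdot> i) = Ident C M \<and> s \<cdot> (c \<cdot> j) = Ident C M"
    using sc by (intro bexI[of _ s]) auto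
  moreover have "c \<cdot> i \<in> hom C M (Cod C c)" "c \<cdot> j \<in> hom C M (Cod C c)" by simp_all
  ultimately have "cylinder C M (Cod C c) (c \<cdot> i) (c \<cdot> j)"
    unfolding cylinder_def using cof weq by blast
  then show ?thesis by (rule that)
qed

lemma product_eq:
  assumes "product_of C p q" "p \<cdot> h = p \<cdot> k" "q \<cdot> h = q \<cdot> k" "h \<in> hom C Z (Dom C p)" "k \<in> hom C Z (Dom C p)"
  shows "h = k"
proof -
  have "p \<cdot> k \<in> hom C Z (Cod C p)" "q \<cdot> k \<in> hom C Z (Cod C q)"
    using assms by (auto simp: product_of_def)
  then show ?thesis using assms unfolding product_of_def by metis
qed

lemma product_pair:
  assumes "product_of C p q" "v \<in> hom C Z (Cod C p)" "w \<in> hom C Z (Cod C q)"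
  obtains h where "h \<in> hom C Z (Dom C p)" "p \<cdot> h = v" "q \<cdot> h = w"
  using assms unfolding product_of_def by metis

lemma product_projection_fib:
  assumes pq: "product_of C p q" and Y: "fibrant C (Cod C p)"
  shows "q \<in> Fib C"
proof (rule fib_if_lifts)
  have pq' [simp]: "p \<in> Arr C" "q \<in> Arr C" "Dom C q = Dom C p"
    using pq by (auto simp: product_of_def)
  show "q \<in> Arr C" by simp
  fix i assume i: "i \<in> Cof C" "i \<in> Weq C"
  note [simp] = cof_arr[OF i(1)]
  show "lifts C i q"
    unfolding lifts_def
  proof (intro ballI impI)
    fix a v assume a: "a \<in> hom C (Dom C i) (Dom C q)" and v: "v \<in> hom C (Cod C i) (Cod C q)"
      and e: "q \<cdot> a = v \<cdot> i"
    obtain b where b: "b \<in> hom C (Cod C i) (Cod C p)" "b \<cdot> i = p \<cdot> a"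
      using fibrant_extend[OF Y i, of "p \<cdot> a"] a by auto
    obtain h where h: "h \<in> hom C (Cod C i) (Dom C p)" "p \<cdot> h = b" "q \<cdot> h = v"
      using product_pair[OF pq b(1) v] by blast
    have "h \<cdot> i = a"
      by (rule product_eq[OF pq])
        (use h a b e comp_eq_extend1[OF h(2), of i] comp_eq_extend1[OF h(3), of i] in auto)
    then show "\<exists>h\<in>hom C (Cod C i) (Dom C q). h \<cdot> i = a \<and> q \<cdot> h = v" using h by auto
  qed
qed

text \<open>Factor the diagonal as a trivial cofibration \<open>c\<close> and a fibration. The last
  clause is the lifting property of the pairing of \<open>d\<close> and \<open>e\<close> against
  trivial cofibrations, phrased without naming a product.\<close>

lemma path_object_exists:
  assumes K: "fibrant C K"
  obtains P c d e where "c \<in> hom C K P" "d \<in> hom C P K" "e \<in> hom C P K" "e \<in> Fib C" "e \<in> Weq C"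
    "d \<cdot> c = Ident C K" "e \<cdot> c = Ident C K"
    "\<And>i a b v. i \<in> Cof C \<Longrightarrow> i \<in> Weq C \<Longrightarrow> v \<in> hom C (Dom C i) P \<Longrightarrow> a \<in> hom C (Cod C i) K \<Longrightarrow>
      b \<in> hom C (Cod C i) K \<Longrightarrow> d \<cdot> v = a \<cdot> i \<Longrightarrow> e \<cdot> v = b \<cdot> i \<Longrightarrow>
      \<exists>h \<in> hom C (Cod C i) P. d \<cdot> h = a \<and> e \<cdot> h = b \<and> h \<cdot> i = v"
proof -
  note Ko [simp] = fibrant_obj[OF K]
  obtain p q where pq: "product_of C p q" and dpq [simp]: "Cod C p = K" "Cod C q = K"
    using product_exists[OF Ko Ko] by blast
  have pq' [simp]: "p \<in> Arr C" "q \<in> Arr C" "Dom C q = Dom C p" using pq by (auto simp: product_of_def)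
  obtain f where f: "f \<in> hom C K (Dom C p)" "p \<cdot> f = Ident C K" "q \<cdot> f = Ident C K"
    using product_pair[OF pq, of "Ident C K" K "Ident C K"] by auto
  obtain c s where cs: "c \<in> Cof C" "c \<in> Weq C" "s \<in> Fib C" "Dom C c = K" "Dom C s = Cod C c" "Cod C s = Dom C p"
    "s \<cdot> c = f"
    using factor_tcof_fib[of f] f by auto
  note [simp] = cof_arr[OF cs(1)] fib_arr[OF cs(3)] cs(4-7)
  have "q \<cdot> s \<in> Fib C" using fib_comp[OF cs(3) product_projection_fib[OF pq]] K by simp
  moreover have "q \<cdot> s \<in> Weq C" using weq_cancel_right[OF cs(2), of "q \<cdot> s"] f weq_ident by simp
  moreover have "\<exists>h \<in> hom C (Cod C i) (Cod C c). (p \<cdot> s) \<cdot> h = a \<and> (q \<cdot> s) \<cdot> h = b \<and> h \<cdot> i = v"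
    if i: "i \<in> Cof C" "i \<in> Weq C" and v: "v \<in> hom C (Dom C i) (Cod C c)" and a: "a \<in> hom C (Cod C i) K"
      and b: "b \<in> hom C (Cod C i) K" and e: "(p \<cdot> s) \<cdot> v = a \<cdot> i" "(q \<cdot> s) \<cdot> v = b \<cdot> i" for i a b v
  proof -
    note [simp] = cof_arr[OF i(1)]
    obtain k where k: "k \<in> hom C (Cod C i) (Dom C p)" "p \<cdot> k = a" "q \<cdot> k = b"
      using product_pair[OF pq, of a _ b] a b by auto
    have "s \<cdot> v = k \<cdot> i"
      by (rule product_eq[OF pq])
        (use k e v comp_eq_extend1[OF k(2), of i] comp_eq_extend1[OF k(3), of i] in auto)
    then obtain h where h: "h \<in> hom C (Cod C i) (Cod C c)" "h \<cdot> i = v" "s \<cdot> h = k"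
      using model_lift[OF i(1) cs(3), of v k] i k v by auto
    then show ?thesis using k by auto
  qed
  ultimately show ?thesis using that[of c "Cod C c" "p \<cdot> s" "q \<cdot> s"] f by simp
qed

section \<open>From homotopy classes to weak equivalences\<close>

text \<open>The fibration part \<open>p\<close> of \<open>g\<close> turns out to have a section,
  built from a section of the trivial fibration \<open>q\<close> in a factorization of
  \<open>g \<cdot> f\<close>; cofibrancy of the target of \<open>g\<close> is what provides the
  latter. Then \<open>p\<close> is a retract of a weak equivalence, so \<open>g\<close> and hence
  \<open>f\<close> are weak equivalences.\<close>

lemma two_of_six:
  assumes f: "f \<in> Arr C" and g: "g \<in> Arr C" and h: "h \<in> Arr C"
    and [simp]: "Dom C g = Cod C f" "Dom C h = Cod C g"
    and gf: "g \<cdot> f \<in> Weq C" and hg: "h \<cdot> g \<in> Weq C" and Z: "cofibrant C (Cod C g)"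
  shows "f \<in> Weq C"
proof -
  note [simp] = f g h cofibrant_obj[OF Z]
  obtain i p where ip: "i \<in> Cof C" "i \<in> Weq C" "p \<in> Fib C" "Dom C i = Cod C f" "Dom C p = Cod C i"
    "Cod C p = Cod C g" "p \<cdot> i = g"
    using factor_tcof_fib[of g] by auto
  note [simp] = cof_arr[OF ip(1)] fib_arr[OF ip(3)] ip(4-6)
  have hp: "h \<cdot> p \<in> Weq C"
    using weq_cancel_right[OF ip(2), of "h \<cdot> p"] ip(7) hg by simp
  obtain j q where jq: "j \<in> Cof C" "j \<in> Weq C" "q \<in> Fib C" "Dom C j = Dom C f" "Dom C q = Cod C j"
    "Cod C q = Cod C g" "q \<cdot> j = g \<cdot> f"
    using factor_tcof_fib[of "g \<cdot> f"] by auto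
  note [simp] = cof_arr[OF jq(1)] fib_arr[OF jq(3)] jq(4-6)
  have "q \<in> Weq C" using weq_cancel_right[OF jq(2), of q] jq(7) gf by simp
  then obtain z where z: "z \<in> hom C (Cod C g) (Cod C j)" "q \<cdot> z = Ident C (Cod C g)"
    using cofibrant_lift[OF Z jq(3), of "Ident C (Cod C g)"] by auto
  have "p \<cdot> (i \<cdot> f) = q \<cdot> j" using comp_eq_extend1[OF ip(7), of f] jq(7) by simp
  then obtain l where l: "l \<in> hom C (Cod C j) (Cod C i)" "p \<cdot> l = q"
    using model_lift[OF jq(1) ip(3), of "i \<cdot> f" q] jq(2) by auto
  \<comment> \<open>\<open>t\<close> is a section of \<open>p\<close>: \<open>z\<close> is a section
    of \<open>q\<close>, and \<open>l\<close> carries \<open>q\<close> to \<open>p\<close>.\<close>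
  define t where "t = l \<cdot> z"
  have t [simp]: "t \<in> Arr C" "Dom C t = Cod C g" "Cod C t = Cod C i" using l z by (auto simp: t_def)
  have pt: "p \<cdot> t = Ident C (Cod C g)"
    using comp_eq_extend1[OF l(2), of z] l z by (simp add: t_def)
  have ptp: "p \<cdot> (t \<cdot> p) = p" using comp_eq_extend1[OF pt, of p] by simp
  \<comment> \<open>Composing \<open>t \<cdot> p\<close> with the weak equivalence
    \<open>h \<cdot> p\<close> returns \<open>h \<cdot> p\<close>, so two-of-three applies to the
    idempotent \<open>t \<cdot> p\<close>.\<close>
  then have "t \<cdot> p \<in> Weq C" using weq_cancel_left[OF hp, of "t \<cdot> p"] hp by simp
  moreover have "retract_of C p (t \<cdot> p)"
    unfolding retract_of_def using pt ptp
    by (intro conjI bexI[of _ "Ident C (Cod C i)"] bexI[of _ t] bexI[of _ p]) auto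
  ultimately have "p \<in> Weq C" by (rule retract_closed(1)[rotated])
  then have "g \<in> Weq C" using weq_comp[OF ip(2)] ip(7) by (metis ip(5))
  then show ?thesis using weq_cancel_left[OF _ gf] by simp
qed

text \<open>Surjectivity and injectivity of the map induced by \<open>g\<close> on homotopy classes
  out of \<open>M\<close>, with every homotopy on one cylinder fixed in advance. Split
  \<open>g\<close> into a trivial cofibration \<open>i\<close>, which has a retraction
  \<open>r\<close> since the source of \<open>g\<close> is fibrant, and a trivial fibration
  \<open>p\<close>, through which maps and homotopies lift.\<close>

lemma weq_up_to_homotopy:
  assumes g: "g \<in> Weq C" and X': "fibrant C (Dom C g)" and X: "fibrant C (Cod C g)"
    and M: "cofibrant C M" and cyl: "cylinder C M T d e"
  shows "w \<in> hom C M (Cod C g) \<Longrightarrow> \<exists>v \<in> hom C M (Dom C g). \<exists>L \<in> hom C T (Cod C g). L \<cdot> d = g \<cdot> v \<and> L \<cdot> e = w"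
    and "v \<in> hom C M (Dom C g) \<Longrightarrow> v' \<in> hom C M (Dom C g) \<Longrightarrow> L \<in> hom C T (Cod C g) \<Longrightarrow>
      L \<cdot> d = g \<cdot> v \<Longrightarrow> L \<cdot> e = g \<cdot> v' \<Longrightarrow> \<exists>L' \<in> hom C T (Dom C g). L' \<cdot> d = v \<and> L' \<cdot> e = v'"
proof -
  note [simp] = weq_arr[OF g] cofibrant_obj[OF M]
  have de [simp]: "d \<in> Arr C" "Dom C d = M" "Cod C d = T" "e \<in> Arr C" "Dom C e = M" "Cod C e = T"
    using cyl by (auto simp: cylinder_def)
  have ext: "\<exists>h \<in> hom C T (Dom C p). h \<cdot> d = a \<and> h \<cdot> e = b \<and> p \<cdot> h = v"
    if "p \<in> Fib C" "p \<in> Weq C" "a \<in> hom C M (Dom C p)" "b \<in> hom C M (Dom C p)"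
      "v \<in> hom C T (Cod C p)" "p \<cdot> a = v \<cdot> d" "p \<cdot> b = v \<cdot> e" for p a b v
    using cyl that unfolding cylinder_def by blast
  have s: "\<exists>s \<in> hom C T M. s \<cdot> d = Ident C M \<and> s \<cdot> e = Ident C M"
    using cyl unfolding cylinder_def by blast
  obtain i p where ip: "i \<in> Cof C" "i \<in> Weq C" "p \<in> Fib C" "Dom C i = Dom C g" "Dom C p = Cod C i"
    "Cod C p = Cod C g" "p \<cdot> i = g"
    using factor_tcof_fib[of g] by auto
  note [simp] = cof_arr[OF ip(1)] fib_arr[OF ip(3)] ip(4-6)
  have p: "p \<in> Weq C" using weq_cancel_right[OF ip(2), of p] ip(7) g by simp
  obtain r where r: "r \<in> hom C (Cod C i) (Dom C g)" "r \<cdot> i = Ident C (Dom C g)"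
    using fibrant_extend[OF X' ip(1,2), of "Ident C (Dom C g)"] by auto
  show "\<exists>L' \<in> hom C T (Dom C g). L' \<cdot> d = v \<and> L' \<cdot> e = v'"
    if v: "v \<in> hom C M (Dom C g)" "v' \<in> hom C M (Dom C g)" "L \<in> hom C T (Cod C g)"
      "L \<cdot> d = g \<cdot> v" "L \<cdot> e = g \<cdot> v'"
  proof -
    \<comment> \<open>The homotopy \<open>L\<close> lifts through \<open>p\<close> to one between
      \<open>i \<cdot> v\<close> and \<open>i \<cdot> v'\<close>; applying \<open>r\<close> then
      removes \<open>i\<close>.\<close>
    have "\<exists>h \<in> hom C T (Dom C p). h \<cdot> d = i \<cdot> v \<and> h \<cdot> e = i \<cdot> v' \<and> p \<cdot> h = L"
      using v comp_eq_extend1[OF ip(7), of v] comp_eq_extend1[OF ip(7), of v'] by (intro ext ip p) auto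
    then obtain h where h: "h \<in> hom C T (Dom C p)" "h \<cdot> d = i \<cdot> v" "h \<cdot> e = i \<cdot> v'" by blast
    have "r \<cdot> (h \<cdot> d) = v" "r \<cdot> (h \<cdot> e) = v'"
      using h v comp_eq_extend1[OF r(2), of v] comp_eq_extend1[OF r(2), of v'] r(1) by auto
    then show ?thesis using r h by (intro bexI[of _ "r \<cdot> h"]) auto
  qed
  show "\<exists>v \<in> hom C M (Dom C g). \<exists>L \<in> hom C T (Cod C g). L \<cdot> d = g \<cdot> v \<and> L \<cdot> e = w"
    if w: "w \<in> hom C M (Cod C g)"
  proof -
    obtain k where k: "k \<in> hom C M (Cod C i)" "p \<cdot> k = w"
      using cofibrant_lift[OF M ip(3) p, of w] w by auto
    have K: "fibrant C (Cod C i)" using fibrant_dom[OF X ip(3)] by simp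
    then obtain P c x y where P: "c \<in> hom C (Cod C i) P" "x \<in> hom C P (Cod C i)" "y \<in> hom C P (Cod C i)"
      "y \<in> Fib C" "y \<in> Weq C" "x \<cdot> c = Ident C (Cod C i)" "y \<cdot> c = Ident C (Cod C i)"
      and Pl: "\<And>i' a b v. i' \<in> Cof C \<Longrightarrow> i' \<in> Weq C \<Longrightarrow> v \<in> hom C (Dom C i') P \<Longrightarrow> a \<in> hom C (Cod C i') (Cod C i) \<Longrightarrow>
        b \<in> hom C (Cod C i') (Cod C i) \<Longrightarrow> x \<cdot> v = a \<cdot> i' \<Longrightarrow> y \<cdot> v = b \<cdot> i' \<Longrightarrow>
        \<exists>h \<in> hom C (Cod C i') P. x \<cdot> h = a \<and> y \<cdot> h = b \<and> h \<cdot> i' = v"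
      using path_object_exists[OF K] by metis
    note [simp] = P(1-3)[unfolded in_hom] r[unfolded in_hom] k[unfolded in_hom]
    \<comment> \<open>A right homotopy from \<open>i \<cdot> r\<close> to the identity, constant
      along \<open>i\<close>. It exists because the two maps agree on \<open>i\<close>, a trivial
      cofibration.\<close>
    have "\<exists>h \<in> hom C (Cod C i) P. x \<cdot> h = i \<cdot> r \<and> y \<cdot> h = Ident C (Cod C i) \<and> h \<cdot> i = c \<cdot> i"
      using comp_eq_extend1[OF P(6), of i] comp_eq_extend1[OF P(7), of i] by (intro Pl ip) auto
    then obtain h where h: "h \<in> hom C (Cod C i) P" "x \<cdot> h = i \<cdot> r" "y \<cdot> h = Ident C (Cod C i)" by blast
    note [simp] = h(1)[unfolded in_hom]
    obtain s where s: "s \<in> hom C T M" "s \<cdot> d = Ident C M" "s \<cdot> e = Ident C M" using s by blast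
    note [simp] = s[unfolded in_hom]
    have yh: "y \<cdot> (h \<cdot> k) = k" "y \<cdot> (c \<cdot> k) = k"
      using comp_eq_extend1[OF h(3), of k] comp_eq_extend1[OF P(7), of k] by auto
    \<comment> \<open>Conversion of the right homotopy into a left one on the given cylinder:
      \<open>h \<cdot> k\<close> and the constant path \<open>c \<cdot> k\<close> have the same
      image under the trivial fibration \<open>y\<close>, so they are joined over \<open>T\<close>.
      Following \<open>l\<close> by \<open>p \<cdot> x\<close> gives the homotopy from
      \<open>g \<cdot> (r \<cdot> k)\<close> to \<open>w\<close>.\<close>
    have "\<exists>l \<in> hom C T (Dom C y). l \<cdot> d = h \<cdot> k \<and> l \<cdot> e = c \<cdot> k \<and> y \<cdot> l = k \<cdot> s"
      using yh by (intro ext P) auto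
    then obtain l where l: "l \<in> hom C T P" "l \<cdot> d = h \<cdot> k" "l \<cdot> e = c \<cdot> k" by auto
    note [simp] = l[unfolded in_hom]
    have "p \<cdot> (x \<cdot> (l \<cdot> d)) = g \<cdot> (r \<cdot> k)"
      using comp_eq_extend[OF h(2), of k] comp_eq_extend1[OF ip(7), of "r \<cdot> k"] by simp
    moreover have "p \<cdot> (x \<cdot> (l \<cdot> e)) = w"
      using comp_eq_extend1[OF P(6), of k] by simp
    ultimately show ?thesis
      by (intro bexI[of _ "r \<cdot> k"] bexI[of _ "p \<cdot> (x \<cdot> l)"]) auto
  qed
qed

end

section \<open>Quillen adjunctions\<close>

text \<open>Conditions on fibrations are the ones that can be checked for modules, where they are
  read off underlying arrows; lifting transposes them to conditions on cofibrations.\<close>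

lemma left_quillen_by_right_adjoint:
  fixes u :: "'u itself"
  assumes inf: "infinite (UNIV :: 'u set)" and C: "model_category u C" and D: "model_category u D"
    and adj: "adjunction C D F U \<phi>"
    and U: "\<And>p. p \<in> Fib D \<Longrightarrow> on_arr U p \<in> Fib C" "\<And>p. p \<in> Fib D \<Longrightarrow> p \<in> Weq D \<Longrightarrow> on_arr U p \<in> Weq C"
  shows "left_quillen u C D F U \<phi>"
proof -
  interpret C: model_structure u C using inf C by unfold_locales
  interpret D: model_structure u D using inf D by unfold_locales
  note F = functorD(3-)[OF adjunctionD(1)[OF adj]]
  have "on_arr F i \<in> Cof D" if i: "i \<in> Cof C" for i
    using adj_lifts[OF adj C.cof_arr[OF i]] D.fib_arr U C.model_lifts[OF i] F C.cof_arr[OF i]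
    by (intro D.cof_if_lifts) auto
  moreover have "on_arr F i \<in> Cof D \<and> on_arr F i \<in> Weq D" if i: "i \<in> Cof C" "i \<in> Weq C" for i
    using adj_lifts[OF adj C.cof_arr[OF i(1)]] D.fib_arr U C.model_lifts[OF i(1)] F C.cof_arr[OF i(1)] i
    by (intro D.tcof_if_lifts) auto
  ultimately show ?thesis unfolding left_quillen_def using C D adj by auto
qed

text \<open>Transpose the extension problem along \<phi>: it becomes an extension along
  \<open>F i\<close>, again a trivial cofibration.\<close>

lemma right_adjoint_fibrant:
  fixes u :: "'u itself"
  assumes inf: "infinite (UNIV :: 'u set)" and Q: "left_quillen u C D F U \<phi>" and Z: "fibrant D Z"
  shows "fibrant C (on_obj U Z)"
proof -
  have adj: "adjunction C D F U \<phi>" and Fw: "\<And>f. f \<in> Cof C \<inter> Weq C \<Longrightarrow> on_arr F f \<in> Cof D \<inter> Weq D"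
    using Q unfolding left_quillen_def by auto
  interpret C: model_structure u C using inf Q unfolding left_quillen_def by unfold_locales auto
  interpret D: model_structure u D using inf Q unfolding left_quillen_def by unfold_locales auto
  note [simp] = functorD(3-)[OF adjunctionD(1)[OF adj]] functorD(3-)[OF adjunctionD(2)[OF adj]] D.fibrant_obj[OF Z]
  have "\<exists>h \<in> hom C (Cod C i) (on_obj U Z). h \<cdot>\<^bsub>C\<^esub> i = w"
    if i: "i \<in> Cof C" "i \<in> Weq C" and w: "w \<in> hom C (Dom C i) (on_obj U Z)" for i w
  proof -
    note [simp] = C.cof_arr[OF i(1)]
    obtain w' where w': "w' \<in> hom D (on_obj F (Dom C i)) Z" "\<phi> (Dom C i) Z w' = w"
      using adj_surj[OF adj _ _ w] by auto
    obtain h where h: "h \<in> hom D (on_obj F (Cod C i)) Z" "h \<cdot>\<^bsub>D\<^esub> on_arr F i = w'"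
      using D.fibrant_extend[OF Z, of "on_arr F i" w'] Fw[of i] i w' by auto
    show ?thesis
      using adj_nat_left[OF adj, of i Z h] adj_simps[OF adj, of h "Cod C i" Z] h w'
      by (intro bexI[of _ "\<phi> (Cod C i) Z h"]) auto
  qed
  then show ?thesis by (simp add: C.fibrant_iff)
qed

text \<open>\<open>cofibrant\<close> only asks for some initial object, so it is enough that
  \<open>F\<close> keeps one initial: maps out of \<open>F T\<close> correspond to maps out of
  \<open>T\<close>.\<close>

lemma left_adjoint_cofibrant:
  fixes u :: "'u itself"
  assumes inf: "infinite (UNIV :: 'u set)" and Q: "left_quillen u C D F U \<phi>" and Z: "cofibrant C Z"
  shows "cofibrant D (on_obj F Z)"
proof -
  have adj: "adjunction C D F U \<phi>" and Fc: "\<And>f. f \<in> Cof C \<Longrightarrow> on_arr F f \<in> Cof D"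
    using Q unfolding left_quillen_def by auto
  interpret C: category C by (rule functorD[OF adjunctionD(1)[OF adj]])
  interpret D: category D by (rule functorD[OF adjunctionD(1)[OF adj]])
  note F [simp] = functorD(3-)[OF adjunctionD(1)[OF adj]] functorD(3-)[OF adjunctionD(2)[OF adj]]
  obtain T f where f: "is_initial C T" "f \<in> hom C T Z" "f \<in> Cof C" using Z unfolding cofibrant_def by blast
  have T [simp]: "T \<in> Obj C" using f(1) by (simp add: is_initial_def)
  have "\<exists>!g. g \<in> hom D (on_obj F T) Y" if Y [simp]: "Y \<in> Obj D" for Y
  proof -
    obtain k where k: "k \<in> hom C T (on_obj U Y)" "\<And>k'. k' \<in> hom C T (on_obj U Y) \<Longrightarrow> k' = k"
      using f(1) F(7)[OF Y] unfolding is_initial_def by (metis (no_types, lifting))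
    obtain g where g: "g \<in> hom D (on_obj F T) Y" using adj_surj[OF adj T Y k(1)] by blast
    have "g' = g" if "g' \<in> hom D (on_obj F T) Y" for g'
      using adj_inj[OF adj T Y that g] k(2) adj_hom[OF adj T Y] that g by metis
    then show ?thesis using g by blast
  qed
  then have "is_initial D (on_obj F T)" by (simp add: is_initial_def)
  moreover have "on_arr F f \<in> hom D (on_obj F T) (on_obj F Z)" "on_arr F f \<in> Cof D"
    using f Fc by simp_all
  ultimately show ?thesis unfolding cofibrant_def by blast
qed

lemma left_quillen_comp:
  assumes "left_quillen u C D F U \<phi>" "left_quillen u D E G T \<psi>"
  shows "left_quillen u C E (comp_fctr G F) (comp_fctr U T) (\<lambda>X Z h. \<phi> X (on_obj T Z) (\<psi> (on_obj F X) Z h))"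
  using assms adjunction_comp unfolding left_quillen_def by (auto simp: comp_fctr_def)

text \<open>
  The functors \<open>V\<close> and \<open>G\<close> are compared through the right adjoints: since \<open>\<gamma>\<close> is a weak equivalence on
  fibrant objects, \<open>\<eta> M\<close> induces bijections of homotopy classes of maps into fibrant objects. Homotopies
  are only ever formed on a cylinder of \<open>M\<close> in \<open>K\<close>, whose images under \<open>V\<close> and \<open>G\<close> still have ends that
  are weak equivalences.
\<close>

lemma mate_weq:
  fixes u :: "'u itself"
  assumes inf: "infinite (UNIV :: 'u set)" and V: "left_quillen u K C V R \<alpha>"
    and G: "left_quillen u K C G S \<beta>"
    and M: "cofibrant K M" and \<eta>: "\<eta> \<in> hom C (on_obj V M) (on_obj G M)"
    and \<gamma>: "\<And>Z. Z \<in> Obj C \<Longrightarrow> \<gamma> Z \<in> hom K (on_obj S Z) (on_obj R Z)"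
    and mate: "\<And>Z v. Z \<in> Obj C \<Longrightarrow> v \<in> hom C (on_obj G M) Z \<Longrightarrow> \<alpha> M Z (v \<cdot>\<^bsub>C\<^esub> \<eta>) = \<gamma> Z \<cdot>\<^bsub>K\<^esub> \<beta> M Z v"
    and \<gamma>w: "\<And>Z. fibrant C Z \<Longrightarrow> \<gamma> Z \<in> Weq K"
  shows "\<eta> \<in> Weq C"
proof -
  have av: "adjunction K C V R \<alpha>" and ag: "adjunction K C G S \<beta>"
    and Vw: "\<And>f. f \<in> Cof K \<Longrightarrow> f \<in> Weq K \<Longrightarrow> on_arr V f \<in> Weq C"
    and Gw: "\<And>f. f \<in> Cof K \<Longrightarrow> f \<in> Weq K \<Longrightarrow> on_arr G f \<in> Weq C"
    using V G unfolding left_quillen_def by auto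
  interpret C: model_structure u C using inf V unfolding left_quillen_def by unfold_locales auto
  interpret K: model_structure u K using inf V unfolding left_quillen_def by unfold_locales auto
  note [simp] = functorD(3-)[OF adjunctionD(1)[OF av]] functorD(3-)[OF adjunctionD(2)[OF av]]
    functorD(3-)[OF adjunctionD(1)[OF ag]] functorD(3-)[OF adjunctionD(2)[OF ag]] K.cofibrant_obj[OF M]
  note [simp] = adj_simps[OF av] adj_simps[OF ag] \<eta>[unfolded in_hom]
  have \<gamma>' [simp]: "\<gamma> Z \<in> Arr K" "Dom K (\<gamma> Z) = on_obj S Z" "Cod K (\<gamma> Z) = on_obj R Z" if "Z \<in> Obj C" for Z
    using \<gamma>[OF that] by auto
  obtain T d e where cyl: "cylinder K M T d e" using K.cylinder_exists[OF M] by blast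
  then have de: "d \<in> hom K M T" "e \<in> hom K M T" "d \<in> Cof K" "d \<in> Weq K" "e \<in> Cof K" "e \<in> Weq K"
    unfolding cylinder_def by auto
  note [simp] = de(1,2)[unfolded in_hom]
  have T [simp]: "T \<in> Obj K" using K.obj_simps(2)[of d] by simp
  \<comment> \<open>If one end of a homotopy is a weak equivalence, so is the homotopy and hence the
    other end. Here \<open>x\<close> stands for the action of \<open>V\<close> or of
    \<open>G\<close> on arrows, under which both ends of the cylinder stay weak
    equivalences.\<close>
  have homotopic_weq: "H \<cdot>\<^bsub>C\<^esub> x d \<in> Weq C"
    if "H \<cdot>\<^bsub>C\<^esub> x e \<in> Weq C" "H \<in> Arr C" "Dom C H = Cod C (x e)" "x e \<in> Weq C" "x d \<in> Weq C" "Cod C (x d) = Cod C (x e)"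
    for H x
    using C.weq_cancel_right[of "x e" H] C.weq_comp[of "x d" H] that by simp
  have fib: "fibrant K (on_obj S Z)" "fibrant K (on_obj R Z)" if "fibrant C Z" for Z
    using right_adjoint_fibrant[OF inf V that] right_adjoint_fibrant[OF inf G that] by auto
  have up: "\<exists>v \<in> hom K M (on_obj S Z). \<exists>L \<in> hom K T (on_obj R Z). L \<cdot>\<^bsub>K\<^esub> d = \<gamma> Z \<cdot>\<^bsub>K\<^esub> v \<and> L \<cdot>\<^bsub>K\<^esub> e = w"
    if "fibrant C Z" "w \<in> hom K M (on_obj R Z)" for Z w
    using K.weq_up_to_homotopy(1)[OF \<gamma>w[OF that(1)] _ _ M cyl, of w] that fib C.fibrant_obj[OF that(1)] by simp
  have down: "\<exists>L' \<in> hom K T (on_obj S Z). L' \<cdot>\<^bsub>K\<^esub> d = v \<and> L' \<cdot>\<^bsub>K\<^esub> e = v'"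
    if "fibrant C Z" "v \<in> hom K M (on_obj S Z)" "v' \<in> hom K M (on_obj S Z)" "L \<in> hom K T (on_obj R Z)"
      "L \<cdot>\<^bsub>K\<^esub> d = \<gamma> Z \<cdot>\<^bsub>K\<^esub> v" "L \<cdot>\<^bsub>K\<^esub> e = \<gamma> Z \<cdot>\<^bsub>K\<^esub> v'" for Z v v' L
    using K.weq_up_to_homotopy(2)[OF \<gamma>w[OF that(1)] _ _ M cyl, of v v' L] that fib C.fibrant_obj[OF that(1)] by simp
  obtain r where r: "r \<in> Cof C" "r \<in> Weq C" "Dom C r = on_obj V M" and rf: "fibrant C (Cod C r)"
    using C.fibrant_replacement[of "on_obj V M"] by auto
  note [simp] = C.cof_arr[OF r(1)] r(3)
  \<comment> \<open>Surjectivity applied to the transpose of the replacement map \<open>r\<close> of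
    \<open>V M\<close>. Transposing back gives \<open>v\<close> and a homotopy \<open>H\<close>
    between \<open>v \<cdot> \<eta>\<close> and \<open>r\<close>.\<close>
  obtain v0 L where v0: "v0 \<in> hom K M (on_obj S (Cod C r))" "L \<in> hom K T (on_obj R (Cod C r))"
    "L \<cdot>\<^bsub>K\<^esub> d = \<gamma> (Cod C r) \<cdot>\<^bsub>K\<^esub> v0" "L \<cdot>\<^bsub>K\<^esub> e = \<alpha> M (Cod C r) r"
    using up[OF rf, of "\<alpha> M (Cod C r) r"] by auto
  obtain v where v: "v \<in> hom C (on_obj G M) (Cod C r)" "\<beta> M (Cod C r) v = v0"
    using adj_surj[OF ag _ _ v0(1)] by auto
  obtain H where H: "H \<in> hom C (on_obj V T) (Cod C r)" "\<alpha> T (Cod C r) H = L"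
    using adj_surj[OF av _ _ v0(2)] by auto
  note [simp] = v(1)[unfolded in_hom] H(1)[unfolded in_hom]
  have He: "H \<cdot>\<^bsub>C\<^esub> on_arr V e = r"
    by (rule adj_inj[OF av, of M "Cod C r"]) (use H v0 adj_nat_left[OF av, of e "Cod C r" H] in auto)
  have Hd: "H \<cdot>\<^bsub>C\<^esub> on_arr V d = v \<cdot>\<^bsub>C\<^esub> \<eta>"
    by (rule adj_inj[OF av, of M "Cod C r"])
      (use H v v0 adj_nat_left[OF av, of d "Cod C r" H] mate[of "Cod C r" v] in auto)
  have v\<eta>: "v \<cdot>\<^bsub>C\<^esub> \<eta> \<in> Weq C"
    using homotopic_weq[of H "on_arr V"] He Hd r(2) Vw de by simp
  obtain r' where r': "r' \<in> Cof C" "r' \<in> Weq C" "Dom C r' = on_obj G M" and rf': "fibrant C (Cod C r')"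
    using C.fibrant_replacement[of "on_obj G M"] by auto
  note [simp] = C.cof_arr[OF r'(1)] r'(3)
  \<comment> \<open>\<open>w\<close> extends \<open>r' \<cdot> \<eta>\<close> to the fibrant
    replacement of \<open>V M\<close>, so that \<open>w \<cdot> H\<close> joins
    \<open>w \<cdot> v \<cdot> \<eta>\<close> to \<open>r' \<cdot> \<eta>\<close>.\<close>
  obtain w where w: "w \<in> hom C (Cod C r) (Cod C r')" "w \<cdot>\<^bsub>C\<^esub> r = r' \<cdot>\<^bsub>C\<^esub> \<eta>"
    using C.fibrant_extend[OF rf' r(1,2), of "r' \<cdot>\<^bsub>C\<^esub> \<eta>"] by auto
  note [simp] = w(1)[unfolded in_hom]
  let ?Z = "Cod C r'" and ?L = "\<alpha> T (Cod C r') (w \<cdot>\<^bsub>C\<^esub> H)"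
  have 1: "?L \<cdot>\<^bsub>K\<^esub> d = \<gamma> ?Z \<cdot>\<^bsub>K\<^esub> \<beta> M ?Z (w \<cdot>\<^bsub>C\<^esub> v)"
    using adj_nat_left[OF av, of d ?Z "w \<cdot>\<^bsub>C\<^esub> H"] mate[of ?Z "w \<cdot>\<^bsub>C\<^esub> v"] Hd by simp
  have 2: "?L \<cdot>\<^bsub>K\<^esub> e = \<gamma> ?Z \<cdot>\<^bsub>K\<^esub> \<beta> M ?Z r'"
    using adj_nat_left[OF av, of e ?Z "w \<cdot>\<^bsub>C\<^esub> H"] mate[of ?Z r'] He w(2) by simp
  \<comment> \<open>By the mate identity both ends of \<open>?L\<close> factor through \<gamma>, so
    injectivity applies: the transposes of \<open>w \<cdot> v\<close> and \<open>r'\<close> are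
    homotopic.\<close>
  obtain L' where L': "L' \<in> hom K T (on_obj S ?Z)" "L' \<cdot>\<^bsub>K\<^esub> d = \<beta> M ?Z (w \<cdot>\<^bsub>C\<^esub> v)" "L' \<cdot>\<^bsub>K\<^esub> e = \<beta> M ?Z r'"
    using down[OF rf' _ _ _ 1 2] by auto
  obtain H' where H': "H' \<in> hom C (on_obj G T) ?Z" "\<beta> T ?Z H' = L'"
    using adj_surj[OF ag _ _ L'(1)] by auto
  note [simp] = H'(1)[unfolded in_hom]
  have H'e: "H' \<cdot>\<^bsub>C\<^esub> on_arr G e = r'"
    by (rule adj_inj[OF ag, of M ?Z]) (use H' L' adj_nat_left[OF ag, of e ?Z H'] in auto)
  have H'd: "H' \<cdot>\<^bsub>C\<^esub> on_arr G d = w \<cdot>\<^bsub>C\<^esub> v"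
    by (rule adj_inj[OF ag, of M ?Z]) (use H' L' adj_nat_left[OF ag, of d ?Z H'] in auto)
  have wv: "w \<cdot>\<^bsub>C\<^esub> v \<in> Weq C"
    using homotopic_weq[of H' "on_arr G"] H'e H'd r'(2) Gw de by simp
  \<comment> \<open>The middle object required by two-of-six: the target of the cofibration
    \<open>r\<close> out of \<open>V M\<close>, which is cofibrant because \<open>V\<close> is left
    Quillen.\<close>
  have "cofibrant C (Cod C v)"
    using C.cofibrant_cod[OF left_adjoint_cofibrant[OF inf V M] r(1)] by simp
  then show ?thesis using C.two_of_six[OF _ _ _ _ _ v\<eta> wv] by simp
qed

section \<open>Closed monoidal categories\<close>

context category
begin

lemma iso_arr [simp]: "is_iso C f \<Longrightarrow> f \<in> Arr C"
  by (simp add: is_iso_def)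

lemma is_isoI:
  assumes "f \<in> Arr C" "g \<in> hom C (Cod C f) (Dom C f)" "g \<cdot> f = Ident C (Dom C f)" "f \<cdot> g = Ident C (Cod C f)"
  shows "is_iso C f"
  using assms unfolding is_iso_def by blast

lemma iso_inverse [simp]: "is_iso C f \<Longrightarrow> is_iso C (inverse_arr f)"
  by (rule is_isoI[where g = f]) simp_all

lemma iso_comp: "is_iso C f \<Longrightarrow> is_iso C g \<Longrightarrow> Dom C g = Cod C f \<Longrightarrow> is_iso C (g \<cdot> f)"
  by (rule is_isoI[where g = "inverse_arr f \<cdot> inverse_arr g"]) simp_all

lemma iso_epi:
  assumes "is_iso C e" "f \<cdot> e = g \<cdot> e" "f \<in> Arr C" "g \<in> Arr C" "Dom C f = Cod C e" "Dom C g = Cod C e"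
  shows "f = g"
proof -
  have "(f \<cdot> e) \<cdot> inverse_arr e = (g \<cdot> e) \<cdot> inverse_arr e" using assms(2) by simp
  then show ?thesis using assms(1,3-6) by simp
qed

end

text \<open>Take \<open>e\<close> to be the counit. The universal arrow is all that is retained of
  an adjunction when internal homs are chosen.\<close>

lemma adj_couniversal:
  assumes adj: "adjunction C D F U \<phi>" and Y: "Y \<in> Obj D"
  shows "\<exists>e \<in> hom D (on_obj F (on_obj U Y)) Y. \<forall>X \<in> Obj C. \<forall>h \<in> hom D (on_obj F X) Y.
    \<exists>!k. k \<in> hom C X (on_obj U Y) \<and> e \<cdot>\<^bsub>D\<^esub> on_arr F k = h"
proof -
  interpret C: category C by (rule functorD[OF adjunctionD(1)[OF adj]])
  interpret D: category D by (rule functorD[OF adjunctionD(1)[OF adj]])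
  note [simp] = functorD(3-)[OF adjunctionD(1)[OF adj]] functorD(3-)[OF adjunctionD(2)[OF adj]] Y
  obtain e where e: "e \<in> hom D (on_obj F (on_obj U Y)) Y" "\<phi> (on_obj U Y) Y e = Ident C (on_obj U Y)"
    using adj_surj[OF adj, of "on_obj U Y" Y "Ident C (on_obj U Y)"] by auto
  have tr: "\<phi> X Y (e \<cdot>\<^bsub>D\<^esub> on_arr F k) = k" if "k \<in> hom C X (on_obj U Y)" for X k
    using adj_nat_left[OF adj, of k Y e] that e by simp
  have "\<exists>!k. k \<in> hom C X (on_obj U Y) \<and> e \<cdot>\<^bsub>D\<^esub> on_arr F k = h"
    if X: "X \<in> Obj C" and h: "h \<in> hom D (on_obj F X) Y" for X h
  proof (rule ex1I[of _ "\<phi> X Y h"])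
    have k: "\<phi> X Y h \<in> hom C X (on_obj U Y)" by (rule adj_hom[OF adj X Y h])
    have "e \<cdot>\<^bsub>D\<^esub> on_arr F (\<phi> X Y h) = h"
      by (rule adj_inj[OF adj X Y]) (use k e h tr[OF k] in auto)
    with k show "\<phi> X Y h \<in> hom C X (on_obj U Y) \<and> e \<cdot>\<^bsub>D\<^esub> on_arr F (\<phi> X Y h) = h" ..
  qed (use tr in auto)
  then show ?thesis using e(1) by blast
qed

context monoidal_category
begin

abbreviation \<iota> where "\<iota> \<equiv> Ident C"
abbreviation \<alpha> where "\<alpha> \<equiv> Assoc C"
abbreviation lu where "lu \<equiv> LUnit C"
abbreviation ru where "ru \<equiv> RUnit C"

lemma tensor_obj_simps [simp]:
  "X \<in> Obj C \<Longrightarrow> Y \<in> Obj C \<Longrightarrow> X \<odot> Y \<in> Obj C"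
  "X \<in> Obj C \<Longrightarrow> Y \<in> Obj C \<Longrightarrow> \<iota> X \<otimes> \<iota> Y = \<iota> (X \<odot> Y)"
  using functorD(3,7)[OF tensor_functor, of "(X, Y)"]
  by (auto simp: tensor_fctr_def prod_cat_def)

lemma tensor_simps [simp]:
  "f \<in> Arr C \<Longrightarrow> g \<in> Arr C \<Longrightarrow> f \<otimes> g \<in> Arr C"
  "f \<in> Arr C \<Longrightarrow> g \<in> Arr C \<Longrightarrow> Dom C (f \<otimes> g) = Dom C f \<odot> Dom C g"
  "f \<in> Arr C \<Longrightarrow> g \<in> Arr C \<Longrightarrow> Cod C (f \<otimes> g) = Cod C f \<odot> Cod C g"
  using functorD(4-6)[OF tensor_functor, of "(f, g)"]
  by (auto simp: tensor_fctr_def prod_cat_def)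

text \<open>Oriented so that composites of products fuse into one product; together with
  \<open>interchange_assoc\<close> this makes bifunctoriality automatic. Only associators and unit
  maps then need manual steps.\<close>

lemma interchange [simp]:
  assumes "f \<in> Arr C" "g \<in> Arr C" "f' \<in> Arr C" "g' \<in> Arr C" "Dom C f' = Cod C f" "Dom C g' = Cod C g"
  shows "(f' \<otimes> g') \<cdot> (f \<otimes> g) = (f' \<cdot> f) \<otimes> (g' \<cdot> g)"
  using functorD(8)[OF tensor_functor, of "(f, g)" "(f', g')"] assms
  by (auto simp: tensor_fctr_def prod_cat_def)

lemma interchange_assoc [simp]:
  assumes "f \<in> Arr C" "g \<in> Arr C" "f' \<in> Arr C" "g' \<in> Arr C" "Dom C f' = Cod C f" "Dom C g' = Cod C g"
    "h \<in> Arr C" "Cod C h = Dom C f \<odot> Dom C g"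
  shows "(f' \<otimes> g') \<cdot> (f \<otimes> g) \<cdot> h = ((f' \<cdot> f) \<otimes> (g' \<cdot> g)) \<cdot> h"
  using comp_eq_extend1[OF interchange[OF assms(1-6)]] assms by simp

lemma Unit_obj [simp]: "Unit C \<in> Obj C"
  by (rule unit_obj)

lemma structure_simps [simp]:
  assumes "X \<in> Obj C"
  shows "lu X \<in> Arr C" "Dom C (lu X) = Unit C \<odot> X" "Cod C (lu X) = X" "is_iso C (lu X)"
    "ru X \<in> Arr C" "Dom C (ru X) = X \<odot> Unit C" "Cod C (ru X) = X" "is_iso C (ru X)"
    "Y \<in> Obj C \<Longrightarrow> Z \<in> Obj C \<Longrightarrow> \<alpha> X Y Z \<in> Arr C"
    "Y \<in> Obj C \<Longrightarrow> Z \<in> Obj C \<Longrightarrow> Dom C (\<alpha> X Y Z) = (X \<odot> Y) \<odot> Z"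
    "Y \<in> Obj C \<Longrightarrow> Z \<in> Obj C \<Longrightarrow> Cod C (\<alpha> X Y Z) = X \<odot> (Y \<odot> Z)"
    "Y \<in> Obj C \<Longrightarrow> Z \<in> Obj C \<Longrightarrow> is_iso C (\<alpha> X Y Z)"
  using lunit_hom[OF assms] runit_hom[OF assms] assoc_hom[OF assms] by auto

lemma iso_tensor [simp]: "is_iso C f \<Longrightarrow> is_iso C g \<Longrightarrow> is_iso C (f \<otimes> g)"
  by (rule is_isoI[where g = "inverse_arr f \<otimes> inverse_arr g"]) simp_all

lemma iso_ident [simp]: "X \<in> Obj C \<Longrightarrow> is_iso C (\<iota> X)"
  by (rule is_isoI[where g = "\<iota> X"]) simp_all

lemma assoc_nat:
  assumes "f \<in> Arr C" "g \<in> Arr C" "h \<in> Arr C"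
  shows "\<alpha> (Cod C f) (Cod C g) (Cod C h) \<cdot> ((f \<otimes> g) \<otimes> h) =
    (f \<otimes> (g \<otimes> h)) \<cdot> \<alpha> (Dom C f) (Dom C g) (Dom C h)"
  using assoc_natural[of f "Dom C f" "Cod C f" g "Dom C g" "Cod C g" h "Dom C h" "Cod C h"] assms by simp

lemma lunit_nat: "f \<in> Arr C \<Longrightarrow> lu (Cod C f) \<cdot> (\<iota> (Unit C) \<otimes> f) = f \<cdot> lu (Dom C f)"
  using lunit_natural[of f "Dom C f" "Cod C f"] by simp

lemma runit_nat: "f \<in> Arr C \<Longrightarrow> ru (Cod C f) \<cdot> (f \<otimes> \<iota> (Unit C)) = f \<cdot> ru (Dom C f)"
  using runit_natural[of f "Dom C f" "Cod C f"] by simp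

text \<open>Kelly: this coherence law follows from the pentagon and the triangle, after tensoring with the unit.\<close>

lemma lunit_tensor:
  assumes X [simp]: "X \<in> Obj C" and Y [simp]: "Y \<in> Obj C"
  shows "lu (X \<odot> Y) \<cdot> \<alpha> (Unit C) X Y = lu X \<otimes> \<iota> Y"
proof -
  let ?S = "Unit C"
  have tri1: "(\<iota> ?S \<otimes> lu (X \<odot> Y)) \<cdot> \<alpha> ?S ?S (X \<odot> Y) = ru ?S \<otimes> \<iota> (X \<odot> Y)"
    and tri2: "(\<iota> ?S \<otimes> lu X) \<cdot> \<alpha> ?S ?S X = ru ?S \<otimes> \<iota> X"
    by (rule triangle; simp)+
  have "((\<iota> ?S \<otimes> (lu (X \<odot> Y) \<cdot> \<alpha> ?S X Y)) \<cdot> \<alpha> ?S (?S \<odot> X) Y) \<cdot> (\<alpha> ?S ?S X \<otimes> \<iota> Y)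
    = (\<iota> ?S \<otimes> lu (X \<odot> Y)) \<cdot> ((\<iota> ?S \<otimes> \<alpha> ?S X Y) \<cdot> (\<alpha> ?S (?S \<odot> X) Y \<cdot> (\<alpha> ?S ?S X \<otimes> \<iota> Y)))"
    by simp
  also have "\<dots> = (\<iota> ?S \<otimes> lu (X \<odot> Y)) \<cdot> (\<alpha> ?S ?S (X \<odot> Y) \<cdot> \<alpha> (?S \<odot> ?S) X Y)"
    by (subst pentagon) simp_all
  also have "\<dots> = ((\<iota> ?S \<otimes> lu (X \<odot> Y)) \<cdot> \<alpha> ?S ?S (X \<odot> Y)) \<cdot> \<alpha> (?S \<odot> ?S) X Y"
    by simp
  also have "\<dots> = (ru ?S \<otimes> (\<iota> X \<otimes> \<iota> Y)) \<cdot> \<alpha> (?S \<odot> ?S) X Y"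
    unfolding tri1 by simp
  also have "\<dots> = \<alpha> ?S X Y \<cdot> ((ru ?S \<otimes> \<iota> X) \<otimes> \<iota> Y)"
    using assoc_nat[of "ru ?S" "\<iota> X" "\<iota> Y"] by simp
  also have "\<dots> = \<alpha> ?S X Y \<cdot> (((\<iota> ?S \<otimes> lu X) \<otimes> \<iota> Y) \<cdot> (\<alpha> ?S ?S X \<otimes> \<iota> Y))"
    unfolding tri2[symmetric] by simp
  also have "\<dots> = (\<alpha> ?S X Y \<cdot> ((\<iota> ?S \<otimes> lu X) \<otimes> \<iota> Y)) \<cdot> (\<alpha> ?S ?S X \<otimes> \<iota> Y)"
    by simp
  also have "\<dots> = ((\<iota> ?S \<otimes> (lu X \<otimes> \<iota> Y)) \<cdot> \<alpha> ?S (?S \<odot> X) Y) \<cdot> (\<alpha> ?S ?S X \<otimes> \<iota> Y)"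
    using assoc_nat[of "\<iota> ?S" "lu X" "\<iota> Y"] by simp
  \<comment> \<open>Both sides have been brought to end in the same invertible associators, which
    are now cancelled one after the other.\<close>
  finally have "(\<iota> ?S \<otimes> (lu (X \<odot> Y) \<cdot> \<alpha> ?S X Y)) \<cdot> \<alpha> ?S (?S \<odot> X) Y =
      (\<iota> ?S \<otimes> (lu X \<otimes> \<iota> Y)) \<cdot> \<alpha> ?S (?S \<odot> X) Y"
    by (rule iso_epi[rotated]) simp_all
  then have "\<iota> ?S \<otimes> (lu (X \<odot> Y) \<cdot> \<alpha> ?S X Y) = \<iota> ?S \<otimes> (lu X \<otimes> \<iota> Y)"
    by (rule iso_epi[rotated]) simp_all
  \<comment> \<open>Tensoring with the unit is faithful: naturality of \<open>lu\<close> moves the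
    arrows out of the product, and \<open>lu\<close> is invertible.\<close>
  then have "lu (X \<odot> Y) \<cdot> (\<iota> ?S \<otimes> (lu (X \<odot> Y) \<cdot> \<alpha> ?S X Y)) = lu (X \<odot> Y) \<cdot> (\<iota> ?S \<otimes> (lu X \<otimes> \<iota> Y))"
    by simp
  then have "(lu (X \<odot> Y) \<cdot> \<alpha> ?S X Y) \<cdot> lu ((?S \<odot> X) \<odot> Y) = (lu X \<otimes> \<iota> Y) \<cdot> lu ((?S \<odot> X) \<odot> Y)"
    using lunit_nat[of "lu (X \<odot> Y) \<cdot> \<alpha> ?S X Y"] lunit_nat[of "lu X \<otimes> \<iota> Y"] by simp
  then show ?thesis
    by (rule iso_epi[rotated]) simp_all
qed

end

locale closed_monoidal_category =
  fixes C :: "('o, 'm, 'z) monoidal_model_cat_scheme" (structure)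
  assumes closed: "closed_monoidal C"
begin

sublocale monoidal_category C
  using closed by (simp add: closed_monoidal_def)

section \<open>Internal homs and the functors that they right-adjoin to\<close>

text \<open>Closedness is an existence statement, so a universal pair of object and evaluation is
  chosen for each \<open>A\<close> and \<open>Z\<close>; functoriality in either variable is
  recovered from its universal property.\<close>

definition "internal_hom A Z = (SOME (E, e). E \<in> Obj C \<and> e \<in> hom C (A \<odot> E) Z \<and>
  (\<forall>X \<in> Obj C. \<forall>h \<in> hom C (A \<odot> X) Z. \<exists>!k. k \<in> hom C X E \<and> e \<cdot> (\<iota> A \<otimes> k) = h))"

definition "ihom A Z = fst (internal_hom A Z)"

definition "ev A Z = snd (internal_hom A Z)"

definition "cur A X Z h = (THE k. k \<in> hom C X (ihom A Z) \<and> ev A Z \<cdot> (\<iota> A \<otimes> k) = h)"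

lemma internal_hom:
  assumes A: "A \<in> Obj C" and Z: "Z \<in> Obj C"
  shows "ihom A Z \<in> Obj C \<and> ev A Z \<in> hom C (A \<odot> ihom A Z) Z \<and>
    (\<forall>X \<in> Obj C. \<forall>h \<in> hom C (A \<odot> X) Z. \<exists>!k. k \<in> hom C X (ihom A Z) \<and> ev A Z \<cdot> (\<iota> A \<otimes> k) = h)"
proof -
  obtain H \<phi> where adj: "adjunction C C (fix_fst C (tensor_fctr C) A) (fix_fst C H A) (\<phi> A)"
    using closed A unfolding closed_monoidal_def by blast
  have "on_obj (fix_fst C H A) Z \<in> Obj C" using functorD(3)[OF adjunctionD(2)[OF adj] Z] .
  then have "\<exists>p. case p of (E, e) \<Rightarrow> E \<in> Obj C \<and> e \<in> hom C (A \<odot> E) Z \<and>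
    (\<forall>X \<in> Obj C. \<forall>h \<in> hom C (A \<odot> X) Z. \<exists>!k. k \<in> hom C X E \<and> e \<cdot> (\<iota> A \<otimes> k) = h)"
    using adj_couniversal[OF adj Z] by (auto simp: fix_fst_def tensor_fctr_def simp del: in_hom)
  from someI_ex[OF this, folded internal_hom_def]
  show ?thesis by (simp add: ihom_def ev_def case_prod_beta)
qed

lemma ev_simps [simp]:
  assumes "A \<in> Obj C" "Z \<in> Obj C"
  shows "ihom A Z \<in> Obj C" "ev A Z \<in> Arr C" "Dom C (ev A Z) = A \<odot> ihom A Z" "Cod C (ev A Z) = Z"
  using internal_hom[OF assms] by auto

lemma cur:
  assumes "A \<in> Obj C" "X \<in> Obj C" "Z \<in> Obj C" "h \<in> Arr C" "Dom C h = A \<odot> X" "Cod C h = Z"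
  shows "cur A X Z h \<in> Arr C" "Dom C (cur A X Z h) = X" "Cod C (cur A X Z h) = ihom A Z"
    "ev A Z \<cdot> (\<iota> A \<otimes> cur A X Z h) = h"
proof -
  have "\<exists>!k. k \<in> hom C X (ihom A Z) \<and> ev A Z \<cdot> (\<iota> A \<otimes> k) = h"
    using internal_hom[OF assms(1,3)] assms(2,4-6) by simp
  from theI'[OF this, folded cur_def]
  show "cur A X Z h \<in> Arr C" "Dom C (cur A X Z h) = X" "Cod C (cur A X Z h) = ihom A Z"
    "ev A Z \<cdot> (\<iota> A \<otimes> cur A X Z h) = h" by simp_all
qed

lemmas cur_simps [simp] = cur(1-3)

text \<open>The uniqueness half of currying, and the way equations between maps into [A, Z] are
  proved below.\<close>

lemma ev_inject:
  assumes A: "A \<in> Obj C" and Z: "Z \<in> Obj C" and k: "k \<in> Arr C" "k' \<in> Arr C" "Dom C k = Dom C k'" "Cod C k = ihom A Z"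
    "Cod C k' = ihom A Z" "ev A Z \<cdot> (\<iota> A \<otimes> k) = ev A Z \<cdot> (\<iota> A \<otimes> k')"
  shows "k = k'"
proof -
  have "\<forall>X \<in> Obj C. \<forall>h \<in> hom C (A \<odot> X) Z. \<exists>!k. k \<in> hom C X (ihom A Z) \<and> ev A Z \<cdot> (\<iota> A \<otimes> k) = h"
    using internal_hom[OF A Z] by blast
  moreover have "Dom C k \<in> Obj C" "ev A Z \<cdot> (\<iota> A \<otimes> k) \<in> hom C (A \<odot> Dom C k) Z"
    using A Z k by simp_all
  ultimately have "\<exists>!l. l \<in> hom C (Dom C k) (ihom A Z) \<and> ev A Z \<cdot> (\<iota> A \<otimes> l) = ev A Z \<cdot> (\<iota> A \<otimes> k)"
    by blast
  moreover have "k \<in> hom C (Dom C k) (ihom A Z)" "k' \<in> hom C (Dom C k) (ihom A Z)" using k by simp_all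
  ultimately show ?thesis using k(6) by metis
qed

lemma ev_cur_comp:
  assumes "A \<in> Obj C" "X \<in> Obj C" "Z \<in> Obj C" "h \<in> Arr C" "Dom C h = A \<odot> X" "Cod C h = Z"
    "k \<in> Arr C" "Cod C k = X"
  shows "ev A Z \<cdot> (\<iota> A \<otimes> (cur A X Z h \<cdot> k)) = h \<cdot> (\<iota> A \<otimes> k)"
proof -
  have "ev A Z \<cdot> (\<iota> A \<otimes> (cur A X Z h \<cdot> k)) = (ev A Z \<cdot> (\<iota> A \<otimes> cur A X Z h)) \<cdot> (\<iota> A \<otimes> k)"
    using assms by simp
  also have "\<dots> = h \<cdot> (\<iota> A \<otimes> k)" using cur(4) assms by simp
  finally show ?thesis .
qed

text \<open>The functor \<open>A \<odot> -\<close> is a left adjoint. Concretely: curry the test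
  arrow, factor it through \<open>p\<close>, and uncurry.\<close>

lemma tensor_coequalizer:
  assumes A: "A \<in> Obj C" and p: "is_coequalizer C s t p"
  shows "is_coequalizer C (\<iota> A \<otimes> s) (\<iota> A \<otimes> t) (\<iota> A \<otimes> p)"
proof -
  note [simp] = A
  have st [simp]: "s \<in> Arr C" "t \<in> Arr C" "Dom C s = Dom C t" "Cod C s = Cod C t" "p \<in> Arr C" "Dom C p = Cod C t"
    and e: "p \<cdot> s = p \<cdot> t"
    using p unfolding is_coequalizer_def by auto
  show ?thesis
  proof (rule is_coequalizerI[where L = "A \<odot> Cod C p"])
    fix Z v assume v: "v \<in> hom C (Cod C (\<iota> A \<otimes> s)) Z" and ve: "v \<cdot> (\<iota> A \<otimes> s) = v \<cdot> (\<iota> A \<otimes> t)"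
    have v' [simp]: "v \<in> Arr C" "Dom C v = A \<odot> Cod C t" "Cod C v = Z" and Z [simp]: "Z \<in> Obj C"
      using v by auto
    let ?c = "cur A (Cod C t) Z v"
    have "?c \<cdot> s = ?c \<cdot> t"
      by (rule ev_inject[of A Z]) (simp_all add: ev_cur_comp ve)
    then obtain k where k: "k \<in> hom C (Cod C p) (ihom A Z)" "k \<cdot> p = ?c"
      and ku: "\<And>k'. k' \<in> hom C (Cod C p) (ihom A Z) \<Longrightarrow> k' \<cdot> p = ?c \<Longrightarrow> k' = k"
      using coequalizer_induced[OF p, of ?c "ihom A Z"] by auto
    have [simp]: "k \<in> Arr C" "Dom C k = Cod C p" "Cod C k = ihom A Z" using k by auto
    show "\<exists>!h. h \<in> hom C (A \<odot> Cod C p) Z \<and> h \<cdot> (\<iota> A \<otimes> p) = v"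
    proof (rule ex1I[of _ "ev A Z \<cdot> (\<iota> A \<otimes> k)"])
      show "ev A Z \<cdot> (\<iota> A \<otimes> k) \<in> hom C (A \<odot> Cod C p) Z \<and> (ev A Z \<cdot> (\<iota> A \<otimes> k)) \<cdot> (\<iota> A \<otimes> p) = v"
        by (simp add: k cur)
    next
      fix h assume h: "h \<in> hom C (A \<odot> Cod C p) Z \<and> h \<cdot> (\<iota> A \<otimes> p) = v"
      have "cur A (Cod C p) Z h \<cdot> p = ?c"
        by (rule ev_inject[of A Z]) (use h in \<open>simp_all add: ev_cur_comp cur\<close>)
      then have "cur A (Cod C p) Z h = k" using h by (intro ku) simp_all
      then show "h = ev A Z \<cdot> (\<iota> A \<otimes> k)" using h cur(4)[of A "Cod C p" Z h] by simp
    qed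
  qed (simp_all add: e)
qed

text \<open>Uses the other half of closedness: here \<open>- \<odot> X\<close> is the left
  adjoint.\<close>

lemma tensor_initial:
  assumes Z: "is_initial C Z" and X: "X \<in> Obj C"
  shows "is_initial C (Z \<odot> X)"
proof -
  obtain H \<phi> where adj: "adjunction C C (fix_snd C (tensor_fctr C) X) (fix_fst C H X) (\<phi> X)"
    using closed X unfolding closed_monoidal_def by blast
  have Zo [simp]: "Z \<in> Obj C" using Z by (simp add: is_initial_def)
  have "\<exists>!f. f \<in> hom C (Z \<odot> X) Y" if Y: "Y \<in> Obj C" for Y
  proof -
    let ?U = "on_obj (fix_fst C H X) Y"
    have U: "?U \<in> Obj C" by (rule functorD(3)[OF adjunctionD(2)[OF adj] Y])
    have T: "on_obj (fix_snd C (tensor_fctr C) X) Z = Z \<odot> X"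
      by (simp add: fix_snd_def tensor_fctr_def)
    obtain k where k: "k \<in> hom C Z ?U" using initial_map[OF Z U] by blast
    obtain g where g: "g \<in> hom C (Z \<odot> X) Y" using adj_surj[OF adj Zo Y k] unfolding T by blast
    have "g' = g" if "g' \<in> hom C (Z \<odot> X) Y" for g'
      using adj_inj[OF adj Zo Y] adj_hom[OF adj Zo Y] initial_unique[OF Z U] g that unfolding T by metis
    then show ?thesis using g by blast
  qed
  then show ?thesis using X by (simp add: is_initial_def)
qed

definition "ihom_post A p = cur A (ihom A (Dom C p)) (Cod C p) (p \<cdot> ev A (Dom C p))"

text \<open>The contravariant action [f, Z] of the internal hom, that is, precomposition with
  \<open>f\<close>.\<close>

definition "ihom_pre f Z = cur (Dom C f) (ihom (Cod C f) Z) Z (ev (Cod C f) Z \<cdot> (f \<otimes> \<iota> (ihom (Cod C f) Z)))"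

lemma ihom_post_simps [simp]:
  assumes "A \<in> Obj C" "p \<in> Arr C"
  shows "ihom_post A p \<in> Arr C" "Dom C (ihom_post A p) = ihom A (Dom C p)" "Cod C (ihom_post A p) = ihom A (Cod C p)"
  using assms by (simp_all add: ihom_post_def)

lemma ihom_pre_simps [simp]:
  assumes "f \<in> Arr C" "Z \<in> Obj C"
  shows "ihom_pre f Z \<in> Arr C" "Dom C (ihom_pre f Z) = ihom (Cod C f) Z" "Cod C (ihom_pre f Z) = ihom (Dom C f) Z"
  using assms by (simp_all add: ihom_pre_def)

lemma ev_ihom_post:
  assumes "A \<in> Obj C" "p \<in> Arr C" "k \<in> Arr C" "Cod C k = ihom A (Dom C p)" "Z = Cod C p"
  shows "ev A Z \<cdot> (\<iota> A \<otimes> (ihom_post A p \<cdot> k)) = p \<cdot> ev A (Dom C p) \<cdot> (\<iota> A \<otimes> k)"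
  using assms by (simp add: ihom_post_def ev_cur_comp)

lemma ev_ihom_pre:
  assumes "f \<in> Arr C" "Z \<in> Obj C" "k \<in> Arr C" "Cod C k = ihom (Cod C f) Z" "A = Dom C f"
  shows "ev A Z \<cdot> (\<iota> A \<otimes> (ihom_pre f Z \<cdot> k)) = ev (Cod C f) Z \<cdot> (f \<otimes> k)"
  using assms by (simp add: ihom_pre_def ev_cur_comp)

lemma ev_ihom_pre0:
  assumes "f \<in> Arr C" "Z \<in> Obj C" "A = Dom C f"
  shows "ev A Z \<cdot> (\<iota> A \<otimes> ihom_pre f Z) = ev (Cod C f) Z \<cdot> (f \<otimes> \<iota> (ihom (Cod C f) Z))"
  using ev_ihom_pre[of f Z "\<iota> (ihom (Cod C f) Z)" A] assms by simp

lemma ihom_pre_comp: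
  assumes [simp]: "f \<in> Arr C" "g \<in> Arr C" "Dom C g = Cod C f" "Z \<in> Obj C"
  shows "ihom_pre (g \<cdot> f) Z = ihom_pre f Z \<cdot> ihom_pre g Z"
proof (rule ev_inject[of "Dom C f" Z])
  have "ev (Dom C f) Z \<cdot> (\<iota> (Dom C f) \<otimes> (ihom_pre f Z \<cdot> ihom_pre g Z)) =
    (ev (Cod C f) Z \<cdot> (\<iota> (Cod C f) \<otimes> ihom_pre g Z)) \<cdot> (f \<otimes> \<iota> (ihom (Cod C g) Z))"
    by (simp add: ev_ihom_pre)
  also have "\<dots> = ev (Cod C g) Z \<cdot> ((g \<cdot> f) \<otimes> \<iota> (ihom (Cod C g) Z))"
    by (simp add: ev_ihom_pre0)
  finally show "ev (Dom C f) Z \<cdot> (\<iota> (Dom C f) \<otimes> ihom_pre (g \<cdot> f) Z) =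
      ev (Dom C f) Z \<cdot> (\<iota> (Dom C f) \<otimes> (ihom_pre f Z \<cdot> ihom_pre g Z))"
    by (simp add: ev_ihom_pre0)
qed simp_all

lemma ihom_pre_ident:
  assumes [simp]: "A \<in> Obj C" "Z \<in> Obj C"
  shows "ihom_pre (\<iota> A) Z = \<iota> (ihom A Z)"
  by (rule ev_inject[of A Z]) (simp_all add: ev_ihom_pre0)

end

section \<open>Homotopical consequences of the pushout product axiom\<close>

locale monoidal_model_structure =
  fixes u :: "'u itself" and C :: "('o, 'm, 'z) monoidal_model_cat_scheme" (structure)
  assumes infinite_universe: "infinite (UNIV :: 'u set)" and monoidal_model: "monoidal_model_category u C"
begin

sublocale model_structure u C
  using infinite_universe monoidal_model by unfold_locales (simp_all add: monoidal_model_category_def)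

sublocale closed_monoidal_category C
  using monoidal_model by unfold_locales (simp_all add: monoidal_model_category_def)

lemma pushout_product:
  assumes "f \<in> Cof C" "g \<in> Cof C" "is_pushout_product C f g k"
  shows "k \<in> Cof C" "f \<in> Weq C \<or> g \<in> Weq C \<Longrightarrow> k \<in> Weq C"
  using monoidal_model assms unfolding monoidal_model_category_def by blast+

text \<open>This is the pushout product with \<open>0 \<rightarrow> A\<close>, because \<open>0 \<odot> X\<close> is again initial.\<close>

lemma tensor_cofibrant:
  assumes A: "cofibrant C A" and g: "g \<in> Cof C"
  shows "\<iota> A \<otimes> g \<in> Cof C" "g \<in> Weq C \<Longrightarrow> \<iota> A \<otimes> g \<in> Weq C"
proof -
  obtain Z f where f: "is_initial C Z" "f \<in> hom C Z A" "f \<in> Cof C" using A unfolding cofibrant_def by blast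
  note [simp] = cofibrant_obj[OF A] cof_arr[OF g]
  have f' [simp]: "f \<in> Arr C" "Dom C f = Z" "Cod C f = A" "Z \<in> Obj C" using f by (auto simp: is_initial_def)
  let ?i = "f \<otimes> \<iota> (Dom C g)"
  have iX: "is_initial C (Z \<odot> Dom C g)" and iY: "is_initial C (Z \<odot> Cod C g)"
    using tensor_initial[OF f(1)] by simp_all
  obtain m where m: "m \<in> hom C (Z \<odot> Cod C g) (A \<odot> Dom C g)"
    using initial_map[OF iY, of "A \<odot> Dom C g"] by auto
  have [simp]: "m \<in> Arr C" "Dom C m = Z \<odot> Cod C g" "Cod C m = A \<odot> Dom C g" using m by auto
  \<comment> \<open>The upper row of the square consists of initial objects, so the pushout is the
    remaining corner \<open>A \<odot> Dom C g\<close>.\<close>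
  have "is_pushout C (\<iota> Z \<otimes> g) ?i m (\<iota> (A \<odot> Dom C g))"
  proof (rule is_pushoutI)
    show "m \<cdot> (\<iota> Z \<otimes> g) = \<iota> (A \<odot> Dom C g) \<cdot> ?i"
      by (rule initial_unique[OF iX, of "A \<odot> Dom C g"]) simp_all
  next
    fix W v w assume v: "v \<in> hom C (Cod C (\<iota> Z \<otimes> g)) W" and w: "w \<in> hom C (Cod C ?i) W"
    have [simp]: "w \<in> Arr C" "Dom C w = A \<odot> Dom C g" "Cod C w = W" using w by auto
    have "w \<cdot> m = v"
      by (rule initial_unique[OF iY, of W]) (use v w in auto)
    then show "\<exists>!h. h \<in> hom C (A \<odot> Dom C g) W \<and> h \<cdot> m = v \<and> h \<cdot> \<iota> (A \<odot> Dom C g) = w"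
      by (intro ex1I[of _ w] conjI; (elim conjE)?) simp_all
  qed simp_all
  moreover have "(\<iota> A \<otimes> g) \<cdot> m = f \<otimes> \<iota> (Cod C g)"
    by (rule initial_unique[OF iY, of "A \<odot> Cod C g"]) simp_all
  ultimately have "is_pushout_product C f g (\<iota> A \<otimes> g)"
    unfolding is_pushout_product_def
    by (intro exI[of _ m] exI[of _ "\<iota> (A \<odot> Dom C g)"]) simp
  from pushout_product[OF f(3) g this]
  show "\<iota> A \<otimes> g \<in> Cof C" "g \<in> Weq C \<Longrightarrow> \<iota> A \<otimes> g \<in> Weq C" by blast+
qed

lemma ihom_post_lifts:
  assumes A [simp]: "A \<in> Obj C" and p [simp]: "p \<in> Arr C" and i [simp]: "i \<in> Arr C"
    and L: "lifts C (\<iota> A \<otimes> i) p"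
  shows "lifts C i (ihom_post A p)"
  unfolding lifts_def
proof (intro ballI impI)
  fix a v assume a: "a \<in> hom C (Dom C i) (Dom C (ihom_post A p))" and v: "v \<in> hom C (Cod C i) (Cod C (ihom_post A p))"
    and e: "ihom_post A p \<cdot> a = v \<cdot> i"
  have [simp]: "a \<in> Arr C" "Dom C a = Dom C i" "Cod C a = ihom A (Dom C p)"
    "v \<in> Arr C" "Dom C v = Cod C i" "Cod C v = ihom A (Cod C p)" using a v by auto
  have "p \<cdot> ev A (Dom C p) \<cdot> (\<iota> A \<otimes> a) = (ev A (Cod C p) \<cdot> (\<iota> A \<otimes> v)) \<cdot> (\<iota> A \<otimes> i)"
    using ev_ihom_post[of A p a "Cod C p"] e by simp
  moreover have "ev A (Dom C p) \<cdot> (\<iota> A \<otimes> a) \<in> hom C (Dom C (\<iota> A \<otimes> i)) (Dom C p)"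
    "ev A (Cod C p) \<cdot> (\<iota> A \<otimes> v) \<in> hom C (Cod C (\<iota> A \<otimes> i)) (Cod C p)" by simp_all
  ultimately have "\<exists>h \<in> hom C (Cod C (\<iota> A \<otimes> i)) (Dom C p). h \<cdot> (\<iota> A \<otimes> i) = ev A (Dom C p) \<cdot> (\<iota> A \<otimes> a) \<and>
    p \<cdot> h = ev A (Cod C p) \<cdot> (\<iota> A \<otimes> v)"
    using L unfolding lifts_def by simp
  then obtain h where h: "h \<in> hom C (Cod C (\<iota> A \<otimes> i)) (Dom C p)" "h \<cdot> (\<iota> A \<otimes> i) = ev A (Dom C p) \<cdot> (\<iota> A \<otimes> a)"
    "p \<cdot> h = ev A (Cod C p) \<cdot> (\<iota> A \<otimes> v)"
    by blast
  have [simp]: "h \<in> Arr C" "Dom C h = A \<odot> Cod C i" "Cod C h = Dom C p" using h by auto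
  let ?k = "cur A (Cod C i) (Dom C p) h"
  have "?k \<cdot> i = a"
    by (rule ev_inject[of A "Dom C p"]) (simp_all add: ev_cur_comp h)
  moreover have "ihom_post A p \<cdot> ?k = v"
    by (rule ev_inject[of A "Cod C p"]) (simp_all add: ev_ihom_post cur h)
  ultimately show "\<exists>h\<in>hom C (Cod C i) (Dom C (ihom_post A p)). h \<cdot> i = a \<and> ihom_post A p \<cdot> h = v"
    by (intro bexI[of _ ?k]) simp_all
qed

text \<open>[A, -] is right Quillen: its lifting problems transpose to problems for
  \<open>A \<odot> i\<close>, which is a (trivial) cofibration along with \<open>i\<close>.\<close>

lemma ihom_post_fib:
  assumes A: "cofibrant C A" and p: "p \<in> Fib C"
  shows "ihom_post A p \<in> Fib C" "p \<in> Weq C \<Longrightarrow> ihom_post A p \<in> Weq C"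
proof -
  note [simp] = cofibrant_obj[OF A] fib_arr[OF p]
  show "ihom_post A p \<in> Fib C"
    by (rule fib_if_lifts) (use tensor_cofibrant[OF A] model_lifts p cof_arr in \<open>auto intro!: ihom_post_lifts\<close>)
  show "ihom_post A p \<in> Weq C" if "p \<in> Weq C"
  proof -
    have "ihom_post A p \<in> Fib C \<and> ihom_post A p \<in> Weq C"
      by (rule tfib_if_lifts)
        (use tensor_cofibrant[OF A] model_lifts p that cof_arr in \<open>auto intro!: ihom_post_lifts\<close>)
    then show ?thesis ..
  qed
qed

text \<open>A lifting problem of \<open>g\<close> against [i, Z] is an extension problem into
  \<open>Z\<close> along the pushout product of \<open>i\<close> and \<open>g\<close>, a trivial
  cofibration. So [i, Z] is even a trivial fibration.\<close>

lemma ihom_pre_tcof: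
  assumes i: "i \<in> Cof C" "i \<in> Weq C" and Z: "fibrant C Z"
  shows "ihom_pre i Z \<in> Weq C"
proof -
  note [simp] = cof_arr[OF i(1)] fibrant_obj[OF Z]
  let ?A = "Dom C i" and ?B = "Cod C i"
  have "ihom_pre i Z \<in> Fib C \<and> ihom_pre i Z \<in> Weq C"
  proof (rule tfib_if_lifts)
    fix g assume g: "g \<in> Cof C"
    note [simp] = cof_arr[OF g]
    show "lifts C g (ihom_pre i Z)"
      unfolding lifts_def
    proof (intro ballI impI)
      fix a v assume a: "a \<in> hom C (Dom C g) (Dom C (ihom_pre i Z))" and v: "v \<in> hom C (Cod C g) (Cod C (ihom_pre i Z))"
        and e: "ihom_pre i Z \<cdot> a = v \<cdot> g"
      have [simp]: "a \<in> Arr C" "Dom C a = Dom C g" "Cod C a = ihom ?B Z"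
        "v \<in> Arr C" "Dom C v = Cod C g" "Cod C v = ihom ?A Z" using a v by auto
      let ?a = "ev ?B Z \<cdot> (\<iota> ?B \<otimes> a)" and ?v = "ev ?A Z \<cdot> (\<iota> ?A \<otimes> v)"
      obtain m n where po: "is_pushout C (\<iota> ?A \<otimes> g) (i \<otimes> \<iota> (Dom C g)) m n"
        by (rule pushout_exists[of "\<iota> ?A \<otimes> g" "i \<otimes> \<iota> (Dom C g)"]) simp_all
      have mn [simp]: "m \<in> Arr C" "n \<in> Arr C" "Dom C m = ?A \<odot> Cod C g" "Dom C n = ?B \<odot> Dom C g" "Cod C n = Cod C m"
        using po unfolding is_pushout_def by auto
      have "?v \<cdot> (\<iota> ?A \<otimes> g) = ?a \<cdot> (i \<otimes> \<iota> (Dom C g))"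
        using ev_ihom_pre[of i Z a ?A] e by simp
      \<comment> \<open>The square, uncurried, is a map \<open>h\<close> from the pushout to
        \<open>Z\<close>.\<close>
      then obtain h where h: "h \<in> hom C (Cod C m) Z" "h \<cdot> m = ?v" "h \<cdot> n = ?a"
        using pushout_induced[OF po, of ?v Z ?a] by auto
      obtain k where k: "k \<in> hom C (Cod C m) (?B \<odot> Cod C g)" "k \<cdot> m = i \<otimes> \<iota> (Cod C g)" "k \<cdot> n = \<iota> ?B \<otimes> g"
        using pushout_induced[OF po, of "i \<otimes> \<iota> (Cod C g)" "?B \<odot> Cod C g" "\<iota> ?B \<otimes> g"] by auto
      have "is_pushout_product C i g k" unfolding is_pushout_product_def using po k by blast
      then have kt: "k \<in> Cof C" "k \<in> Weq C" using pushout_product[OF i(1) g] i(2) by auto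
      obtain w where w: "w \<in> hom C (?B \<odot> Cod C g) Z" "w \<cdot> k = h"
        using fibrant_extend[OF Z kt, of h] h k by auto
      have [simp]: "k \<in> Arr C" "Dom C k = Cod C m" "Cod C k = ?B \<odot> Cod C g"
        "w \<in> Arr C" "Dom C w = ?B \<odot> Cod C g" "Cod C w = Z" using k w by auto
      have wn: "w \<cdot> (\<iota> ?B \<otimes> g) = ?a" and wm: "w \<cdot> (i \<otimes> \<iota> (Cod C g)) = ?v"
        using comp_eq_extend1[OF w(2), of n] comp_eq_extend1[OF w(2), of m] h k by simp_all
      let ?t = "cur ?B (Cod C g) Z w"
      have "?t \<cdot> g = a"
        by (rule ev_inject[of ?B Z]) (simp_all add: ev_cur_comp wn)
      moreover have "ihom_pre i Z \<cdot> ?t = v"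
      proof (rule ev_inject[of ?A Z])
        have "ev ?B Z \<cdot> (i \<otimes> ?t) = (ev ?B Z \<cdot> (\<iota> ?B \<otimes> ?t)) \<cdot> (i \<otimes> \<iota> (Cod C g))" by simp
        also have "\<dots> = ?v" by (simp add: cur wm)
        finally show "ev ?A Z \<cdot> (\<iota> ?A \<otimes> (ihom_pre i Z \<cdot> ?t)) = ?v" by (simp add: ev_ihom_pre)
      qed simp_all
      ultimately show "\<exists>h\<in>hom C (Cod C g) (Dom C (ihom_pre i Z)). h \<cdot> g = a \<and> ihom_pre i Z \<cdot> h = v"
        by (intro bexI[of _ ?t]) simp_all
    qed
  qed simp
  then show ?thesis ..
qed

text \<open>Factor the copair of \<open>f\<close> and the identity of \<open>Cod C f\<close> as
  \<open>c\<close> followed by a weak equivalence \<open>q\<close>. Then \<open>f\<close> and the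
  identity are both \<open>q\<close> after a trivial cofibration, and the case of trivial
  cofibrations together with two-of-three treats first \<open>q\<close>, then
  \<open>f\<close>.\<close>

lemma ihom_pre_weq:
  assumes f: "f \<in> Weq C" and A: "cofibrant C (Dom C f)" and B: "cofibrant C (Cod C f)" and Z: "fibrant C Z"
  shows "ihom_pre f Z \<in> Weq C"
proof -
  note [simp] = weq_arr[OF f] fibrant_obj[OF Z]
  let ?A = "Dom C f" and ?B = "Cod C f"
  obtain i j where ij: "coproduct_of C i j" and dij [simp]: "Dom C i = ?A" "Dom C j = ?B"
    by (rule coproduct_exists[of ?A ?B]) simp_all
  have [simp]: "i \<in> Arr C" "j \<in> Arr C" "Cod C j = Cod C i" using ij by (auto simp: coproduct_of_def)
  obtain d where d: "d \<in> hom C (Cod C i) ?B" "d \<cdot> i = f" "d \<cdot> j = \<iota> ?B"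
    using coproduct_copair[OF ij, of f ?B "\<iota> ?B"] by auto
  obtain c q where cq: "c \<in> Cof C" "q \<in> Fib C" "q \<in> Weq C" "Dom C c = Cod C i" "Dom C q = Cod C c" "Cod C q = ?B"
    "q \<cdot> c = d"
    using factor_cof_tfib[of d] d by (metis in_hom)
  note [simp] = cof_arr[OF cq(1)] fib_arr[OF cq(2)] cq(4-6)
  have q: "q \<cdot> (c \<cdot> i) = f" "q \<cdot> (c \<cdot> j) = \<iota> ?B"
    using comp_eq_extend1[OF cq(7), of i] comp_eq_extend1[OF cq(7), of j] d by simp_all
  have cof: "c \<cdot> i \<in> Cof C" "c \<cdot> j \<in> Cof C"
    using coproduct_inclusion_cof[OF ij] coproduct_inclusion_cof[OF coproduct_sym[OF ij]] A B cof_comp cq(1)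
    by auto
  have weq: "c \<cdot> i \<in> Weq C" "c \<cdot> j \<in> Weq C"
    using weq_cancel_left[OF cq(3), of "c \<cdot> i"] weq_cancel_left[OF cq(3), of "c \<cdot> j"] q f weq_ident by auto
  have "ihom_pre (c \<cdot> j) Z \<cdot> ihom_pre q Z = \<iota> (ihom ?B Z)"
    using ihom_pre_comp[of "c \<cdot> j" q Z] q(2) by (simp add: ihom_pre_ident)
  then have "ihom_pre q Z \<in> Weq C"
    using weq_cancel_left[OF ihom_pre_tcof[OF cof(2) weq(2) Z], of "ihom_pre q Z"] weq_ident by simp
  then have "ihom_pre (c \<cdot> i) Z \<cdot> ihom_pre q Z \<in> Weq C"
    using weq_comp[OF _ ihom_pre_tcof[OF cof(1) weq(1) Z]] by simp
  then show ?thesis using ihom_pre_comp[of "c \<cdot> i" q Z] q(1) by simp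
qed

end

section \<open>Modules\<close>

text \<open>Stated with projections so that the rules apply to a variable arrow without splitting it
  into a triple. There is no rule for \<open>Cof\<close>: cofibrations of modules are handled
  through lifting in the abstract model structure.\<close>

lemma left_modules_simps [simp]:
  "M \<in> Obj (left_modules C A) \<longleftrightarrow> left_module C A M"
  "x \<in> Arr (left_modules C A) \<longleftrightarrow> left_module C A (fst x) \<and> left_module C A (snd (snd x)) \<and>
    fst (snd x) \<in> hom C (fst (fst x)) (fst (snd (snd x))) \<and>
    fst (snd x) \<cdot>\<^bsub>C\<^esub> snd (fst x) = snd (snd (snd x)) \<cdot>\<^bsub>C\<^esub> (Ident C (MObj A) \<otimes>\<^bsub>C\<^esub> fst (snd x))"
  "Dom (left_modules C A) x = fst x"
  "Cod (left_modules C A) x = snd (snd x)"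
  "Ident (left_modules C A) M = (M, Ident C (fst M), M)"
  "y \<cdot>\<^bsub>left_modules C A\<^esub> x = (fst x, fst (snd y) \<cdot>\<^bsub>C\<^esub> fst (snd x), snd (snd y))"
  "x \<in> Weq (left_modules C A) \<longleftrightarrow> x \<in> Arr (left_modules C A) \<and> fst (snd x) \<in> Weq C"
  "x \<in> Fib (left_modules C A) \<longleftrightarrow> x \<in> Arr (left_modules C A) \<and> fst (snd x) \<in> Fib C"
  by (auto simp: left_modules_def module_model_def left_mod_cat_def case_prod_beta)

lemma left_module_iff:
  "left_module C A M \<longleftrightarrow> fst M \<in> Obj C \<and> snd M \<in> hom C (MObj A \<odot>\<^bsub>C\<^esub> fst M) (fst M) \<and>
    snd M \<cdot>\<^bsub>C\<^esub> (MMul A \<otimes>\<^bsub>C\<^esub> Ident C (fst M)) =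
      snd M \<cdot>\<^bsub>C\<^esub> (Ident C (MObj A) \<otimes>\<^bsub>C\<^esub> snd M) \<cdot>\<^bsub>C\<^esub> Assoc C (MObj A) (MObj A) (fst M) \<and>
    snd M \<cdot>\<^bsub>C\<^esub> (MOne A \<otimes>\<^bsub>C\<^esub> Ident C (fst M)) = LUnit C (fst M)"
  by (simp add: left_module_def case_prod_beta)

definition left_forget :: "(('o, 'm) mdl, ('o, 'm) mdl_map, 'o, 'm) fctr" where
  "left_forget = \<lparr>on_obj = fst, on_arr = \<lambda>x. fst (snd x)\<rparr>"

lemma left_forget_simps [simp]: "on_obj left_forget M = fst M" "on_arr left_forget x = fst (snd x)"
  by (simp_all add: left_forget_def)

context closed_monoidal_category
begin

text \<open>In elements (a . phi)(b) = phi(b a): right multiplication on the argument gives a left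
  action on [A, Z].\<close>

definition "coact A Z = cur (MObj A) (MObj A \<odot> ihom (MObj A) Z) Z
  (ev (MObj A) Z \<cdot> (MMul A \<otimes> \<iota> (ihom (MObj A) Z)) \<cdot> inverse_arr (\<alpha> (MObj A) (MObj A) (ihom (MObj A) Z)))"

definition "coind A Z = (ihom (MObj A) Z, coact A Z)"

text \<open>Evaluation at the unit of \<open>A\<close>.\<close>

definition "coind_counit A Z = ev (MObj A) Z \<cdot> (MOne A \<otimes> \<iota> (ihom (MObj A) Z)) \<cdot> inverse_arr (lu (ihom (MObj A) Z))"

text \<open>In elements, x goes to the map a |-> h(a x).\<close>

definition "coind_map A M Z h = cur (MObj A) (fst M) Z (h \<cdot> snd M)"

definition "coind_fctr A = \<lparr>on_obj = coind A,
  on_arr = \<lambda>z. (coind A (Dom C z), ihom_post (MObj A) z, coind A (Cod C z))\<rparr>"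

lemma coind_fctr_simps [simp]: "on_obj (coind_fctr A) = coind A"
  "on_arr (coind_fctr A) z = (coind A (Dom C z), ihom_post (MObj A) z, coind A (Cod C z))"
  "fst (coind A Z) = ihom (MObj A) Z" "snd (coind A Z) = coact A Z"
  by (simp_all add: coind_fctr_def coind_def)

end

locale monoid_object = monoidal_model_structure u C
  for u :: "'u itself" and C :: "('o, 'm, 'z) monoidal_model_cat_scheme" (structure) +
  fixes A :: "('o, 'm) mon"
  assumes monoid: "monoid_in C A"
begin

lemma mon_simps [simp]:
  "MObj A \<in> Obj C" "MMul A \<in> Arr C" "Dom C (MMul A) = MObj A \<odot> MObj A" "Cod C (MMul A) = MObj A"
  "MOne A \<in> Arr C" "Dom C (MOne A) = Unit C" "Cod C (MOne A) = MObj A"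
  using monoid by (auto simp: monoid_in_def)

lemma mon_assoc: "MMul A \<cdot> (\<iota> (MObj A) \<otimes> MMul A) \<cdot> \<alpha> (MObj A) (MObj A) (MObj A) = MMul A \<cdot> (MMul A \<otimes> \<iota> (MObj A))"
  and mon_unit: "MMul A \<cdot> (MOne A \<otimes> \<iota> (MObj A)) = lu (MObj A)" "MMul A \<cdot> (\<iota> (MObj A) \<otimes> MOne A) = ru (MObj A)"
  using monoid by (auto simp: monoid_in_def)

lemma left_moduleD:
  assumes "left_module C A M"
  shows "fst M \<in> Obj C" "snd M \<in> Arr C" "Dom C (snd M) = MObj A \<odot> fst M" "Cod C (snd M) = fst M"
    "snd M \<cdot> (\<iota> (MObj A) \<otimes> snd M) \<cdot> \<alpha> (MObj A) (MObj A) (fst M) = snd M \<cdot> (MMul A \<otimes> \<iota> (fst M))"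
    "snd M \<cdot> (MOne A \<otimes> \<iota> (fst M)) = lu (fst M)"
  using assms by (simp_all add: left_module_iff)

lemma coact_simps [simp]:
  assumes "Z \<in> Obj C"
  shows "coact A Z \<in> Arr C" "Dom C (coact A Z) = MObj A \<odot> ihom (MObj A) Z" "Cod C (coact A Z) = ihom (MObj A) Z"
    "coind_counit A Z \<in> Arr C" "Dom C (coind_counit A Z) = ihom (MObj A) Z" "Cod C (coind_counit A Z) = Z"
  using assms by (simp_all add: coact_def coind_counit_def)

lemma ev_coact:
  assumes [simp]: "Z \<in> Obj C"
  shows "(ev (MObj A) Z \<cdot> (\<iota> (MObj A) \<otimes> coact A Z)) \<cdot> \<alpha> (MObj A) (MObj A) (ihom (MObj A) Z) =
    ev (MObj A) Z \<cdot> (MMul A \<otimes> \<iota> (ihom (MObj A) Z))"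
  by (simp only: coact_def, subst cur(4)) simp_all

lemma counit_lu:
  assumes [simp]: "Z \<in> Obj C"
  shows "coind_counit A Z \<cdot> lu (ihom (MObj A) Z) = ev (MObj A) Z \<cdot> (MOne A \<otimes> \<iota> (ihom (MObj A) Z))"
  by (simp add: coind_counit_def)

text \<open>In elements (a . phi)(1) = phi(1 a) = phi(a), from the left unit law of
  \<open>A\<close>. The work is in moving the unit past the associator, for which
  \<open>lunit_tensor\<close> is needed.\<close>

lemma counit_coact:
  assumes [simp]: "Z \<in> Obj C"
  shows "coind_counit A Z \<cdot> coact A Z = ev (MObj A) Z"
proof -
  let ?A = "MObj A" and ?S = "Unit C" and ?m = "MMul A" and ?e = "MOne A"
  define E where "E = ihom ?A Z"
  have E [simp]: "ihom ?A Z = E" "E \<in> Obj C" by (simp_all add: E_def)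
  have "((coind_counit A Z \<cdot> coact A Z) \<cdot> lu (?A \<odot> E)) \<cdot> \<alpha> ?S ?A E =
    ((coind_counit A Z \<cdot> lu E) \<cdot> (\<iota> ?S \<otimes> coact A Z)) \<cdot> \<alpha> ?S ?A E"
    using lunit_nat[of "coact A Z"] by simp
  also have "\<dots> = (ev ?A Z \<cdot> (\<iota> ?A \<otimes> coact A Z)) \<cdot> ((?e \<otimes> (\<iota> ?A \<otimes> \<iota> E)) \<cdot> \<alpha> ?S ?A E)"
    using counit_lu[of Z] by simp
  also have "\<dots> = ((ev ?A Z \<cdot> (\<iota> ?A \<otimes> coact A Z)) \<cdot> \<alpha> ?A ?A E) \<cdot> ((?e \<otimes> \<iota> ?A) \<otimes> \<iota> E)"
    using assoc_nat[of ?e "\<iota> ?A" "\<iota> E"] by simp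
  also have "\<dots> = (ev ?A Z \<cdot> (?m \<otimes> \<iota> E)) \<cdot> ((?e \<otimes> \<iota> ?A) \<otimes> \<iota> E)"
    using ev_coact[of Z] by (simp only: E assms)
  also have "\<dots> = ev ?A Z \<cdot> (lu ?A \<otimes> \<iota> E)" by (simp add: mon_unit)
  also have "\<dots> = (ev ?A Z \<cdot> lu (?A \<odot> E)) \<cdot> \<alpha> ?S ?A E"
    using lunit_tensor[of ?A E] by simp
  finally have "(coind_counit A Z \<cdot> coact A Z) \<cdot> lu (?A \<odot> E) = ev ?A Z \<cdot> lu (?A \<odot> E)"
    by (rule iso_epi[rotated]) simp_all
  then show ?thesis by (rule iso_epi[rotated]) simp_all
qed

text \<open>Both laws are tested after evaluation. In elements: phi(b 1) = phi(b) for the unit, and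
  phi((b a) a') = phi(b (a a')) for associativity, the latter brought into position by the
  pentagon.\<close>

lemma left_module_coind:
  assumes [simp]: "Z \<in> Obj C"
  shows "left_module C A (coind A Z)"
proof -
  let ?A = "MObj A" and ?S = "Unit C" and ?m = "MMul A" and ?e = "MOne A" and ?r = "coact A Z" and ?v = "ev (MObj A) Z"
  define E where "E = ihom ?A Z"
  have E [simp]: "ihom ?A Z = E" "E \<in> Obj C" by (simp_all add: E_def)
  have 1: "?r \<cdot> (?e \<otimes> \<iota> E) = lu E"
  proof (rule ev_inject[of ?A Z])
    have "(?v \<cdot> (\<iota> ?A \<otimes> (?r \<cdot> (?e \<otimes> \<iota> E)))) \<cdot> \<alpha> ?A ?S E =
      (?v \<cdot> (\<iota> ?A \<otimes> ?r)) \<cdot> ((\<iota> ?A \<otimes> (?e \<otimes> \<iota> E)) \<cdot> \<alpha> ?A ?S E)" by simp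
    also have "\<dots> = ((?v \<cdot> (\<iota> ?A \<otimes> ?r)) \<cdot> \<alpha> ?A ?A E) \<cdot> ((\<iota> ?A \<otimes> ?e) \<otimes> \<iota> E)"
      using assoc_nat[of "\<iota> ?A" ?e "\<iota> E"] by simp
    also have "\<dots> = (?v \<cdot> (?m \<otimes> \<iota> E)) \<cdot> ((\<iota> ?A \<otimes> ?e) \<otimes> \<iota> E)"
      using ev_coact[of Z] by (simp only: E assms)
    also have "\<dots> = ?v \<cdot> (ru ?A \<otimes> \<iota> E)" by (simp add: mon_unit)
    also have "\<dots> = (?v \<cdot> (\<iota> ?A \<otimes> lu E)) \<cdot> \<alpha> ?A ?S E"
      using triangle[of ?A E] by simp
    finally show "?v \<cdot> (\<iota> ?A \<otimes> (?r \<cdot> (?e \<otimes> \<iota> E))) = ?v \<cdot> (\<iota> ?A \<otimes> lu E)"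
      by (rule iso_epi[rotated]) simp_all
  qed simp_all
  have 2: "?r \<cdot> (?m \<otimes> \<iota> E) = ?r \<cdot> (\<iota> ?A \<otimes> ?r) \<cdot> \<alpha> ?A ?A E"
  proof (rule ev_inject[of ?A Z])
    have "((?v \<cdot> (\<iota> ?A \<otimes> (?r \<cdot> (?m \<otimes> \<iota> E)))) \<cdot> \<alpha> ?A (?A \<odot> ?A) E) \<cdot> (\<alpha> ?A ?A ?A \<otimes> \<iota> E) =
      (?v \<cdot> (\<iota> ?A \<otimes> ?r)) \<cdot> ((\<iota> ?A \<otimes> (?m \<otimes> \<iota> E)) \<cdot> \<alpha> ?A (?A \<odot> ?A) E) \<cdot> (\<alpha> ?A ?A ?A \<otimes> \<iota> E)" by simp
    also have "\<dots> = (?v \<cdot> (\<iota> ?A \<otimes> ?r)) \<cdot> (\<alpha> ?A ?A E \<cdot> ((\<iota> ?A \<otimes> ?m) \<otimes> \<iota> E)) \<cdot> (\<alpha> ?A ?A ?A \<otimes> \<iota> E)"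
      using assoc_nat[of "\<iota> ?A" ?m "\<iota> E"] by simp
    also have "\<dots> = ((?v \<cdot> (\<iota> ?A \<otimes> ?r)) \<cdot> \<alpha> ?A ?A E) \<cdot> (((\<iota> ?A \<otimes> ?m) \<cdot> \<alpha> ?A ?A ?A) \<otimes> \<iota> E)"
      by simp
    also have "\<dots> = (?v \<cdot> (?m \<otimes> \<iota> E)) \<cdot> (((\<iota> ?A \<otimes> ?m) \<cdot> \<alpha> ?A ?A ?A) \<otimes> \<iota> E)"
      using ev_coact[of Z] by (simp only: E assms)
    also have "\<dots> = (?v \<cdot> (?m \<otimes> \<iota> E)) \<cdot> ((?m \<otimes> \<iota> ?A) \<otimes> \<iota> E)"
      by (simp add: mon_assoc)
    also have "\<dots> = ((?v \<cdot> (\<iota> ?A \<otimes> ?r)) \<cdot> \<alpha> ?A ?A E) \<cdot> ((?m \<otimes> \<iota> ?A) \<otimes> \<iota> E)"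
      using ev_coact[of Z] by (simp only: E assms)
    also have "\<dots> = (?v \<cdot> (\<iota> ?A \<otimes> ?r)) \<cdot> ((?m \<otimes> (\<iota> ?A \<otimes> \<iota> E)) \<cdot> \<alpha> (?A \<odot> ?A) ?A E)"
      using assoc_nat[of ?m "\<iota> ?A" "\<iota> E"] by simp
    also have "\<dots> = (?v \<cdot> (?m \<otimes> \<iota> E)) \<cdot> ((\<iota> ?A \<otimes> \<iota> ?A) \<otimes> ?r) \<cdot> \<alpha> (?A \<odot> ?A) ?A E"
      by simp
    also have "\<dots> = ((?v \<cdot> (\<iota> ?A \<otimes> ?r)) \<cdot> \<alpha> ?A ?A E) \<cdot> ((\<iota> ?A \<otimes> \<iota> ?A) \<otimes> ?r) \<cdot> \<alpha> (?A \<odot> ?A) ?A E"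
      using ev_coact[of Z] by (simp only: E assms)
    also have "\<dots> = (?v \<cdot> (\<iota> ?A \<otimes> ?r)) \<cdot> (\<alpha> ?A ?A E \<cdot> ((\<iota> ?A \<otimes> \<iota> ?A) \<otimes> ?r)) \<cdot> \<alpha> (?A \<odot> ?A) ?A E"
      by simp
    also have "\<dots> = (?v \<cdot> (\<iota> ?A \<otimes> ?r)) \<cdot> (\<iota> ?A \<otimes> (\<iota> ?A \<otimes> ?r)) \<cdot> (\<alpha> ?A ?A (?A \<odot> E) \<cdot> \<alpha> (?A \<odot> ?A) ?A E)"
      using assoc_nat[of "\<iota> ?A" "\<iota> ?A" ?r] by simp
    \<comment> \<open>The pentagon rewrites the two remaining associators so that the tail agrees
      with that of the first line and can be cancelled.\<close>
    also have "\<dots> = (?v \<cdot> (\<iota> ?A \<otimes> ?r)) \<cdot> (\<iota> ?A \<otimes> (\<iota> ?A \<otimes> ?r)) \<cdot>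
        ((\<iota> ?A \<otimes> \<alpha> ?A ?A E) \<cdot> \<alpha> ?A (?A \<odot> ?A) E \<cdot> (\<alpha> ?A ?A ?A \<otimes> \<iota> E))"
      by (subst pentagon) simp_all
    also have "\<dots> = ((?v \<cdot> (\<iota> ?A \<otimes> (?r \<cdot> (\<iota> ?A \<otimes> ?r) \<cdot> \<alpha> ?A ?A E))) \<cdot> \<alpha> ?A (?A \<odot> ?A) E) \<cdot> (\<alpha> ?A ?A ?A \<otimes> \<iota> E)"
      by simp
    finally have "(?v \<cdot> (\<iota> ?A \<otimes> (?r \<cdot> (?m \<otimes> \<iota> E)))) \<cdot> \<alpha> ?A (?A \<odot> ?A) E =
      (?v \<cdot> (\<iota> ?A \<otimes> (?r \<cdot> (\<iota> ?A \<otimes> ?r) \<cdot> \<alpha> ?A ?A E))) \<cdot> \<alpha> ?A (?A \<odot> ?A) E"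
      by (rule iso_epi[rotated]) simp_all
    then show "?v \<cdot> (\<iota> ?A \<otimes> (?r \<cdot> (?m \<otimes> \<iota> E))) = ?v \<cdot> (\<iota> ?A \<otimes> (?r \<cdot> (\<iota> ?A \<otimes> ?r) \<cdot> \<alpha> ?A ?A E))"
      by (rule iso_epi[rotated]) simp_all
  qed simp_all
  show ?thesis using 1 2 by (simp add: left_module_iff)
qed

text \<open>The assumption reads h(x)(a) = w(a x). At a = 1 it gives the first claim; linearity is
  h(a x)(b) = w(b a x) = h(x)(b a).\<close>

lemma coind_transpose:
  assumes M: "left_module C A M" and h: "h \<in> hom C (fst M) (ihom (MObj A) Z)" and Z [simp]: "Z \<in> Obj C"
    and w: "w \<in> hom C (fst M) Z" and e: "ev (MObj A) Z \<cdot> (\<iota> (MObj A) \<otimes> h) = w \<cdot> snd M"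
  shows "coind_counit A Z \<cdot> h = w" "h \<cdot> snd M = coact A Z \<cdot> (\<iota> (MObj A) \<otimes> h)"
proof -
  let ?A = "MObj A" and ?m = "MMul A" and ?e = "MOne A" and ?v = "ev (MObj A) Z"
  define E where "E = ihom ?A Z"
  have E [simp]: "ihom ?A Z = E" "E \<in> Obj C" by (simp_all add: E_def)
  obtain X a where M': "M = (X, a)" by (cases M)
  note M'' = left_moduleD[OF M, unfolded M' fst_conv snd_conv]
  have [simp]: "X \<in> Obj C" "a \<in> Arr C" "Dom C a = ?A \<odot> X" "Cod C a = X"
    "h \<in> Arr C" "Dom C h = X" "Cod C h = E" "w \<in> Arr C" "Dom C w = X" "Cod C w = Z"
    using M'' h w by (auto simp: M')
  have e': "?v \<cdot> (\<iota> ?A \<otimes> h) = w \<cdot> a" using e by (simp add: M')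
  have "(coind_counit A Z \<cdot> h) \<cdot> lu X = (coind_counit A Z \<cdot> lu E) \<cdot> (\<iota> (Unit C) \<otimes> h)"
    using lunit_nat[of h] by simp
  also have "\<dots> = (?v \<cdot> (\<iota> ?A \<otimes> h)) \<cdot> (?e \<otimes> \<iota> X)"
    using counit_lu[of Z] by simp
  also have "\<dots> = (w \<cdot> a) \<cdot> (?e \<otimes> \<iota> X)" by (simp only: e')
  also have "\<dots> = w \<cdot> lu X" by (simp add: M'')
  finally have "coind_counit A Z \<cdot> h = w" by (rule iso_epi[rotated]) simp_all
  then show "coind_counit A Z \<cdot> h = w" by simp
  have "h \<cdot> a = coact A Z \<cdot> (\<iota> ?A \<otimes> h)"
  proof (rule ev_inject[of ?A Z])
    have "(?v \<cdot> (\<iota> ?A \<otimes> (coact A Z \<cdot> (\<iota> ?A \<otimes> h)))) \<cdot> \<alpha> ?A ?A X =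
      (?v \<cdot> (\<iota> ?A \<otimes> coact A Z)) \<cdot> ((\<iota> ?A \<otimes> (\<iota> ?A \<otimes> h)) \<cdot> \<alpha> ?A ?A X)" by simp
    also have "\<dots> = ((?v \<cdot> (\<iota> ?A \<otimes> coact A Z)) \<cdot> \<alpha> ?A ?A E) \<cdot> ((\<iota> ?A \<otimes> \<iota> ?A) \<otimes> h)"
      using assoc_nat[of "\<iota> ?A" "\<iota> ?A" h] by simp
    also have "\<dots> = (?v \<cdot> (?m \<otimes> \<iota> E)) \<cdot> ((\<iota> ?A \<otimes> \<iota> ?A) \<otimes> h)"
      using ev_coact[of Z] by (simp only: E Z)
    also have "\<dots> = (?v \<cdot> (\<iota> ?A \<otimes> h)) \<cdot> (?m \<otimes> \<iota> X)" by simp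
    also have "\<dots> = (w \<cdot> a) \<cdot> (?m \<otimes> \<iota> X)" by (simp only: e')
    also have "\<dots> = w \<cdot> (a \<cdot> (\<iota> ?A \<otimes> a) \<cdot> \<alpha> ?A ?A X)" by (simp add: M''(5))
    also have "\<dots> = (w \<cdot> a) \<cdot> ((\<iota> ?A \<otimes> a) \<cdot> \<alpha> ?A ?A X)" by simp
    also have "\<dots> = (?v \<cdot> (\<iota> ?A \<otimes> h)) \<cdot> ((\<iota> ?A \<otimes> a) \<cdot> \<alpha> ?A ?A X)" by (simp only: e')
    also have "\<dots> = (?v \<cdot> (\<iota> ?A \<otimes> (h \<cdot> a))) \<cdot> \<alpha> ?A ?A X" by simp
    finally have "?v \<cdot> (\<iota> ?A \<otimes> (coact A Z \<cdot> (\<iota> ?A \<otimes> h))) = ?v \<cdot> (\<iota> ?A \<otimes> (h \<cdot> a))"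
      by (rule iso_epi[rotated]) simp_all
    then show "?v \<cdot> (\<iota> ?A \<otimes> (h \<cdot> a)) = ?v \<cdot> (\<iota> ?A \<otimes> (coact A Z \<cdot> (\<iota> ?A \<otimes> h)))" ..
  qed simp_all
  then show "h \<cdot> snd M = coact A Z \<cdot> (\<iota> ?A \<otimes> h)" by (simp add: M')
qed

text \<open>Conversely a linear \<open>h\<close> is determined by its value at the unit: h(x)(a) =
  (a . h(x))(1) = h(a x)(1). This is the uniqueness needed for the adjunction.\<close>

lemma coind_untranspose:
  assumes "left_module C A M" "h \<in> hom C (fst M) (ihom (MObj A) Z)" and Z [simp]: "Z \<in> Obj C"
    and "h \<cdot> snd M = coact A Z \<cdot> (\<iota> (MObj A) \<otimes> h)"
  shows "ev (MObj A) Z \<cdot> (\<iota> (MObj A) \<otimes> h) = (coind_counit A Z \<cdot> h) \<cdot> snd M"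
proof -
  note [simp] = left_moduleD(1-4)[OF assms(1)] assms(2)[unfolded in_hom]
  have "(coind_counit A Z \<cdot> h) \<cdot> snd M = (coind_counit A Z \<cdot> coact A Z) \<cdot> (\<iota> (MObj A) \<otimes> h)"
    using assms(4) by simp
  then show ?thesis by (simp only: counit_coact Z)
qed

lemma forget_coind_adjunction:
  assumes K: "category (left_modules C A)"
  shows "adjunction (left_modules C A) C left_forget (coind_fctr A) (\<lambda>M Z h. (M, coind_map A M Z h, coind A Z))"
proof (rule adjunction_from_counit[where \<epsilon> = "coind_counit A"])
  show "is_functor (left_modules C A) C left_forget"
    using K category_axioms left_moduleD(1) by (simp add: is_functor_def)
next
  fix z assume z [simp]: "z \<in> Arr C"
  have *: "ev (MObj A) (Cod C z) \<cdot> (\<iota> (MObj A) \<otimes> ihom_post (MObj A) z) =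
    (z \<cdot> coind_counit A (Dom C z)) \<cdot> snd (coind A (Dom C z))"
    using ev_ihom_post[of "MObj A" z "\<iota> (ihom (MObj A) (Dom C z))"] by (simp add: counit_coact)
  have t: "coind_counit A (Cod C z) \<cdot> ihom_post (MObj A) z = z \<cdot> coind_counit A (Dom C z)"
    "ihom_post (MObj A) z \<cdot> snd (coind A (Dom C z)) = coact A (Cod C z) \<cdot> (\<iota> (MObj A) \<otimes> ihom_post (MObj A) z)"
    by (rule coind_transpose[OF left_module_coind _ _ _ *]; simp)+
  then show "coind_counit A (Cod C z) \<cdot> on_arr left_forget (on_arr (coind_fctr A) z) = z \<cdot> coind_counit A (Dom C z)"
    by simp
  show "on_arr (coind_fctr A) z \<in> hom (left_modules C A) (on_obj (coind_fctr A) (Dom C z)) (on_obj (coind_fctr A) (Cod C z))"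
    using t(2) by (simp add: left_module_coind)
next
  fix M Z h assume M: "M \<in> Obj (left_modules C A)" and Z [simp]: "Z \<in> Obj C" and h: "h \<in> hom C (on_obj left_forget M) Z"
  have M': "left_module C A M" using M by simp
  note [simp] = left_moduleD(1-4)[OF M'] h[unfolded in_hom left_forget_simps]
  have e: "ev (MObj A) Z \<cdot> (\<iota> (MObj A) \<otimes> coind_map A M Z h) = h \<cdot> snd M"
    by (simp add: coind_map_def cur)
  have k: "coind_map A M Z h \<in> hom C (fst M) (ihom (MObj A) Z)" by (simp add: coind_map_def)
  show "(M, coind_map A M Z h, coind A Z) \<in> hom (left_modules C A) M (on_obj (coind_fctr A) Z) \<and>
      coind_counit A Z \<cdot> on_arr left_forget (M, coind_map A M Z h, coind A Z) = h"
    using coind_transpose[OF M' k Z _ e] k M' by (simp add: left_module_coind)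
next
  fix M Z k k' assume M: "M \<in> Obj (left_modules C A)" and Z [simp]: "Z \<in> Obj C"
    and k: "k \<in> hom (left_modules C A) M (on_obj (coind_fctr A) Z)"
      "k' \<in> hom (left_modules C A) M (on_obj (coind_fctr A) Z)"
    and e: "coind_counit A Z \<cdot> on_arr left_forget k = coind_counit A Z \<cdot> on_arr left_forget k'"
  have M': "left_module C A M" using M by simp
  have "fst (snd k) = fst (snd k')"
    by (rule ev_inject[of "MObj A" Z])
      (use k e coind_untranspose[OF M', of "fst (snd k)" Z] coind_untranspose[OF M', of "fst (snd k')" Z] in auto)
  then show "k = k'" using k by (auto intro!: prod_eqI)
qed (use category_axioms in \<open>simp_all add: left_module_coind\<close>)

text \<open>The underlying arrow of a coinduced map is [A, p], so preservation of fibrations and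
  trivial fibrations is \<open>ihom_post_fib\<close>.\<close>

lemma forget_left_quillen:
  assumes A: "cofibrant C (MObj A)" and K: "model_category u (left_modules C A)"
  shows "left_quillen u (left_modules C A) C left_forget (coind_fctr A) (\<lambda>M Z h. (M, coind_map A M Z h, coind A Z))"
proof -
  interpret K: model_structure u "left_modules C A" using infinite_universe K by unfold_locales
  note adj = forget_coind_adjunction[OF K.category_axioms]
  have arr: "on_arr (coind_fctr A) p \<in> Arr (left_modules C A)" if "p \<in> Fib C" for p
    using functorD(4)[OF adjunctionD(2)[OF adj] fib_arr[OF that]] .
  show ?thesis
  proof (rule left_quillen_by_right_adjoint[OF infinite_universe K model adj])
    show "on_arr (coind_fctr A) p \<in> Fib (left_modules C A)" if "p \<in> Fib C" for p
      using arr[OF that] ihom_post_fib(1)[OF A that] unfolding left_modules_simps(8) by simp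
    show "on_arr (coind_fctr A) p \<in> Weq (left_modules C A)" if "p \<in> Fib C" "p \<in> Weq C" for p
      using arr[OF that(1)] ihom_post_fib(2)[OF A that] unfolding left_modules_simps(7) by simp
  qed
qed

end

section \<open>Restriction and induction\<close>

context category
begin

text \<open>The targets of \<open>h\<close> and \<open>k\<close> need not be assumed equal: they
  agree because the composites with \<open>p\<close> do.\<close>

lemma coequalizer_epi:
  assumes p: "is_coequalizer C s t p" and h: "h \<in> Arr C" "k \<in> Arr C" "Dom C h = Cod C p" "Dom C k = Cod C p" "h \<cdot> p = k \<cdot> p"
  shows "h = k"
proof -
  have st [simp]: "s \<in> Arr C" "t \<in> Arr C" "Cod C s = Cod C t" "Dom C s = Dom C t" "p \<in> Arr C" "Dom C p = Cod C t"
    and e: "p \<cdot> s = p \<cdot> t"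
    using p unfolding is_coequalizer_def by auto
  have "Cod C h = Cod C (h \<cdot> p)" "Cod C k = Cod C (k \<cdot> p)" using h(1-4) by simp_all
  then have hk: "Cod C h = Cod C k" using h(5) by simp
  have "(h \<cdot> p) \<cdot> s = (h \<cdot> p) \<cdot> t" using e h(1-4) by simp
  moreover have "h \<cdot> p \<in> hom C (Cod C s) (Cod C k)" using hk h(1-4) by simp
  ultimately have "\<exists>!l. l \<in> hom C (Cod C p) (Cod C k) \<and> l \<cdot> p = h \<cdot> p"
    by (intro coequalizer_induced[OF p])
  moreover have "h \<in> hom C (Cod C p) (Cod C k)" "k \<in> hom C (Cod C p) (Cod C k)" using h hk by simp_all
  ultimately show ?thesis using h(5) by metis
qed

end

locale monoid_morphism = monoidal_model_structure u C + A: monoid_object u C A + A': monoid_object u C A'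
  for u :: "'u itself" and C :: "('o, 'm, 'z) monoidal_model_cat_scheme" (structure)
    and A A' :: "('o, 'm) mon" +
  fixes f :: 'm
  assumes f_hom: "monoid_hom_in C A A' f"
begin

lemma f_simps [simp]: "f \<in> Arr C" "Dom C f = MObj A" "Cod C f = MObj A'"
  and f_mul: "f \<cdot> MMul A = MMul A' \<cdot> (f \<otimes> f)" and f_one: "f \<cdot> MOne A = MOne A'"
  using f_hom by (auto simp: monoid_hom_in_def)

lemma left_res_obj_simps [simp]: "fst (left_res_obj C f M) = fst M"
  "snd (left_res_obj C f M) = snd M \<cdot> (f \<otimes> \<iota> (fst M))"
  by (simp_all add: left_res_obj_def case_prod_beta)

lemma left_restriction_simps [simp]: "on_obj (left_restriction C f) M = left_res_obj C f M"
  "on_arr (left_restriction C f) x = (left_res_obj C f (fst x), fst (snd x), left_res_obj C f (snd (snd x)))"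
  by (simp_all add: left_restriction_def case_prod_beta)

lemma left_module_res:
  assumes M: "left_module C A' M"
  shows "left_module C A (left_res_obj C f M)"
proof -
  obtain X a where M': "M = (X, a)" by (cases M)
  note M'' = A'.left_moduleD[OF M, unfolded M' fst_conv snd_conv]
  note [simp] = M''(1-4)
  let ?A = "MObj A" and ?B = "MObj A'"
  have "(a \<cdot> (f \<otimes> \<iota> X)) \<cdot> (MMul A \<otimes> \<iota> X) = (a \<cdot> (MMul A' \<otimes> \<iota> X)) \<cdot> ((f \<otimes> f) \<otimes> \<iota> X)"
    by (simp add: f_mul)
  also have "\<dots> = (a \<cdot> (\<iota> ?B \<otimes> a)) \<cdot> (\<alpha> ?B ?B X \<cdot> ((f \<otimes> f) \<otimes> \<iota> X))"
    by (simp add: M''(5)[symmetric])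
  also have "\<dots> = (a \<cdot> (\<iota> ?B \<otimes> a)) \<cdot> ((f \<otimes> (f \<otimes> \<iota> X)) \<cdot> \<alpha> ?A ?A X)"
    using assoc_nat[of f f "\<iota> X"] by simp
  also have "\<dots> = (a \<cdot> (f \<otimes> \<iota> X)) \<cdot> (\<iota> ?A \<otimes> (a \<cdot> (f \<otimes> \<iota> X))) \<cdot> \<alpha> ?A ?A X"
    by simp
  finally have 1: "(a \<cdot> (f \<otimes> \<iota> X)) \<cdot> (MMul A \<otimes> \<iota> X) = \<dots>" .
  have "(a \<cdot> (f \<otimes> \<iota> X)) \<cdot> (MOne A \<otimes> \<iota> X) = lu X"
    using M''(6) by (simp add: f_one)
  with 1 show ?thesis by (simp add: left_module_iff M')
qed

lemma left_restriction_functor: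
  assumes "category (left_modules C A)" "category (left_modules C A')"
  shows "is_functor (left_modules C A') (left_modules C A) (left_restriction C f)"
proof -
  have "h \<cdot> (snd M \<cdot> (f \<otimes> \<iota> (fst M))) = (snd N \<cdot> (f \<otimes> \<iota> (fst N))) \<cdot> (\<iota> (MObj A) \<otimes> h)"
    if M: "left_module C A' M" and N: "left_module C A' N" and h: "h \<in> hom C (fst M) (fst N)"
      and e: "h \<cdot> snd M = snd N \<cdot> (\<iota> (MObj A') \<otimes> h)" for M N h
  proof -
    note [simp] = A'.left_moduleD(1-4)[OF M] A'.left_moduleD(1-4)[OF N] h[unfolded in_hom]
    have "h \<cdot> (snd M \<cdot> (f \<otimes> \<iota> (fst M))) = (h \<cdot> snd M) \<cdot> (f \<otimes> \<iota> (fst M))" by simp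
    also have "\<dots> = (snd N \<cdot> (\<iota> (MObj A') \<otimes> h)) \<cdot> (f \<otimes> \<iota> (fst M))" by (simp only: e)
    finally show ?thesis by simp
  qed
  then show ?thesis
    unfolding is_functor_def using assms left_module_res by (simp add: A'.left_moduleD(1-4))
qed

section \<open>Induction as a coequalizer, its action and its universal property\<close>

abbreviation "proj M \<equiv> left_ind_proj C A A' f M"

abbreviation "ind_act M \<equiv> snd (left_ind_obj C A A' f M)"

lemma proj:
  assumes M: "left_module C A M"
  shows "is_coequalizer C ((MMul A' \<cdot> (\<iota> (MObj A') \<otimes> f)) \<otimes> \<iota> (fst M))
    ((\<iota> (MObj A') \<otimes> snd M) \<cdot> \<alpha> (MObj A') (MObj A) (fst M)) (proj M)"
proof -
  note [simp] = A.left_moduleD(1-4)[OF M]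
  have "\<exists>p. is_coequalizer C ((MMul A' \<cdot> (\<iota> (MObj A') \<otimes> f)) \<otimes> \<iota> (fst M))
    ((\<iota> (MObj A') \<otimes> snd M) \<cdot> \<alpha> (MObj A') (MObj A) (fst M)) p"
    using coequalizer_exists[of "(MMul A' \<cdot> (\<iota> (MObj A') \<otimes> f)) \<otimes> \<iota> (fst M)"
      "(\<iota> (MObj A') \<otimes> snd M) \<cdot> \<alpha> (MObj A') (MObj A) (fst M)"] by auto
  from someI_ex[OF this] show ?thesis
    by (simp add: left_ind_proj_def rel_tensor_proj_def right_res_obj_def case_prod_beta)
qed

lemma proj_simps [simp]:
  assumes M: "left_module C A M"
  shows "proj M \<in> Arr C" "Dom C (proj M) = MObj A' \<odot> fst M"
proof -
  note [simp] = A.left_moduleD(1-4)[OF M]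
  show "proj M \<in> Arr C" "Dom C (proj M) = MObj A' \<odot> fst M"
    using proj[OF M] unfolding is_coequalizer_def by simp_all
qed

lemma proj_balanced:
  assumes M: "left_module C A M"
  shows "proj M \<cdot> ((MMul A' \<cdot> (\<iota> (MObj A') \<otimes> f)) \<otimes> \<iota> (fst M)) =
    proj M \<cdot> ((\<iota> (MObj A') \<otimes> snd M) \<cdot> \<alpha> (MObj A') (MObj A) (fst M))"
  using proj[OF M] unfolding is_coequalizer_def by blast

lemma proj_induced:
  assumes M: "left_module C A M" and v: "v \<in> hom C (MObj A' \<odot> fst M) Z"
    and e: "v \<cdot> ((MMul A' \<cdot> (\<iota> (MObj A') \<otimes> f)) \<otimes> \<iota> (fst M)) =
      v \<cdot> ((\<iota> (MObj A') \<otimes> snd M) \<cdot> \<alpha> (MObj A') (MObj A) (fst M))"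
  shows "\<exists>!h. h \<in> hom C (Cod C (proj M)) Z \<and> h \<cdot> proj M = v"
proof -
  note [simp] = A.left_moduleD(1-4)[OF M]
  show ?thesis by (rule coequalizer_induced[OF proj[OF M] _ e]) (use v in simp)
qed

text \<open>Multiplication of \<open>A'\<close> on the left respects the relation (b f(a)) x = b (a
  x) by associativity, hence descends along \<open>A' \<odot> proj M\<close>, which is again a
  coequalizer by closedness.\<close>

lemma ind_act_ex1:
  assumes M: "left_module C A M"
  shows "\<exists>!b. b \<in> hom C (MObj A' \<odot> Cod C (proj M)) (Cod C (proj M)) \<and>
    b \<cdot> (\<iota> (MObj A') \<otimes> proj M) \<cdot> \<alpha> (MObj A') (MObj A') (fst M) = proj M \<cdot> (MMul A' \<otimes> \<iota> (fst M))"
proof -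
  let ?A = "MObj A" and ?B = "MObj A'" and ?m = "MMul A'" and ?p = "proj M"
  define X a where X: "X = fst M" "a = snd M"
  note [simp] = A.left_moduleD(1-4)[OF M, folded X] proj_simps[OF M, folded X]
  let ?s = "(?m \<cdot> (\<iota> ?B \<otimes> f)) \<otimes> \<iota> X" and ?t = "(\<iota> ?B \<otimes> a) \<cdot> \<alpha> ?B ?A X"
  note bal = proj_balanced[OF M, folded X]
  let ?v = "?p \<cdot> (?m \<otimes> \<iota> X) \<cdot> inverse_arr (\<alpha> ?B ?B X)"
  have "((?v \<cdot> (\<iota> ?B \<otimes> ?s)) \<cdot> \<alpha> ?B (?B \<odot> ?A) X) \<cdot> (\<alpha> ?B ?B ?A \<otimes> \<iota> X) =
    ?v \<cdot> ((\<iota> ?B \<otimes> ((?m \<cdot> (\<iota> ?B \<otimes> f)) \<otimes> \<iota> X)) \<cdot> \<alpha> ?B (?B \<odot> ?A) X) \<cdot> (\<alpha> ?B ?B ?A \<otimes> \<iota> X)"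
    by simp
  also have "\<dots> = ?v \<cdot> (\<alpha> ?B ?B X \<cdot> ((\<iota> ?B \<otimes> (?m \<cdot> (\<iota> ?B \<otimes> f))) \<otimes> \<iota> X)) \<cdot> (\<alpha> ?B ?B ?A \<otimes> \<iota> X)"
    using assoc_nat[of "\<iota> ?B" "?m \<cdot> (\<iota> ?B \<otimes> f)" "\<iota> X"] by simp
  also have "\<dots> = ?p \<cdot> ((?m \<cdot> (\<iota> ?B \<otimes> ?m) \<cdot> ((\<iota> ?B \<otimes> (\<iota> ?B \<otimes> f)) \<cdot> \<alpha> ?B ?B ?A)) \<otimes> \<iota> X)"
    by simp
  also have "(\<iota> ?B \<otimes> (\<iota> ?B \<otimes> f)) \<cdot> \<alpha> ?B ?B ?A = \<alpha> ?B ?B ?B \<cdot> ((\<iota> ?B \<otimes> \<iota> ?B) \<otimes> f)"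
    using assoc_nat[of "\<iota> ?B" "\<iota> ?B" f] by simp
  also have "?m \<cdot> (\<iota> ?B \<otimes> ?m) \<cdot> (\<alpha> ?B ?B ?B \<cdot> ((\<iota> ?B \<otimes> \<iota> ?B) \<otimes> f)) =
    (?m \<cdot> (\<iota> ?B \<otimes> ?m) \<cdot> \<alpha> ?B ?B ?B) \<cdot> ((\<iota> ?B \<otimes> \<iota> ?B) \<otimes> f)" by simp
  also have "\<dots> = ?m \<cdot> (\<iota> ?B \<otimes> f) \<cdot> (?m \<otimes> \<iota> ?A)" by (simp add: A'.mon_assoc)
  also have "?p \<cdot> ((?m \<cdot> (\<iota> ?B \<otimes> f) \<cdot> (?m \<otimes> \<iota> ?A)) \<otimes> \<iota> X) = (?p \<cdot> ?s) \<cdot> ((?m \<otimes> \<iota> ?A) \<otimes> \<iota> X)" by simp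
  also have "\<dots> = (?p \<cdot> ?t) \<cdot> ((?m \<otimes> \<iota> ?A) \<otimes> \<iota> X)" by (simp only: bal)
  also have "\<dots> = ?p \<cdot> (\<iota> ?B \<otimes> a) \<cdot> ((?m \<otimes> (\<iota> ?A \<otimes> \<iota> X)) \<cdot> \<alpha> (?B \<odot> ?B) ?A X)"
    using assoc_nat[of ?m "\<iota> ?A" "\<iota> X"] by simp
  also have "\<dots> = ?v \<cdot> (\<alpha> ?B ?B X \<cdot> ((\<iota> ?B \<otimes> \<iota> ?B) \<otimes> a)) \<cdot> \<alpha> (?B \<odot> ?B) ?A X" by simp
  also have "\<dots> = ?v \<cdot> ((\<iota> ?B \<otimes> (\<iota> ?B \<otimes> a)) \<cdot> (\<alpha> ?B ?B (?A \<odot> X) \<cdot> \<alpha> (?B \<odot> ?B) ?A X))"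
    using assoc_nat[of "\<iota> ?B" "\<iota> ?B" a] by simp
  also have "\<dots> = ?v \<cdot> ((\<iota> ?B \<otimes> (\<iota> ?B \<otimes> a)) \<cdot>
      ((\<iota> ?B \<otimes> \<alpha> ?B ?A X) \<cdot> \<alpha> ?B (?B \<odot> ?A) X \<cdot> (\<alpha> ?B ?B ?A \<otimes> \<iota> X)))"
    by (subst pentagon) simp_all
  also have "\<dots> = ((?v \<cdot> (\<iota> ?B \<otimes> ?t)) \<cdot> \<alpha> ?B (?B \<odot> ?A) X) \<cdot> (\<alpha> ?B ?B ?A \<otimes> \<iota> X)" by simp
  finally have "(?v \<cdot> (\<iota> ?B \<otimes> ?s)) \<cdot> \<alpha> ?B (?B \<odot> ?A) X = (?v \<cdot> (\<iota> ?B \<otimes> ?t)) \<cdot> \<alpha> ?B (?B \<odot> ?A) X"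
    by (rule iso_epi[rotated]) simp_all
  then have "?v \<cdot> (\<iota> ?B \<otimes> ?s) = ?v \<cdot> (\<iota> ?B \<otimes> ?t)"
    by (rule iso_epi[rotated]) simp_all
  moreover have "?v \<in> hom C (Cod C (\<iota> ?B \<otimes> ?s)) (Cod C ?p)" by simp
  ultimately have "\<exists>!b. b \<in> hom C (Cod C (\<iota> ?B \<otimes> ?p)) (Cod C ?p) \<and> b \<cdot> (\<iota> ?B \<otimes> ?p) = ?v"
    by (intro coequalizer_induced[OF tensor_coequalizer[OF _ proj[OF M, folded X]]]) simp_all
  \<comment> \<open>The definition of the action composes with the associator, the universal
    property with its inverse; the two conditions are equivalent.\<close>
  moreover have "b \<cdot> (\<iota> ?B \<otimes> ?p) = ?v \<longleftrightarrow> b \<cdot> (\<iota> ?B \<otimes> ?p) \<cdot> \<alpha> ?B ?B X = ?p \<cdot> (?m \<otimes> \<iota> X)"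
    if b: "b \<in> hom C (?B \<odot> Cod C ?p) (Cod C ?p)" for b
  proof
    assume *: "b \<cdot> (\<iota> ?B \<otimes> ?p) = ?v"
    have "b \<cdot> (\<iota> ?B \<otimes> ?p) \<cdot> \<alpha> ?B ?B X = (b \<cdot> (\<iota> ?B \<otimes> ?p)) \<cdot> \<alpha> ?B ?B X" using b by simp
    also have "\<dots> = ?v \<cdot> \<alpha> ?B ?B X" by (simp only: *)
    finally show "b \<cdot> (\<iota> ?B \<otimes> ?p) \<cdot> \<alpha> ?B ?B X = ?p \<cdot> (?m \<otimes> \<iota> X)" by simp
  next
    assume *: "b \<cdot> (\<iota> ?B \<otimes> ?p) \<cdot> \<alpha> ?B ?B X = ?p \<cdot> (?m \<otimes> \<iota> X)"
    show "b \<cdot> (\<iota> ?B \<otimes> ?p) = ?v"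
      by (rule iso_epi[of "\<alpha> ?B ?B X"]) (use b * in simp_all)
  qed
  ultimately show ?thesis unfolding X[symmetric] by (simp cong: conj_cong)
qed

lemma ind_obj_fst [simp]: "fst (left_ind_obj C A A' f M) = Cod C (proj M)"
  by (simp add: left_ind_obj_def Let_def)

lemma ind_act:
  assumes M: "left_module C A M"
  shows "ind_act M \<in> Arr C" "Dom C (ind_act M) = MObj A' \<odot> Cod C (proj M)" "Cod C (ind_act M) = Cod C (proj M)"
    "ind_act M \<cdot> (\<iota> (MObj A') \<otimes> proj M) \<cdot> \<alpha> (MObj A') (MObj A') (fst M) = proj M \<cdot> (MMul A' \<otimes> \<iota> (fst M))"
proof -
  have "ind_act M = (THE b. b \<in> hom C (MObj A' \<odot> Cod C (proj M)) (Cod C (proj M)) \<and>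
    b \<cdot> (\<iota> (MObj A') \<otimes> proj M) \<cdot> \<alpha> (MObj A') (MObj A') (fst M) = proj M \<cdot> (MMul A' \<otimes> \<iota> (fst M)))"
    by (simp add: left_ind_obj_def Let_def)
  with theI'[OF ind_act_ex1[OF M]] show "ind_act M \<in> Arr C" "Dom C (ind_act M) = MObj A' \<odot> Cod C (proj M)"
    "Cod C (ind_act M) = Cod C (proj M)"
    "ind_act M \<cdot> (\<iota> (MObj A') \<otimes> proj M) \<cdot> \<alpha> (MObj A') (MObj A') (fst M) = proj M \<cdot> (MMul A' \<otimes> \<iota> (fst M))"
    by simp_all
qed

text \<open>Lets equations on the induced module be checked on representatives in
  \<open>A' \<odot> X\<close>, even under a further tensor factor.\<close>

lemma tensor_proj_epi:
  assumes M: "left_module C A M" and Y: "Y \<in> Obj C"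
    and h: "h \<in> Arr C" "k \<in> Arr C" "Dom C h = Y \<odot> Cod C (proj M)" "Dom C k = Y \<odot> Cod C (proj M)"
      "h \<cdot> (\<iota> Y \<otimes> proj M) = k \<cdot> (\<iota> Y \<otimes> proj M)"
  shows "h = k"
  by (rule coequalizer_epi[OF tensor_coequalizer[OF Y proj[OF M]]]) (use M Y h in simp_all)

text \<open>Each law is checked on representatives, after composing with a product of an identity
  with \<open>p\<close> and an associator, where it reduces to the corresponding law of
  \<open>A'\<close>.\<close>

lemma left_module_ind:
  assumes M: "left_module C A M"
  shows "left_module C A' (left_ind_obj C A A' f M)"
proof -
  let ?B = "MObj A'" and ?m = "MMul A'" and ?e = "MOne A'" and ?S = "Unit C"
  define X p N b where X: "X = fst M" "p = proj M" "N = Cod C (proj M)" "b = ind_act M"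
  note [simp] = A.left_moduleD(1-4)[OF M, folded X] proj_simps[OF M, folded X] ind_act(1-3)[OF M, folded X]
  have N [simp]: "N = Cod C p" "Cod C p \<in> Obj C" by (simp_all add: X M)
  have act: "(b \<cdot> (\<iota> ?B \<otimes> p)) \<cdot> \<alpha> ?B ?B X = p \<cdot> (?m \<otimes> \<iota> X)"
    using ind_act(4)[OF M, folded X] by simp
  have "(b \<cdot> (?m \<otimes> \<iota> N)) \<cdot> (\<iota> (?B \<odot> ?B) \<otimes> p) = (b \<cdot> (\<iota> ?B \<otimes> b) \<cdot> \<alpha> ?B ?B N) \<cdot> (\<iota> (?B \<odot> ?B) \<otimes> p)"
  proof (rule iso_epi[of "\<alpha> (?B \<odot> ?B) ?B X"])
    have "((b \<cdot> (?m \<otimes> \<iota> N)) \<cdot> (\<iota> (?B \<odot> ?B) \<otimes> p)) \<cdot> \<alpha> (?B \<odot> ?B) ?B X =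
      (b \<cdot> (\<iota> ?B \<otimes> p)) \<cdot> ((?m \<otimes> (\<iota> ?B \<otimes> \<iota> X)) \<cdot> \<alpha> (?B \<odot> ?B) ?B X)" by simp
    also have "\<dots> = ((b \<cdot> (\<iota> ?B \<otimes> p)) \<cdot> \<alpha> ?B ?B X) \<cdot> ((?m \<otimes> \<iota> ?B) \<otimes> \<iota> X)"
      using assoc_nat[of ?m "\<iota> ?B" "\<iota> X"] by simp
    also have "\<dots> = (p \<cdot> (?m \<otimes> \<iota> X)) \<cdot> ((?m \<otimes> \<iota> ?B) \<otimes> \<iota> X)" by (simp only: act)
    also have "\<dots> = (p \<cdot> (?m \<otimes> \<iota> X)) \<cdot> ((\<iota> ?B \<otimes> ?m) \<otimes> \<iota> X) \<cdot> (\<alpha> ?B ?B ?B \<otimes> \<iota> X)"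
      by (simp add: A'.mon_assoc)
    also have "\<dots> = ((b \<cdot> (\<iota> ?B \<otimes> p)) \<cdot> \<alpha> ?B ?B X) \<cdot> ((\<iota> ?B \<otimes> ?m) \<otimes> \<iota> X) \<cdot> (\<alpha> ?B ?B ?B \<otimes> \<iota> X)"
      by (simp only: act)
    also have "\<dots> = (b \<cdot> (\<iota> ?B \<otimes> p)) \<cdot> (\<alpha> ?B ?B X \<cdot> ((\<iota> ?B \<otimes> ?m) \<otimes> \<iota> X)) \<cdot> (\<alpha> ?B ?B ?B \<otimes> \<iota> X)" by simp
    also have "\<dots> = (b \<cdot> (\<iota> ?B \<otimes> p)) \<cdot> ((\<iota> ?B \<otimes> (?m \<otimes> \<iota> X)) \<cdot> \<alpha> ?B (?B \<odot> ?B) X) \<cdot> (\<alpha> ?B ?B ?B \<otimes> \<iota> X)"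
      using assoc_nat[of "\<iota> ?B" ?m "\<iota> X"] by simp
    also have "\<dots> = b \<cdot> (\<iota> ?B \<otimes> (p \<cdot> (?m \<otimes> \<iota> X))) \<cdot> \<alpha> ?B (?B \<odot> ?B) X \<cdot> (\<alpha> ?B ?B ?B \<otimes> \<iota> X)" by simp
    also have "\<dots> = b \<cdot> (\<iota> ?B \<otimes> ((b \<cdot> (\<iota> ?B \<otimes> p)) \<cdot> \<alpha> ?B ?B X)) \<cdot> \<alpha> ?B (?B \<odot> ?B) X \<cdot> (\<alpha> ?B ?B ?B \<otimes> \<iota> X)"
      by (simp only: act)
    also have "\<dots> = b \<cdot> (\<iota> ?B \<otimes> (b \<cdot> (\<iota> ?B \<otimes> p))) \<cdot>
        ((\<iota> ?B \<otimes> \<alpha> ?B ?B X) \<cdot> \<alpha> ?B (?B \<odot> ?B) X \<cdot> (\<alpha> ?B ?B ?B \<otimes> \<iota> X))" by simp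
    also have "\<dots> = b \<cdot> (\<iota> ?B \<otimes> (b \<cdot> (\<iota> ?B \<otimes> p))) \<cdot> (\<alpha> ?B ?B (?B \<odot> X) \<cdot> \<alpha> (?B \<odot> ?B) ?B X)"
      by (subst pentagon) simp_all
    also have "\<dots> = b \<cdot> (\<iota> ?B \<otimes> b) \<cdot> ((\<iota> ?B \<otimes> (\<iota> ?B \<otimes> p)) \<cdot> \<alpha> ?B ?B (?B \<odot> X)) \<cdot> \<alpha> (?B \<odot> ?B) ?B X" by simp
    also have "\<dots> = b \<cdot> (\<iota> ?B \<otimes> b) \<cdot> (\<alpha> ?B ?B N \<cdot> ((\<iota> ?B \<otimes> \<iota> ?B) \<otimes> p)) \<cdot> \<alpha> (?B \<odot> ?B) ?B X"
      using assoc_nat[of "\<iota> ?B" "\<iota> ?B" p] by simp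
    also have "\<dots> = ((b \<cdot> (\<iota> ?B \<otimes> b) \<cdot> \<alpha> ?B ?B N) \<cdot> (\<iota> (?B \<odot> ?B) \<otimes> p)) \<cdot> \<alpha> (?B \<odot> ?B) ?B X" by simp
    finally show "((b \<cdot> (?m \<otimes> \<iota> N)) \<cdot> (\<iota> (?B \<odot> ?B) \<otimes> p)) \<cdot> \<alpha> (?B \<odot> ?B) ?B X = \<dots>" .
  qed simp_all
  then have 1: "b \<cdot> (?m \<otimes> \<iota> N) = b \<cdot> (\<iota> ?B \<otimes> b) \<cdot> \<alpha> ?B ?B N"
    by (rule tensor_proj_epi[OF M, of "?B \<odot> ?B", folded X, rotated 5]) simp_all
  have "(b \<cdot> (?e \<otimes> \<iota> N)) \<cdot> (\<iota> ?S \<otimes> p) = lu N \<cdot> (\<iota> ?S \<otimes> p)"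
  proof (rule iso_epi[of "\<alpha> ?S ?B X"])
    have "((b \<cdot> (?e \<otimes> \<iota> N)) \<cdot> (\<iota> ?S \<otimes> p)) \<cdot> \<alpha> ?S ?B X =
      (b \<cdot> (\<iota> ?B \<otimes> p)) \<cdot> ((?e \<otimes> (\<iota> ?B \<otimes> \<iota> X)) \<cdot> \<alpha> ?S ?B X)" by simp
    also have "\<dots> = ((b \<cdot> (\<iota> ?B \<otimes> p)) \<cdot> \<alpha> ?B ?B X) \<cdot> ((?e \<otimes> \<iota> ?B) \<otimes> \<iota> X)"
      using assoc_nat[of ?e "\<iota> ?B" "\<iota> X"] by simp
    also have "\<dots> = (p \<cdot> (?m \<otimes> \<iota> X)) \<cdot> ((?e \<otimes> \<iota> ?B) \<otimes> \<iota> X)" by (simp only: act)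
    also have "\<dots> = p \<cdot> (lu ?B \<otimes> \<iota> X)" by (simp add: A'.mon_unit)
    also have "\<dots> = (p \<cdot> lu (?B \<odot> X)) \<cdot> \<alpha> ?S ?B X" using lunit_tensor[of ?B X] by simp
    also have "p \<cdot> lu (?B \<odot> X) = lu N \<cdot> (\<iota> ?S \<otimes> p)" using lunit_nat[of p] by simp
    finally show "((b \<cdot> (?e \<otimes> \<iota> N)) \<cdot> (\<iota> ?S \<otimes> p)) \<cdot> \<alpha> ?S ?B X = (lu N \<cdot> (\<iota> ?S \<otimes> p)) \<cdot> \<alpha> ?S ?B X" .
  qed simp_all
  then have 2: "b \<cdot> (?e \<otimes> \<iota> N) = lu N"
    by (rule tensor_proj_epi[OF M, of ?S, folded X, rotated 5]) simp_all
  show ?thesis using 1 2 unfolding left_module_iff by (simp add: X[symmetric])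
qed

text \<open>In elements, x goes to the class of 1 (x) x, where (x) denotes the product.\<close>

definition "ind_unit M = proj M \<cdot> (MOne A' \<otimes> \<iota> (fst M)) \<cdot> inverse_arr (lu (fst M))"

lemma ind_unit_simps [simp]:
  assumes M: "left_module C A M"
  shows "ind_unit M \<in> Arr C" "Dom C (ind_unit M) = fst M" "Cod C (ind_unit M) = Cod C (proj M)"
  using A.left_moduleD(1-4)[OF M] M by (simp_all add: ind_unit_def)

lemma ind_unit_lu:
  assumes M: "left_module C A M"
  shows "ind_unit M \<cdot> lu (fst M) = proj M \<cdot> (MOne A' \<otimes> \<iota> (fst M))"
  using A.left_moduleD(1-4)[OF M] M by (simp add: ind_unit_def)

text \<open>The class of b (x) y is b acting on the class of 1 (x) y. Hence the projection is
  recovered from the action and the unit, which is why linear maps out of the induced module are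
  determined on the unit.\<close>

lemma ind_act_unit:
  assumes M: "left_module C A M"
  shows "ind_act M \<cdot> (\<iota> (MObj A') \<otimes> ind_unit M) = proj M"
proof -
  let ?B = "MObj A'" and ?m = "MMul A'" and ?e = "MOne A'" and ?S = "Unit C"
  define X p b where X: "X = fst M" "p = proj M" "b = ind_act M"
  note [simp] = A.left_moduleD(1-4)[OF M, folded X] proj_simps[OF M, folded X] ind_act(1-3)[OF M, folded X]
    ind_unit_simps[OF M, folded X]
  have act: "(b \<cdot> (\<iota> ?B \<otimes> p)) \<cdot> \<alpha> ?B ?B X = p \<cdot> (?m \<otimes> \<iota> X)"
    using ind_act(4)[OF M, folded X] by simp
  have "((b \<cdot> (\<iota> ?B \<otimes> ind_unit M)) \<cdot> (\<iota> ?B \<otimes> lu X)) \<cdot> \<alpha> ?B ?S X =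
    b \<cdot> (\<iota> ?B \<otimes> (ind_unit M \<cdot> lu X)) \<cdot> \<alpha> ?B ?S X" by simp
  also have "\<dots> = b \<cdot> (\<iota> ?B \<otimes> (p \<cdot> (?e \<otimes> \<iota> X))) \<cdot> \<alpha> ?B ?S X"
    by (simp only: ind_unit_lu[OF M, folded X])
  also have "\<dots> = (b \<cdot> (\<iota> ?B \<otimes> p)) \<cdot> ((\<iota> ?B \<otimes> (?e \<otimes> \<iota> X)) \<cdot> \<alpha> ?B ?S X)" by simp
  also have "\<dots> = ((b \<cdot> (\<iota> ?B \<otimes> p)) \<cdot> \<alpha> ?B ?B X) \<cdot> ((\<iota> ?B \<otimes> ?e) \<otimes> \<iota> X)"
    using assoc_nat[of "\<iota> ?B" ?e "\<iota> X"] by simp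
  also have "\<dots> = (p \<cdot> (?m \<otimes> \<iota> X)) \<cdot> ((\<iota> ?B \<otimes> ?e) \<otimes> \<iota> X)" by (simp only: act)
  also have "\<dots> = p \<cdot> (ru ?B \<otimes> \<iota> X)" by (simp add: A'.mon_unit)
  also have "\<dots> = (p \<cdot> (\<iota> ?B \<otimes> lu X)) \<cdot> \<alpha> ?B ?S X" using triangle[of ?B X] by simp
  finally have "(b \<cdot> (\<iota> ?B \<otimes> ind_unit M)) \<cdot> (\<iota> ?B \<otimes> lu X) = p \<cdot> (\<iota> ?B \<otimes> lu X)"
    by (rule iso_epi[rotated]) simp_all
  then have "b \<cdot> (\<iota> ?B \<otimes> ind_unit M) = p"
    by (rule iso_epi[rotated]) simp_all
  then show ?thesis by (simp only: X)
qed

text \<open>In elements, 1 (x) a y is identified with f(a) (x) y by the relation defining the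
  coequalizer; the right-hand side restricts the action along \<open>f\<close>.\<close>

lemma ind_unit_linear:
  assumes M: "left_module C A M"
  shows "ind_unit M \<cdot> snd M = (ind_act M \<cdot> (f \<otimes> \<iota> (Cod C (proj M)))) \<cdot> (\<iota> (MObj A) \<otimes> ind_unit M)"
proof -
  let ?A = "MObj A" and ?B = "MObj A'" and ?m = "MMul A'" and ?e = "MOne A'" and ?S = "Unit C"
  define X a p b where X: "X = fst M" "a = snd M" "p = proj M" "b = ind_act M"
  note [simp] = A.left_moduleD(1-4)[OF M, folded X] proj_simps[OF M, folded X] ind_act(1-3)[OF M, folded X]
    ind_unit_simps[OF M, folded X]
  note bal = proj_balanced[OF M, folded X]
  have "((ind_unit M \<cdot> a) \<cdot> lu (?A \<odot> X)) \<cdot> \<alpha> ?S ?A X = (ind_unit M \<cdot> (a \<cdot> lu (?A \<odot> X))) \<cdot> \<alpha> ?S ?A X"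
    by simp
  also have "a \<cdot> lu (?A \<odot> X) = lu X \<cdot> (\<iota> ?S \<otimes> a)" using lunit_nat[of a] by simp
  also have "(ind_unit M \<cdot> (lu X \<cdot> (\<iota> ?S \<otimes> a))) \<cdot> \<alpha> ?S ?A X = (ind_unit M \<cdot> lu X) \<cdot> (\<iota> ?S \<otimes> a) \<cdot> \<alpha> ?S ?A X"
    by simp
  also have "\<dots> = (p \<cdot> (?e \<otimes> \<iota> X)) \<cdot> (\<iota> ?S \<otimes> a) \<cdot> \<alpha> ?S ?A X"
    by (simp only: ind_unit_lu[OF M, folded X])
  also have "\<dots> = p \<cdot> (\<iota> ?B \<otimes> a) \<cdot> ((?e \<otimes> (\<iota> ?A \<otimes> \<iota> X)) \<cdot> \<alpha> ?S ?A X)" by simp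
  also have "\<dots> = (p \<cdot> ((\<iota> ?B \<otimes> a) \<cdot> \<alpha> ?B ?A X)) \<cdot> ((?e \<otimes> \<iota> ?A) \<otimes> \<iota> X)"
    using assoc_nat[of ?e "\<iota> ?A" "\<iota> X"] by simp
  also have "\<dots> = (p \<cdot> ((?m \<cdot> (\<iota> ?B \<otimes> f)) \<otimes> \<iota> X)) \<cdot> ((?e \<otimes> \<iota> ?A) \<otimes> \<iota> X)" by (simp only: bal)
  also have "\<dots> = p \<cdot> (((?m \<cdot> (?e \<otimes> \<iota> ?B)) \<cdot> (\<iota> ?S \<otimes> f)) \<otimes> \<iota> X)" by simp
  also have "(?m \<cdot> (?e \<otimes> \<iota> ?B)) \<cdot> (\<iota> ?S \<otimes> f) = lu ?B \<cdot> (\<iota> ?S \<otimes> f)"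
    by (simp only: A'.mon_unit)
  also have "\<dots> = f \<cdot> lu ?A" using lunit_nat[of f] by simp
  also have "p \<cdot> ((f \<cdot> lu ?A) \<otimes> \<iota> X) = (p \<cdot> (f \<otimes> \<iota> X)) \<cdot> (lu ?A \<otimes> \<iota> X)" by simp
  also have "\<dots> = ((p \<cdot> (f \<otimes> \<iota> X)) \<cdot> lu (?A \<odot> X)) \<cdot> \<alpha> ?S ?A X"
    using lunit_tensor[of ?A X] by simp
  finally have "(ind_unit M \<cdot> a) \<cdot> lu (?A \<odot> X) = (p \<cdot> (f \<otimes> \<iota> X)) \<cdot> lu (?A \<odot> X)"
    by (rule iso_epi[rotated]) simp_all
  then have "ind_unit M \<cdot> a = p \<cdot> (f \<otimes> \<iota> X)"
    by (rule iso_epi[rotated]) simp_all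
  also have "\<dots> = (b \<cdot> (\<iota> ?B \<otimes> ind_unit M)) \<cdot> (f \<otimes> \<iota> X)"
    by (simp only: ind_act_unit[OF M, folded X])
  also have "\<dots> = (b \<cdot> (f \<otimes> \<iota> (Cod C p))) \<cdot> (\<iota> ?A \<otimes> ind_unit M)" by simp
  finally show ?thesis by (simp only: X)
qed

text \<open>The linear extension of \<open>g\<close> must send the class of b (x) y to b g(y);
  linearity of \<open>g\<close> over \<open>A\<close> says precisely that this respects the
  relation.\<close>

lemma ind_universal:
  assumes M: "left_module C A M" and Y: "left_module C A' Y" and g: "g \<in> hom C (fst M) (fst Y)"
    and lin: "g \<cdot> snd M = (snd Y \<cdot> (f \<otimes> \<iota> (fst Y))) \<cdot> (\<iota> (MObj A) \<otimes> g)"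
  shows "\<exists>!h. h \<in> hom C (Cod C (proj M)) (fst Y) \<and> h \<cdot> ind_act M = snd Y \<cdot> (\<iota> (MObj A') \<otimes> h) \<and> h \<cdot> ind_unit M = g"
proof -
  let ?A = "MObj A" and ?B = "MObj A'" and ?m = "MMul A'" and ?e = "MOne A'" and ?S = "Unit C"
  define X a p b where X: "X = fst M" "a = snd M" "p = proj M" "b = ind_act M"
  define Z c where Z: "Z = fst Y" "c = snd Y"
  note [simp] = A.left_moduleD(1-4)[OF M, folded X] proj_simps[OF M, folded X] ind_act(1-3)[OF M, folded X]
    ind_unit_simps[OF M, folded X] A'.left_moduleD(1-4)[OF Y, folded Z] g[unfolded in_hom, folded X Z]
  have act: "(b \<cdot> (\<iota> ?B \<otimes> p)) \<cdot> \<alpha> ?B ?B X = p \<cdot> (?m \<otimes> \<iota> X)"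
    using ind_act(4)[OF M, folded X] by simp
  note Yas = A'.left_moduleD(5)[OF Y, folded Z] and Yun = A'.left_moduleD(6)[OF Y, folded Z]
  \<comment> \<open>The candidate on representatives, before passing to the quotient.\<close>
  let ?v = "c \<cdot> (\<iota> ?B \<otimes> g)"
  have "?v \<cdot> ((?m \<cdot> (\<iota> ?B \<otimes> f)) \<otimes> \<iota> X) = (c \<cdot> (?m \<otimes> \<iota> Z)) \<cdot> ((\<iota> ?B \<otimes> f) \<otimes> g)" by simp
  also have "\<dots> = (c \<cdot> (\<iota> ?B \<otimes> c) \<cdot> \<alpha> ?B ?B Z) \<cdot> ((\<iota> ?B \<otimes> f) \<otimes> g)" by (simp only: Yas)
  also have "\<dots> = c \<cdot> (\<iota> ?B \<otimes> c) \<cdot> ((\<iota> ?B \<otimes> (f \<otimes> g)) \<cdot> \<alpha> ?B ?A X)"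
    using assoc_nat[of "\<iota> ?B" f g] by simp
  also have "\<dots> = c \<cdot> (\<iota> ?B \<otimes> ((c \<cdot> (f \<otimes> \<iota> Z)) \<cdot> (\<iota> ?A \<otimes> g))) \<cdot> \<alpha> ?B ?A X" by simp
  also have "\<dots> = c \<cdot> (\<iota> ?B \<otimes> (g \<cdot> a)) \<cdot> \<alpha> ?B ?A X" by (simp only: lin[folded X Z])
  also have "\<dots> = ?v \<cdot> ((\<iota> ?B \<otimes> a) \<cdot> \<alpha> ?B ?A X)" by simp
  finally have "\<exists>!h. h \<in> hom C (Cod C p) Z \<and> h \<cdot> p = ?v"
    by (intro proj_induced[OF M, folded X]) simp_all
  then obtain h where h: "h \<in> hom C (Cod C p) Z" "h \<cdot> p = ?v" by blast
  note [simp] = h(1)[unfolded in_hom]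
  have hlin: "h \<cdot> b = c \<cdot> (\<iota> ?B \<otimes> h)"
  proof -
    have "((h \<cdot> b) \<cdot> (\<iota> ?B \<otimes> p)) \<cdot> \<alpha> ?B ?B X = h \<cdot> ((b \<cdot> (\<iota> ?B \<otimes> p)) \<cdot> \<alpha> ?B ?B X)" by simp
    also have "\<dots> = h \<cdot> p \<cdot> (?m \<otimes> \<iota> X)" by (simp only: act)
    also have "\<dots> = (h \<cdot> p) \<cdot> (?m \<otimes> \<iota> X)" by simp
    also have "\<dots> = ?v \<cdot> (?m \<otimes> \<iota> X)" by (simp only: h(2))
    also have "\<dots> = (c \<cdot> (?m \<otimes> \<iota> Z)) \<cdot> ((\<iota> ?B \<otimes> \<iota> ?B) \<otimes> g)" by simp
    also have "\<dots> = (c \<cdot> (\<iota> ?B \<otimes> c) \<cdot> \<alpha> ?B ?B Z) \<cdot> ((\<iota> ?B \<otimes> \<iota> ?B) \<otimes> g)" by (simp only: Yas)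
    also have "\<dots> = c \<cdot> (\<iota> ?B \<otimes> c) \<cdot> (\<alpha> ?B ?B Z \<cdot> ((\<iota> ?B \<otimes> \<iota> ?B) \<otimes> g))" by simp
    also have "\<alpha> ?B ?B Z \<cdot> ((\<iota> ?B \<otimes> \<iota> ?B) \<otimes> g) = (\<iota> ?B \<otimes> (\<iota> ?B \<otimes> g)) \<cdot> \<alpha> ?B ?B X"
      using assoc_nat[of "\<iota> ?B" "\<iota> ?B" g] by simp
    also have "c \<cdot> (\<iota> ?B \<otimes> c) \<cdot> (\<iota> ?B \<otimes> (\<iota> ?B \<otimes> g)) \<cdot> \<alpha> ?B ?B X = c \<cdot> (\<iota> ?B \<otimes> ?v) \<cdot> \<alpha> ?B ?B X" by simp
    also have "\<dots> = c \<cdot> (\<iota> ?B \<otimes> (h \<cdot> p)) \<cdot> \<alpha> ?B ?B X" by (simp only: h(2))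
    also have "\<dots> = ((c \<cdot> (\<iota> ?B \<otimes> h)) \<cdot> (\<iota> ?B \<otimes> p)) \<cdot> \<alpha> ?B ?B X" by simp
    finally have "(h \<cdot> b) \<cdot> (\<iota> ?B \<otimes> p) = (c \<cdot> (\<iota> ?B \<otimes> h)) \<cdot> (\<iota> ?B \<otimes> p)"
      by (rule iso_epi[rotated]) simp_all
    then show ?thesis
      by (rule tensor_proj_epi[OF M, of ?B, folded X, rotated 5]) simp_all
  qed
  have hu: "h \<cdot> ind_unit M = g"
  proof -
    have "(h \<cdot> ind_unit M) \<cdot> lu X = h \<cdot> (ind_unit M \<cdot> lu X)" by simp
    also have "\<dots> = h \<cdot> (p \<cdot> (?e \<otimes> \<iota> X))" by (simp only: ind_unit_lu[OF M, folded X])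
    also have "\<dots> = (h \<cdot> p) \<cdot> (?e \<otimes> \<iota> X)" by simp
    also have "\<dots> = ?v \<cdot> (?e \<otimes> \<iota> X)" by (simp only: h(2))
    also have "\<dots> = (c \<cdot> (?e \<otimes> \<iota> Z)) \<cdot> (\<iota> ?S \<otimes> g)" by simp
    also have "\<dots> = lu Z \<cdot> (\<iota> ?S \<otimes> g)" by (simp only: Yun)
    also have "\<dots> = g \<cdot> lu X" using lunit_nat[of g] by simp
    finally show ?thesis by (rule iso_epi[rotated]) simp_all
  qed
  \<comment> \<open>A linear map with the prescribed value on the unit agrees with \<open>?v\<close>
    on representatives by \<open>ind_act_unit\<close>, and the projection is epi.\<close>
  have uniq: "k = h" if k: "k \<in> hom C (Cod C p) Z" "k \<cdot> b = c \<cdot> (\<iota> ?B \<otimes> k)" "k \<cdot> ind_unit M = g" for k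
  proof -
    note [simp] = k(1)[unfolded in_hom]
    have "k \<cdot> p = k \<cdot> (b \<cdot> (\<iota> ?B \<otimes> ind_unit M))" by (simp only: ind_act_unit[OF M, folded X])
    also have "\<dots> = (k \<cdot> b) \<cdot> (\<iota> ?B \<otimes> ind_unit M)" by simp
    also have "\<dots> = (c \<cdot> (\<iota> ?B \<otimes> k)) \<cdot> (\<iota> ?B \<otimes> ind_unit M)" by (simp only: k(2))
    also have "\<dots> = c \<cdot> (\<iota> ?B \<otimes> (k \<cdot> ind_unit M))" by simp
    also have "\<dots> = ?v" by (simp only: k(3))
    also have "\<dots> = h \<cdot> p" by (simp only: h(2))
    finally show ?thesis by (rule coequalizer_epi[OF proj[OF M, folded X], rotated 4]) simp_all
  qed
  show ?thesis unfolding X[symmetric] Z[symmetric]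
    by (rule ex1I[of _ h]) (use h hlin hu uniq in auto)
qed

text \<open>\<open>left_induction\<close> defines the arrow by a definite description; its existence
  and uniqueness come from the coequalizer, and linearity and naturality of the unit are read off
  representatives.\<close>

lemma ind_map:
  assumes M: "left_module C A M" and N: "left_module C A N" and h: "h \<in> hom C (fst M) (fst N)"
    and lin: "h \<cdot> snd M = snd N \<cdot> (\<iota> (MObj A) \<otimes> h)"
  defines "k \<equiv> fst (snd (on_arr (left_induction C A A' f) (M, h, N)))"
  shows "k \<in> hom C (Cod C (proj M)) (Cod C (proj N))" "k \<cdot> ind_act M = ind_act N \<cdot> (\<iota> (MObj A') \<otimes> k)"
    "k \<cdot> ind_unit M = ind_unit N \<cdot> h"
proof -
  let ?A = "MObj A" and ?B = "MObj A'" and ?m = "MMul A'" and ?e = "MOne A'" and ?S = "Unit C"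
  define X a p b where X: "X = fst M" "a = snd M" "p = proj M" "b = ind_act M"
  define Y c q d where Y: "Y = fst N" "c = snd N" "q = proj N" "d = ind_act N"
  note [simp] = A.left_moduleD(1-4)[OF M, folded X] proj_simps[OF M, folded X] ind_act(1-3)[OF M, folded X]
    ind_unit_simps[OF M, folded X] A.left_moduleD(1-4)[OF N, folded Y] proj_simps[OF N, folded Y] ind_act(1-3)[OF N, folded Y]
    ind_unit_simps[OF N, folded Y] h[unfolded in_hom, folded X Y]
  have actM: "(b \<cdot> (\<iota> ?B \<otimes> p)) \<cdot> \<alpha> ?B ?B X = p \<cdot> (?m \<otimes> \<iota> X)"
    using ind_act(4)[OF M, folded X] by simp
  have actN: "(d \<cdot> (\<iota> ?B \<otimes> q)) \<cdot> \<alpha> ?B ?B Y = q \<cdot> (?m \<otimes> \<iota> Y)"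
    using ind_act(4)[OF N, folded Y] by simp
  let ?v = "q \<cdot> (\<iota> ?B \<otimes> h)"
  have "?v \<cdot> ((?m \<cdot> (\<iota> ?B \<otimes> f)) \<otimes> \<iota> X) = (q \<cdot> ((?m \<cdot> (\<iota> ?B \<otimes> f)) \<otimes> \<iota> Y)) \<cdot> ((\<iota> ?B \<otimes> \<iota> ?A) \<otimes> h)" by simp
  also have "\<dots> = (q \<cdot> ((\<iota> ?B \<otimes> c) \<cdot> \<alpha> ?B ?A Y)) \<cdot> ((\<iota> ?B \<otimes> \<iota> ?A) \<otimes> h)"
    by (simp only: proj_balanced[OF N, folded Y])
  also have "\<dots> = q \<cdot> (\<iota> ?B \<otimes> c) \<cdot> ((\<iota> ?B \<otimes> (\<iota> ?A \<otimes> h)) \<cdot> \<alpha> ?B ?A X)"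
    using assoc_nat[of "\<iota> ?B" "\<iota> ?A" h] by simp
  also have "\<dots> = q \<cdot> (\<iota> ?B \<otimes> (c \<cdot> (\<iota> ?A \<otimes> h))) \<cdot> \<alpha> ?B ?A X" by simp
  also have "\<dots> = q \<cdot> (\<iota> ?B \<otimes> (h \<cdot> a)) \<cdot> \<alpha> ?B ?A X" by (simp only: lin[folded X Y])
  also have "\<dots> = ?v \<cdot> ((\<iota> ?B \<otimes> a) \<cdot> \<alpha> ?B ?A X)" by simp
  finally have "\<exists>!k. k \<in> hom C (Cod C p) (Cod C q) \<and> k \<cdot> p = ?v"
    by (intro proj_induced[OF M, folded X]) simp_all
  from theI'[OF this] have k: "k \<in> hom C (Cod C p) (Cod C q)" "k \<cdot> p = ?v"
    unfolding k_def left_induction_def X Y by simp_all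
  note [simp] = k(1)[unfolded in_hom]
  show "k \<in> hom C (Cod C (proj M)) (Cod C (proj N))" using k by (simp add: X Y)
  have "((k \<cdot> b) \<cdot> (\<iota> ?B \<otimes> p)) \<cdot> \<alpha> ?B ?B X = k \<cdot> ((b \<cdot> (\<iota> ?B \<otimes> p)) \<cdot> \<alpha> ?B ?B X)" by simp
  also have "\<dots> = k \<cdot> p \<cdot> (?m \<otimes> \<iota> X)" by (simp only: actM)
  also have "\<dots> = (k \<cdot> p) \<cdot> (?m \<otimes> \<iota> X)" by simp
  also have "\<dots> = ?v \<cdot> (?m \<otimes> \<iota> X)" by (simp only: k(2))
  also have "\<dots> = (q \<cdot> (?m \<otimes> \<iota> Y)) \<cdot> ((\<iota> ?B \<otimes> \<iota> ?B) \<otimes> h)" by simp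
  also have "\<dots> = ((d \<cdot> (\<iota> ?B \<otimes> q)) \<cdot> \<alpha> ?B ?B Y) \<cdot> ((\<iota> ?B \<otimes> \<iota> ?B) \<otimes> h)" by (simp only: actN)
  also have "\<dots> = (d \<cdot> (\<iota> ?B \<otimes> q)) \<cdot> (\<alpha> ?B ?B Y \<cdot> ((\<iota> ?B \<otimes> \<iota> ?B) \<otimes> h))" by simp
  also have "\<alpha> ?B ?B Y \<cdot> ((\<iota> ?B \<otimes> \<iota> ?B) \<otimes> h) = (\<iota> ?B \<otimes> (\<iota> ?B \<otimes> h)) \<cdot> \<alpha> ?B ?B X"
    using assoc_nat[of "\<iota> ?B" "\<iota> ?B" h] by simp
  also have "(d \<cdot> (\<iota> ?B \<otimes> q)) \<cdot> ((\<iota> ?B \<otimes> (\<iota> ?B \<otimes> h)) \<cdot> \<alpha> ?B ?B X) = d \<cdot> (\<iota> ?B \<otimes> ?v) \<cdot> \<alpha> ?B ?B X" by simp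
  also have "\<dots> = d \<cdot> (\<iota> ?B \<otimes> (k \<cdot> p)) \<cdot> \<alpha> ?B ?B X" by (simp only: k(2))
  also have "\<dots> = ((d \<cdot> (\<iota> ?B \<otimes> k)) \<cdot> (\<iota> ?B \<otimes> p)) \<cdot> \<alpha> ?B ?B X" by simp
  finally have "(k \<cdot> b) \<cdot> (\<iota> ?B \<otimes> p) = (d \<cdot> (\<iota> ?B \<otimes> k)) \<cdot> (\<iota> ?B \<otimes> p)"
    by (rule iso_epi[rotated]) simp_all
  then have "k \<cdot> b = d \<cdot> (\<iota> ?B \<otimes> k)"
    by (rule tensor_proj_epi[OF M, of ?B, folded X, rotated 5]) simp_all
  then show "k \<cdot> ind_act M = ind_act N \<cdot> (\<iota> (MObj A') \<otimes> k)" by (simp only: X Y)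
  have "(k \<cdot> ind_unit M) \<cdot> lu X = k \<cdot> (ind_unit M \<cdot> lu X)" by simp
  also have "\<dots> = k \<cdot> (p \<cdot> (?e \<otimes> \<iota> X))" by (simp only: ind_unit_lu[OF M, folded X])
  also have "\<dots> = (k \<cdot> p) \<cdot> (?e \<otimes> \<iota> X)" by simp
  also have "\<dots> = ?v \<cdot> (?e \<otimes> \<iota> X)" by (simp only: k(2))
  also have "\<dots> = (q \<cdot> (?e \<otimes> \<iota> Y)) \<cdot> (\<iota> ?S \<otimes> h)" by simp
  also have "\<dots> = (ind_unit N \<cdot> lu Y) \<cdot> (\<iota> ?S \<otimes> h)" by (simp only: ind_unit_lu[OF N, folded Y])
  also have "\<dots> = (ind_unit N \<cdot> h) \<cdot> lu X" using lunit_nat[of h] by simp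
  finally show "k \<cdot> ind_unit M = ind_unit N \<cdot> h"
    by (rule iso_epi[rotated]) simp_all
qed

lemma left_induction_simps [simp]: "on_obj (left_induction C A A' f) M = left_ind_obj C A A' f M"
  "fst (on_arr (left_induction C A A' f) x) = left_ind_obj C A A' f (fst x)"
  "snd (snd (on_arr (left_induction C A A' f) x)) = left_ind_obj C A A' f (snd (snd x))"
  by (simp_all add: left_induction_def case_prod_beta)

definition "ind_unit_map M = (M, ind_unit M, left_res_obj C f (left_ind_obj C A A' f M))"

lemma induction_restriction_adjunction:
  assumes K: "category (left_modules C A)" "category (left_modules C A')"
  shows "adjunction (left_modules C A) (left_modules C A') (left_induction C A A' f) (left_restriction C f)
    (\<lambda>M Y h. on_arr (left_restriction C f) h \<cdot>\<^bsub>left_modules C A\<^esub> ind_unit_map M)"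
proof (rule adjunction_from_unit)
  show "is_functor (left_modules C A') (left_modules C A) (left_restriction C f)"
    by (rule left_restriction_functor[OF K])
next
  fix x assume x: "x \<in> Arr (left_modules C A)"
  obtain M h N where x': "x = (M, h, N)" by (cases x)
  have MN: "left_module C A M" "left_module C A N" "h \<in> hom C (fst M) (fst N)" "h \<cdot> snd M = snd N \<cdot> (\<iota> (MObj A) \<otimes> h)"
    using x by (simp_all add: x')
  note k = ind_map[OF MN]
  show "on_arr (left_induction C A A' f) x \<in> hom (left_modules C A')
      (on_obj (left_induction C A A' f) (Dom (left_modules C A) x)) (on_obj (left_induction C A A' f) (Cod (left_modules C A) x))"
    using k MN left_module_ind by (simp add: x')
  show "on_arr (left_restriction C f) (on_arr (left_induction C A A' f) x) \<cdot>\<^bsub>left_modules C A\<^esub> ind_unit_map (Dom (left_modules C A) x) =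
      ind_unit_map (Cod (left_modules C A) x) \<cdot>\<^bsub>left_modules C A\<^esub> x"
    using k(3) by (simp add: x' ind_unit_map_def)
next
  fix M assume "M \<in> Obj (left_modules C A)"
  then have M: "left_module C A M" by simp
  then show "ind_unit_map M \<in> hom (left_modules C A) M (on_obj (left_restriction C f) (on_obj (left_induction C A A' f) M))"
    using ind_unit_linear[OF M] left_module_res[OF left_module_ind[OF M]] by (simp add: ind_unit_map_def)
next
  fix M Y g assume "M \<in> Obj (left_modules C A)" "Y \<in> Obj (left_modules C A')"
    and g: "g \<in> hom (left_modules C A) M (on_obj (left_restriction C f) Y)"
  then have M: "left_module C A M" and Y: "left_module C A' Y" by simp_all
  obtain g' where g': "g = (M, g', left_res_obj C f Y)" using g by (cases g) auto
  have "\<exists>!h. h \<in> hom C (Cod C (proj M)) (fst Y) \<and> h \<cdot> ind_act M = snd Y \<cdot> (\<iota> (MObj A') \<otimes> h) \<and> h \<cdot> ind_unit M = g'"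
    using g by (intro ind_universal[OF M Y]) (simp_all add: g')
  then obtain h where h: "h \<in> hom C (Cod C (proj M)) (fst Y)" "h \<cdot> ind_act M = snd Y \<cdot> (\<iota> (MObj A') \<otimes> h)" "h \<cdot> ind_unit M = g'"
    and hu: "\<And>k. k \<in> hom C (Cod C (proj M)) (fst Y) \<Longrightarrow> k \<cdot> ind_act M = snd Y \<cdot> (\<iota> (MObj A') \<otimes> k) \<Longrightarrow> k \<cdot> ind_unit M = g' \<Longrightarrow> k = h"
    by blast
  show "\<exists>!h. h \<in> hom (left_modules C A') (on_obj (left_induction C A A' f) M) Y \<and>
      on_arr (left_restriction C f) h \<cdot>\<^bsub>left_modules C A\<^esub> ind_unit_map M = g"
  proof (rule ex1I[of _ "(left_ind_obj C A A' f M, h, Y)"])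
    show "(left_ind_obj C A A' f M, h, Y) \<in> hom (left_modules C A') (on_obj (left_induction C A A' f) M) Y \<and>
      on_arr (left_restriction C f) (left_ind_obj C A A' f M, h, Y) \<cdot>\<^bsub>left_modules C A\<^esub> ind_unit_map M = g"
      using h left_module_ind[OF M] Y by (simp add: ind_unit_map_def g')
  next
    fix k assume k: "k \<in> hom (left_modules C A') (on_obj (left_induction C A A' f) M) Y \<and>
      on_arr (left_restriction C f) k \<cdot>\<^bsub>left_modules C A\<^esub> ind_unit_map M = g"
    then obtain k' where k': "k = (left_ind_obj C A A' f M, k', Y)" by (cases k) auto
    have "k' = h"
      using k by (intro hu) (simp_all add: ind_unit_map_def g' k')
    then show "k = (left_ind_obj C A A' f M, h, Y)" by (simp add: k')
  qed
qed (use K left_module_ind in simp_all)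

text \<open>Linearity of [f, Z] is the transposition lemma in disguise: [f, Z] is the
  \<open>A\<close>-linear transpose of evaluation at the unit of \<open>A'\<close> on the restricted
  coinduced module.\<close>

lemma ihom_pre_coind:
  assumes Z [simp]: "Z \<in> Obj C"
  shows "(left_res_obj C f (coind A' Z), ihom_pre f Z, coind A Z) \<in> Arr (left_modules C A)"
proof -
  have N: "left_module C A (left_res_obj C f (coind A' Z))"
    by (intro left_module_res A'.left_module_coind Z)
  have "(coind_counit A' Z \<cdot> coact A' Z) \<cdot> (f \<otimes> \<iota> (ihom (MObj A') Z)) = ev (MObj A) Z \<cdot> (\<iota> (MObj A) \<otimes> ihom_pre f Z)"
    unfolding A'.counit_coact[OF Z] using ev_ihom_pre0[of f Z "MObj A"] by simp
  then have e: "ev (MObj A) Z \<cdot> (\<iota> (MObj A) \<otimes> ihom_pre f Z) = coind_counit A' Z \<cdot> snd (left_res_obj C f (coind A' Z))"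
    by simp
  show ?thesis
    using A.coind_transpose(2)[OF N _ Z _ e] N A.left_module_coind[OF Z] by simp
qed

section \<open>The Quillen equivalence for left modules\<close>

context
  assumes cofibrant: "cofibrant C (MObj A)" "cofibrant C (MObj A')" and f_weq: "f \<in> Weq C"
    and models: "model_category u (left_modules C A)" "model_category u (left_modules C A')"
begin

text \<open>Restriction leaves underlying arrows unchanged, hence preserves fibrations and weak
  equivalences.\<close>

lemma induction_left_quillen:
  "left_quillen u (left_modules C A) (left_modules C A') (left_induction C A A' f) (left_restriction C f)
    (\<lambda>M Y h. on_arr (left_restriction C f) h \<cdot>\<^bsub>left_modules C A\<^esub> ind_unit_map M)"
proof -
  interpret K: model_structure u "left_modules C A" using infinite_universe models by unfold_locales
  interpret K': model_structure u "left_modules C A'" using infinite_universe models by unfold_locales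
  note adj = induction_restriction_adjunction[OF K.category_axioms K'.category_axioms]
  have arr: "on_arr (left_restriction C f) p \<in> Arr (left_modules C A)" if "p \<in> Arr (left_modules C A')" for p
    using functorD(4)[OF adjunctionD(2)[OF adj] that] .
  show ?thesis
  proof (rule left_quillen_by_right_adjoint[OF infinite_universe models adj])
    show "on_arr (left_restriction C f) p \<in> Fib (left_modules C A)" if "p \<in> Fib (left_modules C A')" for p
      using that arr[of p] unfolding left_modules_simps(8) by simp
    show "on_arr (left_restriction C f) p \<in> Weq (left_modules C A)"
      if "p \<in> Fib (left_modules C A')" "p \<in> Weq (left_modules C A')" for p
      using that arr[of p] unfolding left_modules_simps(7,8) by simp
  qed
qed

text \<open>Instance of \<open>mate_weq\<close> with \<open>V\<close> the forgetful functor and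
  \<open>G\<close> induction followed by the forgetful functor; \<gamma> is [f, Z] as a module map
  from the restriction of [A', Z] to [A, Z].\<close>

lemma ind_unit_weq:
  assumes cof: "cofibrant (left_modules C A) M"
  shows "ind_unit M \<in> Weq C"
proof (rule mate_weq[OF infinite_universe A.forget_left_quillen[OF cofibrant(1) models(1)]
      left_quillen_comp[OF induction_left_quillen A'.forget_left_quillen[OF cofibrant(2) models(2)]] cof,
      where \<gamma> = "\<lambda>Z. (left_res_obj C f (coind A' Z), ihom_pre f Z, coind A Z)"])
  interpret K: model_structure u "left_modules C A" using infinite_universe models by unfold_locales
  have M: "left_module C A M" using K.cofibrant_obj[OF cof] by simp
  then show "ind_unit M \<in> hom C (on_obj left_forget M) (on_obj (comp_fctr left_forget (left_induction C A A' f)) M)"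
    by (simp add: comp_fctr_def)
  show "(left_res_obj C f (coind A' Z), ihom_pre f Z, coind A Z)
      \<in> hom (left_modules C A) (on_obj (comp_fctr (left_restriction C f) (coind_fctr A')) Z) (on_obj (coind_fctr A) Z)"
    if "Z \<in> Obj C" for Z
    using ihom_pre_coind[OF that] by (simp add: comp_fctr_def)
  show "(left_res_obj C f (coind A' Z), ihom_pre f Z, coind A Z) \<in> Weq (left_modules C A)" if Z: "fibrant C Z" for Z
    using ihom_pre_coind[OF fibrant_obj[OF Z]] ihom_pre_weq[OF f_weq _ _ Z] cofibrant
    unfolding left_modules_simps(7) by simp
  fix Z v assume Z [simp]: "Z \<in> Obj C"
    and v: "v \<in> hom C (on_obj (comp_fctr left_forget (left_induction C A A' f)) M) Z"
  let ?N = "left_ind_obj C A A' f M"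
  note N = left_module_ind[OF M]
  note [simp] = v[unfolded in_hom comp_fctr_def, simplified] A.left_moduleD(1-4)[OF M] ind_act(1-3)[OF M]
    ind_unit_simps[OF M] proj_simps[OF M]
  let ?t = "coind_map A' ?N Z v"
  have t [simp]: "?t \<in> Arr C" "Dom C ?t = Cod C (proj M)" "Cod C ?t = ihom (MObj A') Z"
    by (simp_all add: coind_map_def)
  \<comment> \<open>The mate identity. After evaluation it reduces to linearity of the unit: both
    sides send y to the map a |-> v(unit(a y)).\<close>
  have "coind_map A M Z (v \<cdot> ind_unit M) = ihom_pre f Z \<cdot> (?t \<cdot> ind_unit M)"
  proof (rule ev_inject[of "MObj A" Z])
    have "ev (MObj A) Z \<cdot> (\<iota> (MObj A) \<otimes> (ihom_pre f Z \<cdot> (?t \<cdot> ind_unit M))) =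
      (ev (MObj A') Z \<cdot> (\<iota> (MObj A') \<otimes> ?t)) \<cdot> (f \<otimes> ind_unit M)"
      by (simp add: ev_ihom_pre)
    also have "\<dots> = (v \<cdot> ind_act M) \<cdot> (f \<otimes> ind_unit M)"
      by (simp add: coind_map_def cur)
    also have "\<dots> = v \<cdot> (ind_unit M \<cdot> snd M)"
      using ind_unit_linear[OF M] by simp
    finally show "ev (MObj A) Z \<cdot> (\<iota> (MObj A) \<otimes> coind_map A M Z (v \<cdot> ind_unit M)) =
      ev (MObj A) Z \<cdot> (\<iota> (MObj A) \<otimes> (ihom_pre f Z \<cdot> (?t \<cdot> ind_unit M)))"
      by (simp add: coind_map_def cur)
  qed (simp_all add: coind_map_def)
  then show "(M, coind_map A M Z (v \<cdot> ind_unit M), coind A Z) =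
    (left_res_obj C f (coind A' Z), ihom_pre f Z, coind A Z) \<cdot>\<^bsub>left_modules C A\<^esub>
    (on_arr (left_restriction C f) (on_obj (left_induction C A A' f) M,
      coind_map A' (on_obj (left_induction C A A' f) M) Z v, coind A' Z) \<cdot>\<^bsub>left_modules C A\<^esub> ind_unit_map M)"
    by (simp add: ind_unit_map_def)
qed

text \<open>The adjoint of \<open>h\<close> has underlying arrow \<open>h\<close> after the unit, so
  two-of-three in \<open>C\<close> gives both directions once the unit is a weak
  equivalence.\<close>

theorem left_quillen_equivalence:
  "quillen_equivalence u (left_modules C A) (left_modules C A') (left_induction C A A' f) (left_restriction C f)"
  unfolding quillen_equivalence_def
proof (intro exI[of _ "\<lambda>M Y h. on_arr (left_restriction C f) h \<cdot>\<^bsub>left_modules C A\<^esub> ind_unit_map M"]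
    conjI ballI impI induction_left_quillen)
  fix M Y h assume M: "M \<in> Obj (left_modules C A)" and Y: "Y \<in> Obj (left_modules C A')"
    and c: "cofibrant (left_modules C A) M \<and> fibrant (left_modules C A') Y"
    and h: "h \<in> hom (left_modules C A') (on_obj (left_induction C A A' f) M) Y"
  have M': "left_module C A M" using M by simp
  note [simp] = ind_unit_simps[OF M'] proj_simps[OF M']
  have w: "ind_unit M \<in> Weq C" using ind_unit_weq c by blast
  have "adjunction (left_modules C A) (left_modules C A') (left_induction C A A' f) (left_restriction C f)
      (\<lambda>M Y h. on_arr (left_restriction C f) h \<cdot>\<^bsub>left_modules C A\<^esub> ind_unit_map M)"
    using induction_left_quillen by (simp only: left_quillen_def)
  then have "on_arr (left_restriction C f) h \<cdot>\<^bsub>left_modules C A\<^esub> ind_unit_map M \<in> Arr (left_modules C A)"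
    using adj_hom[OF _ M Y h] unfolding in_hom by blast
  moreover have "fst (snd h) \<in> hom C (Cod C (proj M)) (fst Y)" using h by auto
  then have "fst (snd h) \<cdot> ind_unit M \<in> Weq C \<longleftrightarrow> fst (snd h) \<in> Weq C"
    using weq_comp[OF w, of "fst (snd h)"] weq_cancel_right[OF w, of "fst (snd h)"] by auto
  moreover have "h \<in> Arr (left_modules C A')" using h unfolding in_hom by blast
  ultimately show "h \<in> Weq (left_modules C A') \<longleftrightarrow>
      on_arr (left_restriction C f) h \<cdot>\<^bsub>left_modules C A\<^esub> ind_unit_map M \<in> Weq (left_modules C A)"
    unfolding left_modules_simps(7) by (simp add: ind_unit_map_def)
qed

end

end

section \<open>Right modules as left modules over the reversed monoidal category\<close>

text \<open>Reversing the factors turns an associator around, so the inverse with arguments in the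
  opposite order is taken, and the two unit maps trade places. Everything that does not mention the
  product is literally unchanged, which keeps the model structure fixed.\<close>

definition reverse :: "('o, 'm, 'z) monoidal_model_cat_scheme \<Rightarrow> ('o, 'm, 'z) monoidal_model_cat_scheme" where
  "reverse C = C\<lparr>TensO := \<lambda>X Y. Y \<odot>\<^bsub>C\<^esub> X, TensA := \<lambda>f g. g \<otimes>\<^bsub>C\<^esub> f,
    Assoc := \<lambda>X Y Z. category.inverse_arr C (Assoc C Z Y X), LUnit := RUnit C, RUnit := LUnit C\<rparr>"

lemma reverse_simps [simp]:
  "Obj (reverse C) = Obj C" "Arr (reverse C) = Arr C" "Dom (reverse C) = Dom C" "Cod (reverse C) = Cod C"
  "Ident (reverse C) = Ident C" "Comp (reverse C) = Comp C"
  "Weq (reverse C) = Weq C" "Cof (reverse C) = Cof C" "Fib (reverse C) = Fib C"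
  "X \<odot>\<^bsub>reverse C\<^esub> Y = Y \<odot>\<^bsub>C\<^esub> X" "f \<otimes>\<^bsub>reverse C\<^esub> g = g \<otimes>\<^bsub>C\<^esub> f" "Unit (reverse C) = Unit C"
  "Assoc (reverse C) X Y Z = category.inverse_arr C (Assoc C Z Y X)"
  "LUnit (reverse C) = RUnit C" "RUnit (reverse C) = LUnit C" "QFun (reverse C) = QFun C" "QMap (reverse C) = QMap C"
  by (simp_all add: reverse_def)

lemma hom_reverse [simp]: "hom (reverse C) = hom C"
  by (simp add: hom_def fun_eq_iff)

lemma category_reverse [simp]: "category (reverse C) = category C"
  by (simp only: category_def reverse_simps hom_reverse)

lemma constructions_reverse [simp]:
  "is_iso (reverse C) = is_iso C" "op_cat (reverse C) = op_cat C" "arrow_cat (reverse C) = arrow_cat C"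
  "prod_cat (reverse C) D = prod_cat C D" "prod_cat K (reverse C) = prod_cat K C"
  "fix_fst (reverse C) = fix_fst C" "fix_snd (reverse C) = fix_snd C"
  by (simp_all only: is_iso_def op_cat_def arrow_cat_def prod_cat_def fix_fst_def fix_snd_def
      reverse_simps hom_reverse fun_eq_iff simp_thms)

lemma functor_reverse [simp]:
  "is_functor J (reverse C) = is_functor J C" "is_functor (reverse C) J = is_functor C J"
  by (simp_all only: is_functor_def reverse_simps hom_reverse category_reverse fun_eq_iff simp_thms)

lemma limits_reverse [simp]:
  "is_cocone J (reverse C) = is_cocone J C" "is_colimit J (reverse C) = is_colimit J C"
  "is_cone J (reverse C) = is_cone J C" "is_limit J (reverse C) = is_limit J C"
  "is_initial (reverse C) = is_initial C" "is_terminal (reverse C) = is_terminal C"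
  "is_pushout (reverse C) = is_pushout C" "is_coequalizer (reverse C) = is_coequalizer C"
  by (simp_all only: is_cocone_def is_colimit_def is_cone_def is_limit_def is_initial_def is_terminal_def
      is_pushout_def is_coequalizer_def reverse_simps hom_reverse fun_eq_iff simp_thms)

lemma adjunction_reverse [simp]:
  "adjunction (reverse C) (reverse C) = adjunction C C" "nat_transf (reverse C) (reverse C) = nat_transf C C"
  by (simp_all only: adjunction_def nat_transf_def reverse_simps hom_reverse functor_reverse fun_eq_iff simp_thms)

lemma model_category_reverse [simp]:
  "model_category u (reverse C) = model_category u C" "cofibrant (reverse C) = cofibrant C"
  "functorial_cofibrant_replacement (reverse C) = functorial_cofibrant_replacement C"
  by (simp_all only: model_category_def bicomplete_def wide_subcategory_def retract_of_def lifts_def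
      functorial_factorization_def cofibrant_def functorial_cofibrant_replacement_def
      reverse_simps hom_reverse category_reverse constructions_reverse functor_reverse limits_reverse
      adjunction_reverse fun_eq_iff simp_thms)

context monoidal_category
begin

text \<open>Naturality and the pentagon for inverse associators are the old laws after cancelling
  isomorphisms; the triangle exchanges its two unit maps.\<close>

lemma monoidal_category_reverse: "monoidal_category (reverse C)"
proof (intro monoidal_category.intro monoidal_category_axioms.intro)
  show "category (reverse C)" using category_axioms by simp
  show "is_functor (prod_cat (reverse C) (reverse C)) (reverse C) (tensor_fctr (reverse C))"
    using tensor_functor unfolding is_functor_def
    by (auto simp: tensor_fctr_def prod_cat_def)
  show "Unit (reverse C) \<in> Obj (reverse C)" by simp
next
  fix X Y Z assume [simp]: "X \<in> Obj (reverse C)" "Y \<in> Obj (reverse C)" "Z \<in> Obj (reverse C)"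
  then have [simp]: "X \<in> Obj C" "Y \<in> Obj C" "Z \<in> Obj C" by simp_all
  show "Assoc (reverse C) X Y Z \<in> hom (reverse C) ((X \<odot>\<^bsub>reverse C\<^esub> Y) \<odot>\<^bsub>reverse C\<^esub> Z) (X \<odot>\<^bsub>reverse C\<^esub> (Y \<odot>\<^bsub>reverse C\<^esub> Z)) \<and>
      is_iso (reverse C) (Assoc (reverse C) X Y Z)" by simp
next
  fix f g h X Y Z X' Y' Z'
  assume "f \<in> hom (reverse C) X X'" "g \<in> hom (reverse C) Y Y'" "h \<in> hom (reverse C) Z Z'"
  then have [simp]: "f \<in> Arr C" "g \<in> Arr C" "h \<in> Arr C"
    "X = Dom C f" "Y = Dom C g" "Z = Dom C h" "X' = Cod C f" "Y' = Cod C g" "Z' = Cod C h" by auto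
  have "inverse_arr (\<alpha> Z' Y' X') \<cdot> (h \<otimes> (g \<otimes> f)) = ((h \<otimes> g) \<otimes> f) \<cdot> inverse_arr (\<alpha> Z Y X)"
  proof (rule iso_epi[of "\<alpha> Z Y X"])
    have "(inverse_arr (\<alpha> Z' Y' X') \<cdot> (h \<otimes> (g \<otimes> f))) \<cdot> \<alpha> Z Y X = inverse_arr (\<alpha> Z' Y' X') \<cdot> ((h \<otimes> (g \<otimes> f)) \<cdot> \<alpha> Z Y X)"
      by simp
    also have "(h \<otimes> (g \<otimes> f)) \<cdot> \<alpha> Z Y X = \<alpha> Z' Y' X' \<cdot> ((h \<otimes> g) \<otimes> f)"
      using assoc_nat[of h g f] by simp
    finally show "(inverse_arr (\<alpha> Z' Y' X') \<cdot> (h \<otimes> (g \<otimes> f))) \<cdot> \<alpha> Z Y X = (((h \<otimes> g) \<otimes> f) \<cdot> inverse_arr (\<alpha> Z Y X)) \<cdot> \<alpha> Z Y X"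
      by simp
  qed simp_all
  then show "Assoc (reverse C) X' Y' Z' \<cdot>\<^bsub>reverse C\<^esub> ((f \<otimes>\<^bsub>reverse C\<^esub> g) \<otimes>\<^bsub>reverse C\<^esub> h) =
      (f \<otimes>\<^bsub>reverse C\<^esub> (g \<otimes>\<^bsub>reverse C\<^esub> h)) \<cdot>\<^bsub>reverse C\<^esub> Assoc (reverse C) X Y Z" by simp
next
  fix W X Y Z assume "W \<in> Obj (reverse C)" "X \<in> Obj (reverse C)" "Y \<in> Obj (reverse C)" "Z \<in> Obj (reverse C)"
  then have [simp]: "W \<in> Obj C" "X \<in> Obj C" "Y \<in> Obj C" "Z \<in> Obj C" by simp_all
  note pent = pentagon[of Z Y X W, simplified]
  have "inverse_arr (\<alpha> (Z \<odot> Y) X W) \<cdot> inverse_arr (\<alpha> Z Y (X \<odot> W)) =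
    (inverse_arr (\<alpha> Z Y X) \<otimes> \<iota> W) \<cdot> (inverse_arr (\<alpha> Z (Y \<odot> X) W) \<cdot> (\<iota> Z \<otimes> inverse_arr (\<alpha> Y X W)))"
  proof (rule iso_epi[of "\<alpha> Z Y (X \<odot> W) \<cdot> \<alpha> (Z \<odot> Y) X W"])
    \<comment> \<open>The original pentagon turns the second factor into the composite that the
      first one inverts.\<close>
    have "((inverse_arr (\<alpha> Z Y X) \<otimes> \<iota> W) \<cdot> (inverse_arr (\<alpha> Z (Y \<odot> X) W) \<cdot> (\<iota> Z \<otimes> inverse_arr (\<alpha> Y X W)))) \<cdot>
        (\<alpha> Z Y (X \<odot> W) \<cdot> \<alpha> (Z \<odot> Y) X W) = \<iota> (((Z \<odot> Y) \<odot> X) \<odot> W)"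
      unfolding pent by simp
    then show "(inverse_arr (\<alpha> (Z \<odot> Y) X W) \<cdot> inverse_arr (\<alpha> Z Y (X \<odot> W))) \<cdot> (\<alpha> Z Y (X \<odot> W) \<cdot> \<alpha> (Z \<odot> Y) X W) =
      ((inverse_arr (\<alpha> Z Y X) \<otimes> \<iota> W) \<cdot> (inverse_arr (\<alpha> Z (Y \<odot> X) W) \<cdot> (\<iota> Z \<otimes> inverse_arr (\<alpha> Y X W)))) \<cdot>
        (\<alpha> Z Y (X \<odot> W) \<cdot> \<alpha> (Z \<odot> Y) X W)"
      by (simp only:) simp
  qed (simp_all add: iso_comp)
  then show "Assoc (reverse C) W X (Y \<odot>\<^bsub>reverse C\<^esub> Z) \<cdot>\<^bsub>reverse C\<^esub> Assoc (reverse C) (W \<odot>\<^bsub>reverse C\<^esub> X) Y Z =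
      (Ident (reverse C) W \<otimes>\<^bsub>reverse C\<^esub> Assoc (reverse C) X Y Z) \<cdot>\<^bsub>reverse C\<^esub>
      (Assoc (reverse C) W (X \<odot>\<^bsub>reverse C\<^esub> Y) Z \<cdot>\<^bsub>reverse C\<^esub> (Assoc (reverse C) W X Y \<otimes>\<^bsub>reverse C\<^esub> Ident (reverse C) Z))"
    by simp
next
  fix X Y assume "X \<in> Obj (reverse C)" "Y \<in> Obj (reverse C)"
  then have [simp]: "X \<in> Obj C" "Y \<in> Obj C" by simp_all
  have "(ru Y \<otimes> \<iota> X) \<cdot> inverse_arr (\<alpha> Y (Unit C) X) = \<iota> Y \<otimes> lu X"
    unfolding triangle[of Y X, simplified, symmetric] by simp
  then show "(Ident (reverse C) X \<otimes>\<^bsub>reverse C\<^esub> LUnit (reverse C) Y) \<cdot>\<^bsub>reverse C\<^esub> Assoc (reverse C) X (Unit (reverse C)) Y =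
      RUnit (reverse C) X \<otimes>\<^bsub>reverse C\<^esub> Ident (reverse C) Y" by simp
qed (use lunit_nat runit_nat in auto)

text \<open>The associativity laws differ by moving an associator to the other side. When the typing
  conditions fail, neither predicate holds.\<close>

lemma left_module_reverse:
  assumes A: "monoid_in C A"
  shows "left_module (reverse C) A M \<longleftrightarrow> right_module C A M"
proof (cases "fst M \<in> Obj C \<and> snd M \<in> hom C (fst M \<odot> MObj A) (fst M)")
  case True
  obtain X a where M: "M = (X, a)" by (cases M)
  let ?A = "MObj A"
  have [simp]: "X \<in> Obj C" "a \<in> Arr C" "Dom C a = X \<odot> ?A" "Cod C a = X"
    "?A \<in> Obj C" "MMul A \<in> Arr C" "Dom C (MMul A) = ?A \<odot> ?A" "Cod C (MMul A) = ?A"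
    using True A by (auto simp: M monoid_in_def)
  have "a \<cdot> (\<iota> X \<otimes> MMul A) = a \<cdot> (a \<otimes> \<iota> ?A) \<cdot> inverse_arr (\<alpha> X ?A ?A) \<longleftrightarrow>
    a \<cdot> (a \<otimes> \<iota> ?A) = a \<cdot> (\<iota> X \<otimes> MMul A) \<cdot> \<alpha> X ?A ?A"
  proof
    assume e: "a \<cdot> (\<iota> X \<otimes> MMul A) = a \<cdot> (a \<otimes> \<iota> ?A) \<cdot> inverse_arr (\<alpha> X ?A ?A)"
    have "(a \<cdot> (\<iota> X \<otimes> MMul A)) \<cdot> \<alpha> X ?A ?A = a \<cdot> (a \<otimes> \<iota> ?A)" unfolding e by simp
    then show "a \<cdot> (a \<otimes> \<iota> ?A) = a \<cdot> (\<iota> X \<otimes> MMul A) \<cdot> \<alpha> X ?A ?A" by simp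
  next
    assume e: "a \<cdot> (a \<otimes> \<iota> ?A) = a \<cdot> (\<iota> X \<otimes> MMul A) \<cdot> \<alpha> X ?A ?A"
    have "(a \<cdot> (a \<otimes> \<iota> ?A)) \<cdot> inverse_arr (\<alpha> X ?A ?A) = a \<cdot> (\<iota> X \<otimes> MMul A)" unfolding e by simp
    then show "a \<cdot> (\<iota> X \<otimes> MMul A) = a \<cdot> (a \<otimes> \<iota> ?A) \<cdot> inverse_arr (\<alpha> X ?A ?A)" by simp
  qed
  then show ?thesis by (simp add: left_module_def right_module_def M)
next
  case False
  then show ?thesis by (auto simp: left_module_def right_module_def)
qed

text \<open>A literal equality of records, so the hypotheses and results on model structures
  transfer by rewriting.\<close>

lemma left_modules_reverse:
  assumes A: "monoid_in C A"
  shows "left_modules (reverse C) A = right_modules C A"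
proof -
  have "left_module (reverse C) A = right_module C A"
    using left_module_reverse[OF A] by (rule ext)
  then have "left_mod_cat (reverse C) A = right_mod_cat C A"
    unfolding left_mod_cat_def right_mod_cat_def by (simp only: reverse_simps hom_reverse)
  then show ?thesis
    by (simp add: left_modules_def right_modules_def module_model_def)
qed

lemma monoid_in_reverse:
  assumes A: "monoid_in C A"
  shows "monoid_in (reverse C) A"
proof -
  let ?A = "MObj A" and ?m = "MMul A"
  have [simp]: "?A \<in> Obj C" "?m \<in> Arr C" "Dom C ?m = ?A \<odot> ?A" "Cod C ?m = ?A"
    and e: "?m \<cdot> (?m \<otimes> \<iota> ?A) = ?m \<cdot> (\<iota> ?A \<otimes> ?m) \<cdot> \<alpha> ?A ?A ?A"
    using A by (auto simp: monoid_in_def)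
  have "(?m \<cdot> (?m \<otimes> \<iota> ?A)) \<cdot> inverse_arr (\<alpha> ?A ?A ?A) = ?m \<cdot> (\<iota> ?A \<otimes> ?m)" unfolding e by simp
  then show ?thesis using A by (simp add: monoid_in_def)
qed

lemma monoid_hom_in_reverse: "monoid_hom_in C A A' f \<Longrightarrow> monoid_hom_in (reverse C) A A' f"
  by (simp add: monoid_hom_in_def)

text \<open>Reversal exchanges the two parallel arrows and moves the associator from one to the
  other. Composing both with an isomorphism \<open>e\<close> leaves the coequalizers the
  same.\<close>

lemma coequalizer_swap:
  assumes e: "is_iso C e" and st: "Dom C s = Cod C e" "Dom C t = Cod C e" and p: "is_coequalizer C s t p"
  shows "is_coequalizer C (t \<cdot> e) (s \<cdot> e) p"
proof -
  note [simp] = e st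
  have [simp]: "s \<in> Arr C" "t \<in> Arr C" "Cod C s = Cod C t" "p \<in> Arr C" "Dom C p = Cod C t"
    and ps: "p \<cdot> s = p \<cdot> t"
    using p unfolding is_coequalizer_def by auto
  show ?thesis
  proof (rule is_coequalizerI[where L = "Cod C p"])
    have "(p \<cdot> t) \<cdot> e = (p \<cdot> s) \<cdot> e" by (simp only: ps)
    then show "p \<cdot> (t \<cdot> e) = p \<cdot> (s \<cdot> e)" by simp
  next
    fix Z v assume v: "v \<in> hom C (Cod C (t \<cdot> e)) Z" and ve: "v \<cdot> (t \<cdot> e) = v \<cdot> (s \<cdot> e)"
    have [simp]: "v \<in> Arr C" "Dom C v = Cod C t" using v by auto
    have "(v \<cdot> s) \<cdot> e = (v \<cdot> t) \<cdot> e" using ve by simp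
    then have "v \<cdot> s = v \<cdot> t" by (rule iso_epi[rotated]) simp_all
    moreover have "v \<in> hom C (Cod C s) Z" using v by simp
    ultimately show "\<exists>!h. h \<in> hom C (Cod C p) Z \<and> h \<cdot> p = v"
      by (intro coequalizer_induced[OF p])
  qed simp_all
qed

context
  fixes A A' :: "('o, 'm) mon" and f :: 'm
  assumes A: "monoid_in C A" and A': "monoid_in C A'" and f: "monoid_hom_in C A A' f"
begin

text \<open>The projections are arbitrary choices, yet equal on the nose: the two predicates under
  \<open>SOME\<close> coincide, hence so do the chosen arrows.\<close>

lemma ind_proj_reverse:
  assumes M: "right_module C A M"
  shows "left_ind_proj (reverse C) A A' f M = right_ind_proj C A A' f M"
proof -
  obtain X a where M': "M = (X, a)" by (cases M)
  let ?A = "MObj A" and ?B = "MObj A'"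
  have [simp]: "X \<in> Obj C" "a \<in> Arr C" "Dom C a = X \<odot> ?A" "Cod C a = X"
    "?A \<in> Obj C" "?B \<in> Obj C" "MMul A' \<in> Arr C" "Dom C (MMul A') = ?B \<odot> ?B" "Cod C (MMul A') = ?B"
    "f \<in> Arr C" "Dom C f = ?A" "Cod C f = ?B"
    using M A A' f by (auto simp: M' right_module_def monoid_in_def monoid_hom_in_def)
  let ?s = "a \<otimes> \<iota> ?B" and ?t = "\<iota> X \<otimes> (MMul A' \<cdot> (f \<otimes> \<iota> ?B))" and ?e = "\<alpha> X ?A ?B"
  have "is_coequalizer C ?t (?s \<cdot> inverse_arr ?e) p \<longleftrightarrow> is_coequalizer C ?s (?t \<cdot> ?e) p" for p
    using coequalizer_swap[of ?e ?t "?s \<cdot> inverse_arr ?e" p] coequalizer_swap[of "inverse_arr ?e" ?s "?t \<cdot> ?e" p]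
    by auto
  then have "is_coequalizer C ?t (?s \<cdot> inverse_arr ?e) = is_coequalizer C ?s (?t \<cdot> ?e)"
    by (rule ext)
  then show ?thesis
    by (simp add: left_ind_proj_def right_ind_proj_def rel_tensor_proj_def M' right_res_obj_def left_res_obj_def)
qed

text \<open>Likewise for the action: the conditions under \<open>THE\<close> agree after moving an
  associator across. The typing of the projection is a hypothesis, to be supplied from the reversed
  category.\<close>

lemma ind_obj_reverse:
  assumes M: "right_module C A M"
    and p: "right_ind_proj C A A' f M \<in> Arr C" "Dom C (right_ind_proj C A A' f M) = fst M \<odot> MObj A'"
  shows "left_ind_obj (reverse C) A A' f M = right_ind_obj C A A' f M"
proof -
  obtain X a where M': "M = (X, a)" by (cases M)
  let ?B = "MObj A'"
  define q where "q = right_ind_proj C A A' f M"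
  have [simp]: "X \<in> Obj C" "?B \<in> Obj C" "MMul A' \<in> Arr C" "Dom C (MMul A') = ?B \<odot> ?B" "Cod C (MMul A') = ?B"
    "q \<in> Arr C" "Dom C q = X \<odot> ?B"
    using M A' p by (auto simp: M' right_module_def monoid_in_def q_def)
  have "b \<cdot> (q \<otimes> \<iota> ?B) \<cdot> inverse_arr (\<alpha> X ?B ?B) = q \<cdot> (\<iota> X \<otimes> MMul A') \<longleftrightarrow>
    b \<cdot> (q \<otimes> \<iota> ?B) = q \<cdot> (\<iota> X \<otimes> MMul A') \<cdot> \<alpha> X ?B ?B" if "b \<in> hom C (Cod C q \<odot> ?B) (Cod C q)" for b
  proof
    assume e: "b \<cdot> (q \<otimes> \<iota> ?B) \<cdot> inverse_arr (\<alpha> X ?B ?B) = q \<cdot> (\<iota> X \<otimes> MMul A')"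
    have "(q \<cdot> (\<iota> X \<otimes> MMul A')) \<cdot> \<alpha> X ?B ?B = b \<cdot> (q \<otimes> \<iota> ?B)" unfolding e[symmetric] using that by simp
    then show "b \<cdot> (q \<otimes> \<iota> ?B) = q \<cdot> (\<iota> X \<otimes> MMul A') \<cdot> \<alpha> X ?B ?B" by simp
  next
    assume e: "b \<cdot> (q \<otimes> \<iota> ?B) = q \<cdot> (\<iota> X \<otimes> MMul A') \<cdot> \<alpha> X ?B ?B"
    have "b \<cdot> (q \<otimes> \<iota> ?B) \<cdot> inverse_arr (\<alpha> X ?B ?B) = (b \<cdot> (q \<otimes> \<iota> ?B)) \<cdot> inverse_arr (\<alpha> X ?B ?B)" using that by simp
    then show "b \<cdot> (q \<otimes> \<iota> ?B) \<cdot> inverse_arr (\<alpha> X ?B ?B) = q \<cdot> (\<iota> X \<otimes> MMul A')" unfolding e by simp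
  qed
  then have "(THE b. b \<in> hom C (Cod C q \<odot> ?B) (Cod C q) \<and> b \<cdot> (q \<otimes> \<iota> ?B) \<cdot> inverse_arr (\<alpha> X ?B ?B) = q \<cdot> (\<iota> X \<otimes> MMul A')) =
    (THE b. b \<in> hom C (Cod C q \<odot> ?B) (Cod C q) \<and> b \<cdot> (q \<otimes> \<iota> ?B) = q \<cdot> (\<iota> X \<otimes> MMul A') \<cdot> \<alpha> X ?B ?B)"
    by (intro arg_cong[of _ _ The] ext) blast
  then show ?thesis
    unfolding left_ind_obj_def right_ind_obj_def ind_proj_reverse[OF M] Let_def q_def[symmetric]
    by (simp add: M')
qed

end

end

text \<open>Every axiom comes in two mirror halves that are interchanged: the two adjunctions of
  closedness and the two unit conditions. The pushout product of \<open>f\<close> and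
  \<open>g\<close> becomes that of \<open>g\<close> and \<open>f\<close>.\<close>

lemma monoidal_model_category_reverse:
  assumes C: "monoidal_model_category u C"
  shows "monoidal_model_category u (reverse C)"
proof -
  have "closed_monoidal C" using C by (simp add: monoidal_model_category_def)
  then interpret closed_monoidal_category C by unfold_locales
  have tens: "fix_fst C (tensor_fctr (reverse C)) = fix_snd C (tensor_fctr C)"
    "fix_snd C (tensor_fctr (reverse C)) = fix_fst C (tensor_fctr C)"
    by (simp_all add: fix_fst_def fix_snd_def tensor_fctr_def fun_eq_iff)
  have 1: "closed_monoidal (reverse C)"
    using closed monoidal_category_reverse unfolding closed_monoidal_def
    by (simp only: reverse_simps hom_reverse constructions_reverse functor_reverse adjunction_reverse tens)
  have 2: "is_pushout_product C g f k" if po: "is_pushout_product (reverse C) f g k" for f g k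
  proof -
    obtain i j where ij: "is_pushout C (g \<otimes>\<^bsub>C\<^esub> Ident C (Dom C f)) (Ident C (Dom C g) \<otimes>\<^bsub>C\<^esub> f) i j"
      "k \<in> hom C (Cod C i) (Cod C g \<odot>\<^bsub>C\<^esub> Cod C f)" "k \<cdot>\<^bsub>C\<^esub> i = Ident C (Cod C g) \<otimes>\<^bsub>C\<^esub> f" "k \<cdot>\<^bsub>C\<^esub> j = g \<otimes>\<^bsub>C\<^esub> Ident C (Cod C f)"
      using po unfolding is_pushout_product_def limits_reverse hom_reverse reverse_simps by blast
    let ?x = "g \<otimes>\<^bsub>C\<^esub> Ident C (Dom C f)" and ?y = "Ident C (Dom C g) \<otimes>\<^bsub>C\<^esub> f"
    have p: "?x \<in> Arr C" "?y \<in> Arr C" "Dom C ?x = Dom C ?y" "i \<in> hom C (Cod C ?x) (Cod C i)" "j \<in> hom C (Cod C ?y) (Cod C i)"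
      "i \<cdot>\<^bsub>C\<^esub> ?x = j \<cdot>\<^bsub>C\<^esub> ?y" "Cod C j = Cod C i"
      using ij(1) unfolding is_pushout_def by auto
    have "is_pushout C ?y ?x j i"
    proof (rule is_pushoutI[where L = "Cod C i"])
      fix Z v w assume vw: "v \<in> hom C (Cod C ?y) Z" "w \<in> hom C (Cod C ?x) Z" "v \<cdot>\<^bsub>C\<^esub> ?y = w \<cdot>\<^bsub>C\<^esub> ?x"
      show "\<exists>!h. h \<in> hom C (Cod C i) Z \<and> h \<cdot>\<^bsub>C\<^esub> j = v \<and> h \<cdot>\<^bsub>C\<^esub> i = w"
        using pushout_induced[OF ij(1) vw(2,1) vw(3)[symmetric]] by (simp only: conj_ac)
    qed (use p in simp_all)
    then show ?thesis unfolding is_pushout_product_def using ij(2-4) p(7) by metis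
  qed
  show ?thesis
    using C 1 2 unfolding monoidal_model_category_def model_category_reverse reverse_simps by blast
qed

text \<open>The functor records are total functions, and reversed left induction agrees with right
  induction only on actual modules; being a Quillen equivalence depends only on those
  values.\<close>

lemma quillen_equivalence_cong:
  assumes Q: "quillen_equivalence u C D F U"
    and o: "\<And>X. X \<in> Obj C \<Longrightarrow> on_obj F' X = on_obj F X" and a: "\<And>x. x \<in> Arr C \<Longrightarrow> on_arr F' x = on_arr F x"
  shows "quillen_equivalence u C D F' U"
proof -
  obtain \<phi> where L: "left_quillen u C D F U \<phi>" and
    W: "\<forall>X \<in> Obj C. \<forall>Y \<in> Obj D. cofibrant C X \<and> fibrant D Y \<longrightarrow>
      (\<forall>h \<in> hom D (on_obj F X) Y. h \<in> Weq D \<longleftrightarrow> \<phi> X Y h \<in> Weq C)"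
    using Q unfolding quillen_equivalence_def by blast
  have adj: "adjunction C D F U \<phi>" and M: "model_category u C" using L by (simp_all add: left_quillen_def)
  note F = adjunctionD(1)[OF adj]
  interpret category C by (rule functorD[OF F])
  have cof: "Cof C \<subseteq> Arr C" using M by (simp add: model_category_def wide_subcategory_def)
  have "is_functor C D F'"
    using F unfolding is_functor_def by (simp add: o a)
  then have "adjunction C D F' U \<phi>"
    using adj unfolding adjunction_def by (simp add: o a)
  then have "left_quillen u C D F' U \<phi>"
    using L cof a unfolding left_quillen_def by (auto simp: subset_iff)
  then show ?thesis
    unfolding quillen_equivalence_def using W o by (intro exI[of _ \<phi>]) simp
qed

theorem theorem2p4:
  fixes C :: "('o, 'm, 'z) monoidal_model_cat_scheme"
    and A A' :: "('o, 'm) mon"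
    and f :: 'm
  assumes universe: "infinite (UNIV :: 'u set)"
    and C: "monoidal_model_category TYPE('u) C"
    and generated: "\<exists>I J. cofibrantly_generated_by TYPE('u) C I J \<and>
      (\<forall>i \<in> I. cofibrant C (Dom C i))"
    and A: "monoid_in C A" "cofibrant C (MObj A)"
    and A': "monoid_in C A'" "cofibrant C (MObj A')"
    and f: "monoid_hom_in C A A' f" "f \<in> Weq C"
    and left_model_structures: "model_category TYPE('u) (left_modules C A)"
      "model_category TYPE('u) (left_modules C A')"
    and right_model_structures: "model_category TYPE('u) (right_modules C A)"
      "model_category TYPE('u) (right_modules C A')"
  shows "quillen_equivalence TYPE('u) (left_modules C A) (left_modules C A')
      (left_induction C A A' f) (left_restriction C f) \<and>
    quillen_equivalence TYPE('u) (right_modules C A) (right_modules C A')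
      (right_induction C A A' f) (right_restriction C f)"
proof
  show "quillen_equivalence TYPE('u) (left_modules C A) (left_modules C A')
      (left_induction C A A' f) (left_restriction C f)"
    by (rule monoid_morphism.left_quillen_equivalence[OF _ A(2) A'(2) f(2) left_model_structures])
      (use universe C A A' f in unfold_locales)
next
  interpret monoidal_model_structure "TYPE('u)" C using universe C by unfold_locales
  let ?R = "reverse C"
  have RA: "monoid_in ?R A" "monoid_in ?R A'" and Rf: "monoid_hom_in ?R A A' f"
    using monoid_in_reverse A(1) A'(1) monoid_hom_in_reverse f(1) by blast+
  note RC = monoidal_model_category_reverse[OF C]
  note mods = left_modules_reverse[OF A(1)] left_modules_reverse[OF A'(1)]
  have res: "left_restriction ?R f = right_restriction C f"
    by (simp add: left_restriction_def right_restriction_def left_res_obj_def right_res_obj_def)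
  interpret R: monoid_morphism "TYPE('u)" ?R A A' f
    using universe RC RA Rf by unfold_locales
  have Q: "quillen_equivalence TYPE('u) (right_modules C A) (right_modules C A')
      (left_induction ?R A A' f) (left_restriction ?R f)"
    using R.left_quillen_equivalence A(2) A'(2) f(2) right_model_structures by (simp add: mods)
  \<comment> \<open>Agreement of the two inductions on right modules; the typing needed for the
    action comes from the projection lemmas in the reversed category.\<close>
  have p: "left_ind_proj ?R A A' f M = right_ind_proj C A A' f M"
    and o: "left_ind_obj ?R A A' f M = right_ind_obj C A A' f M" if M: "right_module C A M" for M
  proof -
    show p: "left_ind_proj ?R A A' f M = right_ind_proj C A A' f M"
      by (rule ind_proj_reverse[OF A(1) A'(1) f(1) M])
    have "left_module ?R A M" using M left_module_reverse[OF A(1)] by simp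
    from R.proj_simps[OF this] show "left_ind_obj ?R A A' f M = right_ind_obj C A A' f M"
      by (intro ind_obj_reverse[OF A(1) A'(1) f(1) M]) (simp_all add: p)
  qed
  have "Obj (right_modules C A) = {M. right_module C A M}"
    and *: "x \<in> Arr (right_modules C A) \<Longrightarrow> right_module C A (fst x) \<and> right_module C A (snd (snd x))" for x
    by (auto simp: right_modules_def module_model_def right_mod_cat_def)
  then show "quillen_equivalence TYPE('u) (right_modules C A) (right_modules C A')
      (right_induction C A A' f) (right_restriction C f)"
    using *
    by (intro quillen_equivalence_cong[OF Q[unfolded res]])
      (simp_all add: left_induction_def right_induction_def case_prod_beta p o)
qed

end
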